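(* For every $w\in\mathrm{Trop}(X(L)^\circ)$ one has $$\mathrm{In}_w\,J(L)=J(L_w)$$ as ideals of $S$. In particular, the embedding $X(L)\hookrightarrow\mathbb{A}^n$ is well-poised, i.e. $\mathrm{In}_w J(L)$ is a prime ideal for every $w\in\mathrm{Trop}(X(L)^\circ)$.
   Context: $\mathbb{K}$ is an algebraically closed field. $T$ is an algebraic torus with character lattice $M$ and cocharacter lattice $N$. Fix $m\geq 1$, a pointed polyhedral cone $\sigma\subset N_\mathbb{Q}$, and $\Delta_0,\dots,\Delta_m$, each either empty or a polyhedron in $N_\mathbb{Q}$ with tailcone $\{v:\Delta_i+v\subseteq\Delta_i\}=\sigma$, such that $\sum_i\Delta_i\subsetneq\sigma$. For $u\in\sigma^\vee$ let $\Delta_i(u)=\min_{v\in\Delta_i}\langle v,u\rangle$, and $\Delta_i(u)=\infty$ if $\Delta_i=\emptyset$. Let $e_1,\dots,e_m$ be the standard basis of $\mathbb{Q}^m$, $e_0=-\sum_{i\ge1}e_i$, and let $C\subset N_\mathbb{Q}\times\mathbb{Q}^m$ be the (pointed) cone generated by $\sigma\times0$ and all $\Delta_i\times e_i$. Put $A(C)=\mathbb{K}[C^\vee\cap(M\times\mathbb{Z}^m)]$, with monomials $\chi^{(u,v)}=z^v\chi^u$, and $X(C)=\mathrm{Spec}\,A(C)$. For any line $L\subset\mathbb{P}^m=\mathrm{Proj}\,\mathbb{K}[y_0,\dots,y_m]$ meeting the dense torus $(\mathbb{K}^* )^m$ (with coordinates $z_i=y_i/y_0$), let $L^\circ=L\cap(\mathbb{K}^*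 )^m$, $I(L)\subset\mathbb{K}[z_1^{\pm1},\dots,z_m^{\pm1}]$ its ideal, $Q_i$ the restriction of $V(y_i)$ to $L$, and $$A(L)=\bigoplus_{u\in\sigma^\vee\cap M}H^0\Big(L,\mathcal{O}\big(\textstyle\sum_i\lfloor\Delta_i(u)\rfloor Q_i\big)\Big)\cdot\chi^u,\qquad X(L)=\mathrm{Spec}\,A(L)$$ (a coefficient $\infty$ allows poles of arbitrary order). Restriction $z^v\chi^u\mapsto z^v|_L\,\chi^u$ gives a surjection $A(C)\to A(L)$, hence a closed embedding $X(L)\subset X(C)$. Fix a finite generating set $H$ of the semigroup $C^\vee\cap(M\times\mathbb{Z}^m)$, $n=\#H$, $S=\mathbb{K}[x_h\mid h\in H]$; this gives closed embeddings $X(L)\subset X(C)\subset\mathbb{A}^n$, and $J(L)\subset S$ is the ideal of $X(L)$, i.e. the kernel of $S\to A(C)\to A(L)$, $x_h\mapsto\chi^h$. Set $X(L)^\circ=X(L)\cap(\mathbb{K}^* )^n$. For a weight $w$, the initial form $\mathrm{In}_w(f)$ of $f$ is the sum of its terms of minimal $w$-weight, and $\mathrm{In}_w(I)$ is the ideal generated by $\mathrm{In}_w(f)$, $f\in I$. $\mathrm{Trop}(X(L)^\circ)\subset\mathbb{R}^n$ is the set of $w$ such that $\mathrm{In}_w(J(L))$ contains no monomial. It is contained in the image of the injective linear map $\phi:(N\oplus\mathbb{Z}^m)_\mathbb{R}\to\mathbb{R}^{\#H}$, $a\mapsto(\langle a,h\rangle)_{h\in H}$. Hence $w=\phi(a,b)$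 for unique $a\in N_\mathbb{R}$, $b\in\mathbb{R}^m$, and $w$ defines a weight on monomials of $\mathbb{K}[\mathbb{Z}^m]=\mathbb{K}[z_1^{\pm1},\dots,z_m^{\pm1}]$ by giving $z^v$ weight $\langle b,v\rangle$. Define $L_w=\overline{V(\mathrm{In}_w I(L))}\subset\mathbb{P}^m$; this is a line in $\mathbb{P}^m$ meeting the dense torus. Let $Q_{i,w}$ be the restriction of $V(y_i)$ to $L_w$ and $$A(L_w)=\bigoplus_{u\in\sigma^\vee\cap M}H^0\Big(L_w,\mathcal{O}\big(\textstyle\sum_i\lfloor\Delta_i(u)\rfloor Q_{i,w}\big)\Big)\cdot\chi^u$$ (same $\Delta_i$, $C$, $H$); then $J(L_w)\subset S$ denotes the kernel of the composition $S\to A(C)\to A(L_w)$, where the first map is $x_h\mapsto\chi^h$ and the second is the restriction map $z^v\chi^u\mapsto z^v|_{L_w}\,\chi^u$, i.e. $J(L_w)$ is the ideal of $X(L_w)=\mathrm{Spec}\,A(L_w)$ in $\mathbb{A}^n$. *)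

theory Defs
  imports
    "HOL-Algebra.RingHom"
    "HOL-Computational_Algebra.Fraction_Field"
    "HOL-Computational_Algebra.Polynomial"
    "HOL-Library.Poly_Mapping"
    "HOL-Library.Product_Plus"
    "HOL-Library.Set_Algebras"
    "HOL-Library.Extended_Real"
begin

section \<open>Lattices, cones and polyhedra\<close>

text \<open>
  A torus \<open>T\<close> of rank \<open>r\<close> (possibly \<open>r = 0\<close>) is given in coordinates. The set
  \<open>coord_space r\<close> of vectors supported on \<open>{1..r}\<close> is \<open>M\<close> with \<open>int\<close> entries, and \<open>N\<^sub>\<rat>\<close> and
  \<open>N\<^sub>\<real>\<close> with \<open>rat\<close> and \<open>real\<close> entries. In the same way \<open>coord_space m\<close> serves as
  \<open>\<int>\<close>, \<open>\<rat>\<close> or \<open>\<real>\<close> to the power \<open>m\<close>.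
\<close>

definition coord_space :: "nat \<Rightarrow> (nat \<Rightarrow>\<^sub>0 'a::zero) set" where
  "coord_space n = {v. Poly_Mapping.keys v \<subseteq> {1..n}}"

definition pairing :: "(nat \<Rightarrow>\<^sub>0 'a::ring_1) \<Rightarrow> (nat \<Rightarrow>\<^sub>0 int) \<Rightarrow> 'a" where
  "pairing v u = (\<Sum>i\<in>Poly_Mapping.keys u. Poly_Mapping.lookup v i * of_int (Poly_Mapping.lookup u i))"

definition vscale :: "rat \<Rightarrow> (nat \<Rightarrow>\<^sub>0 rat) \<Rightarrow> (nat \<Rightarrow>\<^sub>0 rat)" where
  "vscale c v = Poly_Mapping.map ((*) c) v"

definition pscale :: "rat \<Rightarrow> (nat \<Rightarrow>\<^sub>0 rat) \<times> (nat \<Rightarrow>\<^sub>0 rat) \<Rightarrow> (nat \<Rightarrow>\<^sub>0 rat) \<times> (nat \<Rightarrow>\<^sub>0 rat)" where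
  "pscale c p = (vscale c (fst p), vscale c (snd p))"

definition cone_gen :: "(rat \<Rightarrow> 'v \<Rightarrow> 'v::comm_monoid_add) \<Rightarrow> 'v set \<Rightarrow> 'v set" where
  "cone_gen sc X = {\<Sum>x\<in>F. sc (c x) x | F c. finite F \<and> F \<subseteq> X \<and> (\<forall>x\<in>F. 0 \<le> c x)}"

definition pointed_polyhedral_cone :: "nat \<Rightarrow> (nat \<Rightarrow>\<^sub>0 rat) set \<Rightarrow> bool" where
  "pointed_polyhedral_cone r \<sigma> \<longleftrightarrow>
     (\<exists>B. finite B \<and> B \<subseteq> coord_space r \<and> \<sigma> = cone_gen vscale B) \<and>
     (\<forall>v. v \<in> \<sigma> \<and> - v \<in> \<sigma> \<longrightarrow> v = 0)"

text \<open>Every linear form on \<open>N\<^sub>\<rat>\<close> is a positive multiple of one in \<open>M\<close>, so normals may be taken in \<open>M\<close>.\<close>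

definition rat_polyhedron :: "nat \<Rightarrow> (nat \<Rightarrow>\<^sub>0 rat) set \<Rightarrow> bool" where
  "rat_polyhedron r P \<longleftrightarrow>
     (\<exists>B. finite B \<and> B \<subseteq> coord_space r \<times> UNIV \<and>
          P = {v \<in> coord_space r. \<forall>(u, a)\<in>B. a \<le> pairing v u})"

definition tailcone :: "nat \<Rightarrow> (nat \<Rightarrow>\<^sub>0 rat) set \<Rightarrow> (nat \<Rightarrow>\<^sub>0 rat) set" where
  "tailcone r P = {v \<in> coord_space r. (\<lambda>x. x + v) ` P \<subseteq> P}"

text \<open>The lattice points \<open>\<sigma>\<^sup>\<or> \<inter> M\<close>.\<close>

definition dual_pts :: "nat \<Rightarrow> (nat \<Rightarrow>\<^sub>0 rat) set \<Rightarrow> (nat \<Rightarrow>\<^sub>0 int) set" where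
  "dual_pts r \<sigma> = {u \<in> coord_space r. \<forall>v\<in>\<sigma>. 0 \<le> pairing v u}"

text \<open>The integer \<open>\<lfloor>\<Delta>(u)\<rfloor>\<close>, or \<open>\<infinity>\<close>; for \<open>u\<close> in the dual of the tailcone the minimum exists.\<close>

definition floor_min :: "(nat \<Rightarrow>\<^sub>0 rat) set \<Rightarrow> (nat \<Rightarrow>\<^sub>0 int) \<Rightarrow> ereal" where
  "floor_min P u =
     (if P = {} then \<infinity> else ereal (of_int \<lfloor>LEAST q. q \<in> (\<lambda>v. pairing v u) ` P\<rfloor>))"

definition e_vec :: "nat \<Rightarrow> nat \<Rightarrow> (nat \<Rightarrow>\<^sub>0 rat)" where
  "e_vec m i = (if i = 0 then - (\<Sum>j=1..m. Poly_Mapping.single j 1) else Poly_Mapping.single i 1)"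

definition big_cone :: "nat \<Rightarrow> (nat \<Rightarrow>\<^sub>0 rat) set \<Rightarrow> (nat \<Rightarrow> (nat \<Rightarrow>\<^sub>0 rat) set)
    \<Rightarrow> ((nat \<Rightarrow>\<^sub>0 rat) \<times> (nat \<Rightarrow>\<^sub>0 rat)) set" where
  "big_cone m \<sigma> \<Delta> = cone_gen pscale (\<sigma> \<times> {0} \<union> (\<Union>i\<le>m. \<Delta> i \<times> {e_vec m i}))"

text \<open>Exponents \<open>(u, v) \<in> M \<times> \<int>\<^sup>m\<close>.\<close>

type_synonym expo = "(nat \<Rightarrow>\<^sub>0 int) \<times> (nat \<Rightarrow>\<^sub>0 int)"

definition dual_pts2 :: "nat \<Rightarrow> nat \<Rightarrow> ((nat \<Rightarrow>\<^sub>0 rat) \<times> (nat \<Rightarrow>\<^sub>0 rat)) set \<Rightarrow> expo set" where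
  "dual_pts2 r m C =
     {(u, v). u \<in> coord_space r \<and> v \<in> coord_space m \<and> (\<forall>(a, b)\<in>C. 0 \<le> pairing a u + pairing b v)}"


section \<open>Rings and initial ideals\<close>

definition carrier_ring :: "'a::comm_ring_1 set \<Rightarrow> 'a ring" where
  "carrier_ring A = \<lparr>carrier = A, monoid.mult = (*), one = 1, ring.zero = 0, add = (+)\<rparr>"

text \<open>The polynomial ring over a field in the variables \<open>x\<^sub>h\<close>, \<open>h \<in> H\<close>.\<close>

definition mpoly_ring :: "'x set \<Rightarrow> (('x \<Rightarrow>\<^sub>0 nat) \<Rightarrow>\<^sub>0 'k::field) ring" where
  "mpoly_ring H = carrier_ring {f. \<forall>\<mu>\<in>Poly_Mapping.keys f. Poly_Mapping.keys \<mu> \<subseteq> H}"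

text \<open>The Laurent polynomial ring in \<open>z\<^sub>1, \<dots>, z\<^sub>m\<close>.\<close>

definition laurent_ring :: "nat \<Rightarrow> ((nat \<Rightarrow>\<^sub>0 int) \<Rightarrow>\<^sub>0 'k::field) ring" where
  "laurent_ring m = carrier_ring {f. Poly_Mapping.keys f \<subseteq> coord_space m}"

definition initial_form :: "('e \<Rightarrow> real) \<Rightarrow> ('e \<Rightarrow>\<^sub>0 'k::comm_monoid_add) \<Rightarrow> ('e \<Rightarrow>\<^sub>0 'k)" where
  "initial_form wt f =
     (\<Sum>e\<in>{e \<in> Poly_Mapping.keys f. \<forall>e'\<in>Poly_Mapping.keys f. wt e \<le> wt e'}.
        Poly_Mapping.single e (Poly_Mapping.lookup f e))"

definition initial_ideal ::
    "('e \<Rightarrow>\<^sub>0 'k::comm_monoid_add) ring \<Rightarrow> ('e \<Rightarrow> real) \<Rightarrow> ('e \<Rightarrow>\<^sub>0 'k) set \<Rightarrow> ('e \<Rightarrow>\<^sub>0 'k) set" where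
  "initial_ideal R wt I = genideal R (initial_form wt ` I)"

definition poly_weight :: "('x \<Rightarrow> real) \<Rightarrow> ('x \<Rightarrow>\<^sub>0 nat) \<Rightarrow> real" where
  "poly_weight w \<mu> = (\<Sum>h\<in>Poly_Mapping.keys \<mu>. real (Poly_Mapping.lookup \<mu> h) * w h)"


section \<open>Projective space and lines\<close>

text \<open>A point of \<open>\<P>\<^sup>m\<close> is the set of all its vectors of homogeneous_mpoly coordinates \<open>y\<^sub>0, \<dots>, y\<^sub>m\<close>.\<close>

type_synonym 'k ppoint = "(nat \<Rightarrow> 'k) set"

definition proj_pt :: "(nat \<Rightarrow> 'k::field) \<Rightarrow> 'k ppoint" where
  "proj_pt y = {\<lambda>i. c * y i | c. c \<noteq> 0}"

definition hcoords :: "nat \<Rightarrow> (nat \<Rightarrow> 'k::zero) set" where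
  "hcoords m = {y. \<forall>i>m. y i = 0}"

definition proj_space :: "nat \<Rightarrow> 'k::field ppoint set" where
  "proj_space m = {proj_pt y | y. y \<in> hcoords m \<and> y \<noteq> (\<lambda>_. 0)}"

definition coord_hyperplane :: "nat \<Rightarrow> 'k::field ppoint set" where
  "coord_hyperplane i = {P. \<forall>y\<in>P. y i = 0}"

definition line_basis :: "nat \<Rightarrow> 'k::field ppoint set \<Rightarrow> (nat \<Rightarrow> 'k) \<times> (nat \<Rightarrow> 'k) \<Rightarrow> bool" where
  "line_basis m L = (\<lambda>(p, q). p \<in> hcoords m \<and> q \<in> hcoords m \<and>
     (\<forall>s t. (\<forall>i. s * p i + t * q i = 0) \<longrightarrow> s = 0 \<and> t = 0) \<and>
     L = {proj_pt (\<lambda>i. s * p i + t * q i) | s t. (s, t) \<noteq> (0, 0)})"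

definition is_line :: "nat \<Rightarrow> 'k::field ppoint set \<Rightarrow> bool" where
  "is_line m L \<longleftrightarrow> (\<exists>pq. line_basis m L pq)"

definition split_torus :: "nat \<Rightarrow> (nat \<Rightarrow> 'k::field) set" where
  "split_torus m = {z. (\<forall>i\<in>{1..m}. z i \<noteq> 0) \<and> (\<forall>i. i \<notin> {1..m} \<longrightarrow> z i = 0)}"

definition torus_pt :: "(nat \<Rightarrow> 'k::field) \<Rightarrow> 'k ppoint" where
  "torus_pt z = proj_pt (z(0 := 1))"

text \<open>\<open>L\<^sup>\<circ>\<close> as a subset of the torus, in the coordinates \<open>z\<^sub>i = y\<^sub>i / y\<^sub>0\<close>.\<close>

definition open_part :: "nat \<Rightarrow> 'k::field ppoint set \<Rightarrow> (nat \<Rightarrow> 'k) set" where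
  "open_part m L = {z \<in> split_torus m. torus_pt z \<in> L}"

definition laurent_eval :: "((nat \<Rightarrow>\<^sub>0 int) \<Rightarrow>\<^sub>0 'k::field) \<Rightarrow> (nat \<Rightarrow> 'k) \<Rightarrow> 'k" where
  "laurent_eval f z = (\<Sum>v\<in>Poly_Mapping.keys f. Poly_Mapping.lookup f v *
     (\<Prod>i\<in>Poly_Mapping.keys v. z i powi Poly_Mapping.lookup v i))"

definition line_ideal :: "nat \<Rightarrow> 'k::field ppoint set \<Rightarrow> ((nat \<Rightarrow>\<^sub>0 int) \<Rightarrow>\<^sub>0 'k) set" where
  "line_ideal m L = {f \<in> carrier (laurent_ring m). \<forall>z\<in>open_part m L. laurent_eval f z = 0}"

definition torus_locus :: "nat \<Rightarrow> ((nat \<Rightarrow>\<^sub>0 int) \<Rightarrow>\<^sub>0 'k::field) set \<Rightarrow> (nat \<Rightarrow> 'k) set" where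
  "torus_locus m I = {z \<in> split_torus m. \<forall>f\<in>I. laurent_eval f z = 0}"

definition mpoly_eval :: "((nat \<Rightarrow>\<^sub>0 nat) \<Rightarrow>\<^sub>0 'k::field) \<Rightarrow> (nat \<Rightarrow> 'k) \<Rightarrow> 'k" where
  "mpoly_eval F y = (\<Sum>\<mu>\<in>Poly_Mapping.keys F. Poly_Mapping.lookup F \<mu> *
     (\<Prod>i\<in>Poly_Mapping.keys \<mu>. y i ^ Poly_Mapping.lookup \<mu> i))"

definition homogeneous_mpoly :: "((nat \<Rightarrow>\<^sub>0 nat) \<Rightarrow>\<^sub>0 'k::field) \<Rightarrow> bool" where
  "homogeneous_mpoly F \<longleftrightarrow>
     (\<exists>d. \<forall>\<mu>\<in>Poly_Mapping.keys F. (\<Sum>i\<in>Poly_Mapping.keys \<mu>. Poly_Mapping.lookup \<mu> i) = d)"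

text \<open>Zariski closure in \<open>\<P>\<^sup>m\<close>.\<close>

definition proj_closure :: "nat \<Rightarrow> 'k::field ppoint set \<Rightarrow> 'k ppoint set" where
  "proj_closure m X = {P \<in> proj_space m. \<forall>F\<in>carrier (mpoly_ring {0..m}).
     homogeneous_mpoly F \<and> (\<forall>P'\<in>X. \<forall>y\<in>P'. mpoly_eval F y = 0) \<longrightarrow> (\<forall>y\<in>P. mpoly_eval F y = 0)}"


section \<open>The function field and sections of divisors\<close>

text \<open>
  A basis \<open>(p, q)\<close> of the plane over \<open>L\<close> gives the affine coordinate \<open>t\<close> on \<open>L\<close> for which
  \<open>t \<mapsto> [p + t q]\<close> and \<open>\<infinity> \<mapsto> [q]\<close>, and so identifies the function field of \<open>L\<close> with the field of
  rational functions in \<open>t\<close>. We fix one such basis for every line; another choice changes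
  \<open>A(L)\<close> by a Moebius substitution in \<open>t\<close> only. The point \<open>\<infinity>\<close> is \<open>None\<close>.
\<close>

definition the_basis :: "nat \<Rightarrow> 'k::field ppoint set \<Rightarrow> (nat \<Rightarrow> 'k) \<times> (nat \<Rightarrow> 'k)" where
  "the_basis m L = (SOME pq. line_basis m L pq)"

fun line_pt :: "(nat \<Rightarrow> 'k::field) \<times> (nat \<Rightarrow> 'k) \<Rightarrow> 'k option \<Rightarrow> 'k ppoint" where
  "line_pt (p, q) (Some t) = proj_pt (\<lambda>i. p i + t * q i)"
| "line_pt (p, q) None = proj_pt q"

fun poly_ord :: "'k::field option \<Rightarrow> 'k poly \<Rightarrow> int" where
  "poly_ord (Some t) a = int (Polynomial.order t a)"
| "poly_ord None a = - int (Polynomial.degree a)"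

text \<open>Order of vanishing of a nonzero rational function.\<close>

definition ratfun_ord :: "'k::field option \<Rightarrow> 'k poly fract \<Rightarrow> int" where
  "ratfun_ord x f =
     (THE n. \<exists>a b. a \<noteq> 0 \<and> b \<noteq> 0 \<and> f = Fraction_Field.Fract a b \<and> n = poly_ord x a - poly_ord x b)"

lemma poly_ord_mult: "a \<noteq> 0 \<Longrightarrow> b \<noteq> 0 \<Longrightarrow> poly_ord x (a * b) = poly_ord x a + poly_ord x b"
  by (cases x) (simp_all add: order_mult degree_mult_eq)

lemma ratfun_ord_Fract:
  assumes "a \<noteq> 0" "b \<noteq> 0"
  shows "ratfun_ord x (Fraction_Field.Fract a b) = poly_ord x a - poly_ord x b"
  unfolding ratfun_ord_def
proof (rule the_equality)
  fix n
  assume "\<exists>c d. c \<noteq> 0 \<and> d \<noteq> 0 \<and> Fraction_Field.Fract a b = Fraction_Field.Fract c d \<and>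
    n = poly_ord x c - poly_ord x d"
  then obtain c d where cd: "c \<noteq> 0" "d \<noteq> 0"
      "Fraction_Field.Fract a b = Fraction_Field.Fract c d" "n = poly_ord x c - poly_ord x d"
    by blast
  then have "a * d = c * b" using assms by (simp add: Fraction_Field.eq_fract)
  then have "poly_ord x a + poly_ord x d = poly_ord x c + poly_ord x b"
    using assms cd by (metis poly_ord_mult)
  then show "n = poly_ord x a - poly_ord x b" using cd by simp
qed (use assms in blast)

text \<open>
  The global sections of \<open>\<O>(D)\<close> on \<open>L\<close>. A divisor is given by its coefficients at the points;
  the coefficient \<open>\<infinity>\<close> imposes no condition.
\<close>

definition global_sections :: "nat \<Rightarrow> 'k::field ppoint set \<Rightarrow> ('k ppoint \<Rightarrow> ereal) \<Rightarrow> 'k poly fract set" where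
  "global_sections m L D =
     {f. f = 0 \<or> (\<forall>x. 0 \<le> ereal (of_int (ratfun_ord x f)) + D (line_pt (the_basis m L) x))}"

text \<open>
  \<open>\<Sum>\<^sub>i \<lfloor>\<Delta>\<^sub>i(u)\<rfloor> Q\<^sub>i\<close>. Each \<open>Q\<^sub>i\<close> is a point with multiplicity one, since \<open>y\<^sub>i\<close> restricts to a nonzero
  linear form on a line meeting the torus; the \<open>Q\<^sub>i\<close> need not be distinct.
\<close>

definition line_divisor :: "nat \<Rightarrow> (nat \<Rightarrow> (nat \<Rightarrow>\<^sub>0 rat) set) \<Rightarrow> (nat \<Rightarrow>\<^sub>0 int) \<Rightarrow> 'k::field ppoint \<Rightarrow> ereal" where
  "line_divisor m \<Delta> u P = (\<Sum>i\<le>m. if P \<in> coord_hyperplane i then floor_min (\<Delta> i) u else 0)"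


section \<open>The algebras and their ideals\<close>

definition alg_C :: "nat \<Rightarrow> nat \<Rightarrow> (nat \<Rightarrow>\<^sub>0 rat) set \<Rightarrow> (nat \<Rightarrow> (nat \<Rightarrow>\<^sub>0 rat) set)
    \<Rightarrow> (expo \<Rightarrow>\<^sub>0 'k::field) ring" where
  "alg_C r m \<sigma> \<Delta> = carrier_ring {g. Poly_Mapping.keys g \<subseteq> dual_pts2 r m (big_cone m \<sigma> \<Delta>)}"

definition alg_L :: "nat \<Rightarrow> nat \<Rightarrow> (nat \<Rightarrow>\<^sub>0 rat) set \<Rightarrow> (nat \<Rightarrow> (nat \<Rightarrow>\<^sub>0 rat) set)
    \<Rightarrow> 'k::field ppoint set \<Rightarrow> ((nat \<Rightarrow>\<^sub>0 int) \<Rightarrow>\<^sub>0 'k poly fract) ring" where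
  "alg_L r m \<sigma> \<Delta> L = carrier_ring {g. Poly_Mapping.keys g \<subseteq> dual_pts r \<sigma> \<and>
     (\<forall>u\<in>dual_pts r \<sigma>. Poly_Mapping.lookup g u \<in> global_sections m L (line_divisor m \<Delta> u))}"

text \<open>The homomorphism \<open>S \<rightarrow> A(C)\<close>, \<open>x\<^sub>h \<mapsto> \<chi>\<^sup>h\<close>.\<close>

definition toric_map :: "((expo \<Rightarrow>\<^sub>0 nat) \<Rightarrow>\<^sub>0 'k::field) \<Rightarrow> (expo \<Rightarrow>\<^sub>0 'k)" where
  "toric_map f = (\<Sum>\<mu>\<in>Poly_Mapping.keys f. Poly_Mapping.single 0 (Poly_Mapping.lookup f \<mu>) *
     (\<Prod>h\<in>Poly_Mapping.keys \<mu>. Poly_Mapping.single h 1 ^ Poly_Mapping.lookup \<mu> h))"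

text \<open>The rational function \<open>z\<^sub>i|\<^sub>L = (p\<^sub>i + t q\<^sub>i) / (p\<^sub>0 + t q\<^sub>0)\<close>.\<close>

definition z_on_line :: "nat \<Rightarrow> 'k::field ppoint set \<Rightarrow> nat \<Rightarrow> 'k poly fract" where
  "z_on_line m L i = (case the_basis m L of (p, q) \<Rightarrow> Fraction_Field.Fract [:p i, q i:] [:p 0, q 0:])"

text \<open>The restriction map \<open>A(C) \<rightarrow> A(L)\<close>, \<open>z\<^sup>v \<chi>\<^sup>u \<mapsto> z\<^sup>v|\<^sub>L \<chi>\<^sup>u\<close>.\<close>

definition restrict_map :: "nat \<Rightarrow> 'k::field ppoint set \<Rightarrow> (expo \<Rightarrow>\<^sub>0 'k)
    \<Rightarrow> ((nat \<Rightarrow>\<^sub>0 int) \<Rightarrow>\<^sub>0 'k poly fract)" where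
  "restrict_map m L g = (\<Sum>(u, v)\<in>Poly_Mapping.keys g.
     Poly_Mapping.single u (Fraction_Field.Fract [:Poly_Mapping.lookup g (u, v):] 1 *
       (\<Prod>i\<in>Poly_Mapping.keys v. z_on_line m L i powi Poly_Mapping.lookup v i)))"

definition ideal_J :: "nat \<Rightarrow> nat \<Rightarrow> (nat \<Rightarrow>\<^sub>0 rat) set \<Rightarrow> (nat \<Rightarrow> (nat \<Rightarrow>\<^sub>0 rat) set) \<Rightarrow> expo set
    \<Rightarrow> 'k::field ppoint set \<Rightarrow> ((expo \<Rightarrow>\<^sub>0 nat) \<Rightarrow>\<^sub>0 'k) set" where
  "ideal_J r m \<sigma> \<Delta> H L =
     a_kernel (mpoly_ring H) (alg_L r m \<sigma> \<Delta> L) (restrict_map m L \<circ> toric_map)"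

text \<open>The tropicalization of \<open>X(L)\<^sup>\<circ>\<close>, as a subset of \<open>\<real>\<^sup>H\<close>.\<close>

definition trop_X :: "nat \<Rightarrow> nat \<Rightarrow> (nat \<Rightarrow>\<^sub>0 rat) set \<Rightarrow> (nat \<Rightarrow> (nat \<Rightarrow>\<^sub>0 rat) set) \<Rightarrow> expo set
    \<Rightarrow> 'k::field ppoint set \<Rightarrow> (expo \<Rightarrow> real) set" where
  "trop_X r m \<sigma> \<Delta> H L = {w \<in> extensional H. \<forall>\<mu>. Poly_Mapping.keys \<mu> \<subseteq> H \<longrightarrow>
     Poly_Mapping.single \<mu> 1 \<notin> initial_ideal (mpoly_ring H) (poly_weight w) (ideal_J r m \<sigma> \<Delta> H L)}"

definition weight_map :: "expo set \<Rightarrow> (nat \<Rightarrow>\<^sub>0 real) \<times> (nat \<Rightarrow>\<^sub>0 real) \<Rightarrow> (expo \<Rightarrow> real)" where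
  "weight_map H = (\<lambda>(a, b). \<lambda>(u, v)\<in>H. pairing a u + pairing b v)"

text \<open>
  The line \<open>L\<^sub>w\<close>. On \<open>trop_X\<close> the vector \<open>w\<close> has exactly one preimage \<open>(a, b)\<close> under \<open>weight_map H\<close>.
\<close>

definition initial_line :: "nat \<Rightarrow> nat \<Rightarrow> expo set \<Rightarrow> 'k::field ppoint set \<Rightarrow> (expo \<Rightarrow> real) \<Rightarrow> 'k ppoint set" where
  "initial_line r m H L w =
     (let (a, b) = inv_into (coord_space r \<times> coord_space m) (weight_map H) w
      in proj_closure m (torus_pt ` torus_locus m
           (initial_ideal (laurent_ring m) (pairing b) (line_ideal m L))))"


section \<open>Basic facts\<close>

lemma pairing_superset:
  "finite A \<Longrightarrow> Poly_Mapping.keys u \<subseteq> A \<Longrightarrow>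
     pairing v u = (\<Sum>i\<in>A. Poly_Mapping.lookup v i * of_int (Poly_Mapping.lookup u i))"
  unfolding pairing_def by (rule sum.mono_neutral_left) (auto simp: in_keys_iff)

lemma pairing_add: "pairing v (u + u') = pairing v u + pairing v u'"
proof -
  let ?A = "Poly_Mapping.keys u \<union> Poly_Mapping.keys u'"
  have "Poly_Mapping.keys (u + u') \<subseteq> ?A" by (rule Poly_Mapping.keys_add)
  then show ?thesis
    by (simp add: pairing_superset[of ?A] lookup_add distrib_left sum.distrib)
qed

lemma coord_space_add: "u \<in> coord_space n \<Longrightarrow> u' \<in> coord_space n \<Longrightarrow> u + u' \<in> coord_space n"
  for u u' :: "nat \<Rightarrow>\<^sub>0 int"
  unfolding coord_space_def using Poly_Mapping.keys_add[of u u'] by blast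

lemma dual_pts2_zero: "0 \<in> dual_pts2 r m C"
  by (auto simp: dual_pts2_def coord_space_def pairing_def zero_prod_def)

lemma dual_pts2_add: "x \<in> dual_pts2 r m C \<Longrightarrow> y \<in> dual_pts2 r m C \<Longrightarrow> x + y \<in> dual_pts2 r m C"
proof -
  assume x: "x \<in> dual_pts2 r m C" and y: "y \<in> dual_pts2 r m C"
  obtain u v u' v' where xy: "x = (u, v)" "y = (u', v')" by (cases x, cases y)
  have "0 \<le> pairing a (u + u') + pairing b (v + v')" if "(a, b) \<in> C" for a b
  proof -
    have "0 \<le> pairing a u + pairing b v" "0 \<le> pairing a u' + pairing b v'"
      using that x y by (auto simp: dual_pts2_def xy)
    then show ?thesis by (simp add: pairing_add)
  qed
  moreover have "u + u' \<in> coord_space r" "v + v' \<in> coord_space m"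
    using x y by (auto simp: dual_pts2_def xy intro: coord_space_add)
  ultimately show "x + y \<in> dual_pts2 r m C" by (auto simp: dual_pts2_def xy)
qed

lemma toric_map_alg_C:
  fixes f :: "(expo \<Rightarrow>\<^sub>0 nat) \<Rightarrow>\<^sub>0 'k::field"
  assumes H: "H \<subseteq> dual_pts2 r m (big_cone m \<sigma> \<Delta>)" and f: "f \<in> carrier (mpoly_ring H)"
  shows "toric_map f \<in> carrier (alg_C r m \<sigma> \<Delta>)"
proof -
  let ?D = "dual_pts2 r m (big_cone m \<sigma> \<Delta>)"
  let ?A = "{g :: expo \<Rightarrow>\<^sub>0 'k. Poly_Mapping.keys g \<subseteq> ?D}"
  have mult: "g * g' \<in> ?A" if "g \<in> ?A" "g' \<in> ?A" for g g'
  proof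
    have "a + b \<in> ?D" if "a \<in> Poly_Mapping.keys g" "b \<in> Poly_Mapping.keys g'" for a b
      using that \<open>g \<in> ?A\<close> \<open>g' \<in> ?A\<close> by (intro dual_pts2_add) auto
    then show "Poly_Mapping.keys (g * g') \<subseteq> ?D" using keys_mult[of g g'] by blast
  qed
  have one: "1 \<in> ?A" by (simp add: dual_pts2_zero)
  have pow: "g ^ n \<in> ?A" if "g \<in> ?A" for g n
  proof (induction n)
    case 0
    show ?case unfolding power_0 by (rule one)
  next
    case (Suc n)
    show ?case unfolding power_Suc by (rule mult[OF that Suc])
  qed
  have prod: "(\<Prod>h\<in>K. F h) \<in> ?A" if "\<And>h. h \<in> K \<Longrightarrow> F h \<in> ?A" for F and K :: "expo set"
    using that
  proof (induction K rule: infinite_finite_induct)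
    case (insert x K)
    then show ?case using mult[of "F x" "prod F K"] by simp
  qed (use one in simp_all)
  have "Poly_Mapping.single 0 (Poly_Mapping.lookup f \<mu>) *
     (\<Prod>h\<in>Poly_Mapping.keys \<mu>. Poly_Mapping.single h 1 ^ Poly_Mapping.lookup \<mu> h) \<in> ?A"
    if "\<mu> \<in> Poly_Mapping.keys f" for \<mu>
  proof (intro mult prod pow)
    show "Poly_Mapping.single 0 (Poly_Mapping.lookup f \<mu>) \<in> ?A" by (simp add: dual_pts2_zero)
    show "Poly_Mapping.single h 1 \<in> ?A" if "h \<in> Poly_Mapping.keys \<mu>" for h
      using that \<open>\<mu> \<in> _\<close> f H by (auto simp: mpoly_ring_def carrier_ring_def)
  qed
  then have "Poly_Mapping.keys (toric_map f) \<subseteq> ?D"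
    unfolding toric_map_def by (intro order_trans[OF keys_sum]) blast
  then show ?thesis by (simp add: alg_C_def carrier_ring_def)
qed

end

theory Submission
  imports Defs
begin

text \<open>
  Everything is read in the homogeneous coordinates \<open>y\<^sub>0, \<dots>, y\<^sub>m\<close>. In a fixed degree \<open>u\<close> the algebra \<open>A(C)\<close> has a basis
  of monomials \<open>z\<^sup>v\<close> of degree zero in \<open>y\<close> whose exponent at each \<open>y\<^sub>i\<close> is bounded below, with no bound if \<open>\<Delta>\<^sub>i\<close> is
  empty (\<open>dual_pts2_iff\<close>). An element of \<open>S\<close> lies in \<open>J(L)\<close> if and only if the coefficient of each \<open>\<chi>\<^sup>u\<close> of its image in
  \<open>A(C)\<close> lies in the ideal \<open>I(L)\<close> of Laurent polynomials (\<open>ideal_J_iff\<close>), so the theorem is a statement about \<open>I(L)\<close>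
  in each degree.

  Let \<open>b\<close> be a weight for \<open>z\<close>. Choose coordinates \<open>y\<^sub>j, y\<^sub>k\<close> that form a basis of the linear forms on \<open>L\<close> of maximal
  total weight (\<open>adapted_basis_exists\<close>). Then \<open>y\<^sub>i = p\<^sub>i y\<^sub>j + q\<^sub>i y\<^sub>k\<close> on \<open>L\<close>, where a term on the right that occurs is at
  least as heavy as \<open>y\<^sub>i\<close>. Dropping the heavier terms gives the equations of a limit line \<open>L0\<close>. Parametrise \<open>L\<close> by
  \<open>y\<^sub>j = 1\<close>, \<open>y\<^sub>k = t\<close>, and give \<open>t\<close> the weight of \<open>y\<^sub>k / y\<^sub>j\<close>. Then the leading part of the restriction of \<open>g\<close> to \<open>L\<close> is the
  restriction of its initial part to \<open>L0\<close>. This gives both inclusions. If \<open>g\<close> vanishes on \<open>L\<close>, its initial form vanishes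
  on \<open>L0\<close>. If a homogeneous \<open>g\<close> vanishes on \<open>L0\<close>, its restriction to \<open>L\<close> consists of powers of \<open>t\<close> of higher weight;
  each is the restriction of a monomial in \<open>y\<^sub>j\<close> and \<open>y\<^sub>k\<close>, and subtracting these lifts \<open>g\<close> to an element of \<open>I(L)\<close> with
  initial form \<open>g\<close> (\<open>lift_homogeneous\<close>). The monomials satisfy the same lower bounds on exponents as \<open>g\<close>, so the lift
  stays inside \<open>A(C)\<close>. Moreover \<open>L0\<close> is the line \<open>L\<^sub>w\<close>, provided that it meets the
  torus (\<open>closure_torus_locus_initial\<close>).

  It remains to use \<open>w \<in> Trop(X(L)\<^sup>\<circ>)\<close>. Binomials in the toric ideal force \<open>w\<close> to respect all integral relations between the
  elements of \<open>H\<close>, hence \<open>w = \<phi>(a, b)\<close> (\<open>trop_in_image\<close>). If a coordinate \<open>y\<^sub>i\<close> vanished on \<open>L0\<close>, the lift would make every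
  monomial divisible by \<open>y\<^sub>i\<close> an initial form, so it suffices that \<open>A(C)\<close> has such a monomial. Here \<open>\<Sum>\<^sub>i \<Delta>\<^sub>i \<subset> \<sigma>\<close> enters:
  the sum misses the origin, and if no \<open>\<Delta>\<^sub>i\<close> is empty, Farkas' lemma provides a degree \<open>u\<close> with \<open>\<Sum>\<^sub>i \<lfloor>\<Delta>\<^sub>i(u)\<rfloor> \<ge> 1\<close> (\<open>slack_point\<close>).

  Primality holds because \<open>J(L0)\<close> is the kernel of a homomorphism to a domain.
\<close>

section \<open>Farkas' lemma over the rationals\<close>

text \<open>
  A pair \<open>(\<rho>, c)\<close> stands for the inequality \<open>c \<le> \<rho> \<cdot> x\<close>, so \<open>conic_hull B\<close> collects inequalities that
  every solution of the system \<open>B\<close> satisfies. Keeping them in a closure under addition and scaling,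
  instead of as explicit combinations of \<open>B\<close>, lets one argue about multipliers by induction.
\<close>

inductive_set conic_hull :: "(('v \<Rightarrow> rat) \<times> rat) set \<Rightarrow> (('v \<Rightarrow> rat) \<times> rat) set" for B where
  gen: "x \<in> B \<Longrightarrow> x \<in> conic_hull B"
| add: "(\<rho>, c) \<in> conic_hull B \<Longrightarrow> (\<rho>', c') \<in> conic_hull B \<Longrightarrow> (\<lambda>v. \<rho> v + \<rho>' v, c + c') \<in> conic_hull B"
| scale: "(\<rho>, c) \<in> conic_hull B \<Longrightarrow> 0 \<le> s \<Longrightarrow> (\<lambda>v. s * \<rho> v, s * c) \<in> conic_hull B"

lemma conic_hull_subset: "B' \<subseteq> conic_hull B \<Longrightarrow> conic_hull B' \<subseteq> conic_hull B"
proof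
  fix x assume "B' \<subseteq> conic_hull B" "x \<in> conic_hull B'"
  from this(2,1) show "x \<in> conic_hull B"
    by (induction rule: conic_hull.induct) (auto intro: conic_hull.intros)
qed

lemma conic_hull_vanish:
  assumes "x \<in> conic_hull B" "\<And>y. y \<in> B \<Longrightarrow> fst y w = 0"
  shows "fst x w = 0"
  using assms by (induction rule: conic_hull.induct) auto

lemma exists_between:
  fixes l u :: "'a \<Rightarrow> rat"
  assumes "finite P" "finite N" "\<And>p n. p \<in> P \<Longrightarrow> n \<in> N \<Longrightarrow> l p \<le> u n"
  shows "\<exists>y. (\<forall>p\<in>P. l p \<le> y) \<and> (\<forall>n\<in>N. y \<le> u n)"
proof (cases "P = {}")
  case True
  show ?thesis
  proof (cases "N = {}")
    case False
    then show ?thesis using True assms by (intro exI[of _ "Min (u ` N)"]) auto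
  qed (use True in auto)
next
  case False
  then show ?thesis using assms by (intro exI[of _ "Max (l ` P)"]) auto
qed

text \<open>
  Fourier-Motzkin elimination. To remove the coordinate \<open>w\<close>, every constraint with positive entry at \<open>w\<close>
  is added to every constraint with negative entry, scaled so that the entries cancel. If the new
  system had a solution, each lower bound for the coordinate \<open>w\<close> would lie below each upper bound, and
  the solution would extend; hence it has none, and its contradiction is a combination of \<open>B\<close>.
\<close>

lemma farkas:
  fixes B :: "(('v \<Rightarrow> rat) \<times> rat) set"
  assumes "finite V" "finite B"
    and "\<And>x. \<exists>(\<rho>, c)\<in>B. (\<Sum>v\<in>V. \<rho> v * x v) < c"
  shows "\<exists>(\<rho>, \<gamma>)\<in>conic_hull B. (\<forall>v\<in>V. \<rho> v = 0) \<and> 0 < \<gamma>"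
  using assms
proof (induction V arbitrary: B rule: finite_induct)
  case empty
  then show ?case by (fastforce intro: conic_hull.gen)
next
  case (insert w V)
  define P where "P = {b \<in> B. 0 < fst b w}"
  define N where "N = {b \<in> B. fst b w < 0}"
  define comb :: "(('v \<Rightarrow> rat) \<times> rat) \<Rightarrow> (('v \<Rightarrow> rat) \<times> rat) \<Rightarrow> (('v \<Rightarrow> rat) \<times> rat)"
    where "comb p n = (\<lambda>v. (- fst n w) * fst p v + fst p w * fst n v,
                       (- fst n w) * snd p + fst p w * snd n)" for p n
  define B' where "B' = {b \<in> B. fst b w = 0} \<union> (\<lambda>(p, n). comb p n) ` (P \<times> N)"
  have "finite B'" using insert.prems by (auto simp: B'_def P_def N_def)
  have comb_hull: "comb p n \<in> conic_hull B" if "p \<in> P" "n \<in> N" for p n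
  proof -
    have "(fst p, snd p) \<in> conic_hull B" "(fst n, snd n) \<in> conic_hull B"
      using that by (auto simp: P_def N_def intro: conic_hull.gen)
    then show ?thesis using that unfolding comb_def
      by (intro conic_hull.add conic_hull.scale) (auto simp: P_def N_def)
  qed
  have hull: "conic_hull B' \<subseteq> conic_hull B"
    by (rule conic_hull_subset) (auto simp: B'_def intro: conic_hull.gen comb_hull)
  have van: "fst x w = 0" if "x \<in> conic_hull B'" for x
    using that by (rule conic_hull_vanish) (auto simp: B'_def comb_def)
  have "\<exists>(\<rho>, c)\<in>B'. (\<Sum>v\<in>V. \<rho> v * x v) < c" for x
  proof (rule ccontr)
    assume "\<not> ?thesis"
    then have feas: "snd b \<le> (\<Sum>v\<in>V. fst b v * x v)" if "b \<in> B'" for b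
      using that by (force simp: not_less)
    \<comment> \<open>The bound that \<open>b\<close> imposes on the coordinate \<open>w\<close>, from below on \<open>P\<close> and from above on \<open>N\<close>.\<close>
    define q where "q b = (snd b - (\<Sum>v\<in>V. fst b v * x v)) / fst b w" for b
    have "\<exists>y. (\<forall>p\<in>P. q p \<le> y) \<and> (\<forall>n\<in>N. y \<le> q n)"
    proof (rule exists_between)
      show "finite P" "finite N" using insert.prems by (auto simp: P_def N_def)
      fix p n assume pn: "p \<in> P" "n \<in> N"
      then have "comb p n \<in> B'" by (auto simp: B'_def)
      from feas[OF this]
      have "(- fst n w) * snd p + fst p w * snd n
        \<le> (- fst n w) * (\<Sum>v\<in>V. fst p v * x v) + fst p w * (\<Sum>v\<in>V. fst n v * x v)"
        by (simp add: comb_def sum_distrib_left flip: sum.distrib) (simp add: algebra_simps)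
      then have "(- fst n w) * (snd p - (\<Sum>v\<in>V. fst p v * x v))
          \<le> fst p w * ((\<Sum>v\<in>V. fst n v * x v) - snd n)"
        by (simp add: algebra_simps)
      moreover have "0 < fst p w" "0 < - fst n w" using pn by (auto simp: P_def N_def)
      ultimately show "q p \<le> q n"
        unfolding q_def by (simp add: divide_simps) (simp add: algebra_simps)
    qed
    then obtain y where y: "\<And>p. p \<in> P \<Longrightarrow> q p \<le> y" "\<And>n. n \<in> N \<Longrightarrow> y \<le> q n" by blast
    define x' where "x' = x(w := y)"
    have s: "(\<Sum>v\<in>insert w V. \<rho> v * x' v) = \<rho> w * y + (\<Sum>v\<in>V. \<rho> v * x v)" for \<rho> :: "'v \<Rightarrow> rat"
      using insert.hyps by (simp add: x'_def) (rule sum.cong, auto)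
    obtain b where b: "b \<in> B" "(\<Sum>v\<in>insert w V. fst b v * x' v) < snd b"
      using insert.prems(2)[of x'] by force
    consider "b \<in> P" | "b \<in> N" | "b \<in> B'" "fst b w = 0"
      using b(1) by (auto simp: P_def N_def B'_def) (metis linorder_less_linear)
    then show False
    proof cases
      case 1
      then have "q b \<le> y" "0 < fst b w" using y by (auto simp: P_def)
      then show ?thesis using b(2) unfolding s by (simp add: q_def divide_simps algebra_simps)
    next
      case 2
      then have "y \<le> q b" "fst b w < 0" using y by (auto simp: N_def)
      then show ?thesis using b(2) unfolding s by (simp add: q_def divide_simps algebra_simps)
    next
      case 3
      then show ?thesis using b(2) feas[of b] unfolding s by simp
    qed
  qed
  from insert.IH[OF \<open>finite B'\<close> this]
  show ?case using hull van by fastforce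
qed

section \<open>Separation of polyhedra\<close>

lemma lookup_sum_single:
  fixes f :: "'i \<Rightarrow> 'a::comm_monoid_add"
  assumes "finite A"
  shows "Poly_Mapping.lookup (\<Sum>i\<in>A. Poly_Mapping.single i (f i)) k = (if k \<in> A then f k else 0)"
  using assms by (simp add: lookup_sum lookup_single when_def)

lemma sum_single_coord_space:
  "(\<Sum>k=1..n. Poly_Mapping.single k (f k)) \<in> coord_space n"
  for f :: "nat \<Rightarrow> 'a::comm_monoid_add"
  by (auto simp: coord_space_def in_keys_iff lookup_sum_single split: if_splits)

lemma pairing_coord_space:
  "u \<in> coord_space n \<Longrightarrow>
     pairing v u = (\<Sum>k=1..n. Poly_Mapping.lookup v k * of_int (Poly_Mapping.lookup u k))"
  by (rule pairing_superset) (auto simp: coord_space_def)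

lemma pairing_zero_right [simp]: "pairing v 0 = 0"
  by (simp add: pairing_def)

lemma pairing_zero_left [simp]: "pairing 0 u = 0"
  by (simp add: pairing_def)

lemma pairing_add_left: "pairing (v + v') u = pairing v u + pairing v' u"
  by (simp add: pairing_def lookup_add distrib_right sum.distrib)

lemma pairing_uminus_left: "pairing (- v) u = - pairing v u"
  by (simp add: pairing_def sum_negf)

lemma pairing_sum_left: "pairing (\<Sum>i\<in>A. f i) u = (\<Sum>i\<in>A. pairing (f i) u)"
  by (induction A rule: infinite_finite_induct) (simp_all add: pairing_add_left)

lemma pairing_sum_right: "pairing v (\<Sum>i\<in>A. f i) = (\<Sum>i\<in>A. pairing v (f i))"
  by (induction A rule: infinite_finite_induct) (simp_all add: pairing_add)

lemma lookup_vscale: "Poly_Mapping.lookup (vscale c v) k = c * Poly_Mapping.lookup v k"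
  by (simp add: vscale_def Poly_Mapping.map.rep_eq when_def)

lemma pairing_vscale: "pairing (vscale c v) u = c * pairing v u"
  by (simp add: pairing_def lookup_vscale sum_distrib_left mult.assoc)

text \<open>
  Apply Farkas' lemma to the system \<open>v\<^sub>i \<in> \<Delta>\<^sub>i\<close>, \<open>\<Sum>\<^sub>i v\<^sub>i = 0\<close>, which has no solution. In the resulting
  contradiction the multipliers of the last equation form one linear form \<open>u\<close>, the same for all \<open>i\<close>,
  and the multipliers of the inequalities of \<open>\<Delta>\<^sub>i\<close> add up to a lower bound \<open>l\<^sub>i\<close> of \<open>u\<close> on \<open>\<Delta>\<^sub>i\<close>.
  Working with multipliers gives rational bounds whose sum is positive, without minima on the \<open>\<Delta>\<^sub>i\<close>.
\<close>

lemma separate_polyhedra: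
  fixes \<Delta> :: "nat \<Rightarrow> (nat \<Rightarrow>\<^sub>0 rat) set"
  assumes poly: "\<And>i. i \<le> m \<Longrightarrow> rat_polyhedron r (\<Delta> i)"
    and zero: "0 \<notin> (\<Sum>i\<le>m. \<Delta> i)"
  shows "\<exists>u l. (\<forall>i\<le>m. \<forall>a\<in>\<Delta> i. l i \<le> (\<Sum>k=1..r. u k * Poly_Mapping.lookup a k)) \<and> 0 < (\<Sum>i\<le>m. l i)"
proof -
  define rep where "rep i B \<longleftrightarrow> finite B \<and> B \<subseteq> coord_space r \<times> UNIV \<and>
      \<Delta> i = {v \<in> coord_space r. \<forall>(u, a)\<in>B. a \<le> pairing v u}" for i B
  define B where "B i = (SOME B. rep i B)" for i
  have "rep i (B i)" if "i \<le> m" for i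
    using poly[OF that] unfolding B_def rat_polyhedron_def rep_def by (rule someI_ex)
  then have B: "finite (B i)" "B i \<subseteq> coord_space r \<times> UNIV"
      "\<Delta> i = {v \<in> coord_space r. \<forall>(u, a)\<in>B i. a \<le> pairing v u}" if "i \<le> m" for i
    using that unfolding rep_def by auto
  define row :: "nat \<Rightarrow> (nat \<Rightarrow>\<^sub>0 int) \<Rightarrow> nat \<times> nat \<Rightarrow> rat"
    where "row i u = (\<lambda>(i', k). if i' = i then of_int (Poly_Mapping.lookup u k) else 0)" for i u
  define eqn :: "rat \<Rightarrow> nat \<Rightarrow> nat \<times> nat \<Rightarrow> rat"
    where "eqn s k = (\<lambda>(i', k'). if k' = k then s else 0)" for s k
  define V where "V = {..m} \<times> {1..r}"
  define BB where "BB = (\<Union>i\<le>m. (\<lambda>(u, a). (row i u, a)) ` B i) \<union> (\<lambda>(s, k). (eqn s k, 0)) ` ({1, -1} \<times> {1..r})"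
  have sumV: "(\<Sum>v\<in>V. \<rho> v * x v) = (\<Sum>i\<le>m. \<Sum>k=1..r. \<rho> (i, k) * x (i, k))" for \<rho> x :: "nat \<times> nat \<Rightarrow> rat"
    unfolding V_def by (subst sum.cartesian_product) (simp add: case_prod_unfold)
  have row_sum: "(\<Sum>v\<in>V. row i u v * x v) = (\<Sum>k=1..r. x (i, k) * of_int (Poly_Mapping.lookup u k))"
    if "i \<le> m" for i u x
  proof -
    have "(\<Sum>v\<in>V. row i u v * x v)
      = (\<Sum>i'\<le>m. if i' = i then (\<Sum>k=1..r. x (i, k) * of_int (Poly_Mapping.lookup u k)) else 0)"
      unfolding sumV by (rule sum.cong) (auto simp: row_def mult.commute)
    then show ?thesis using that by simp
  qed
  have eqn_sum: "(\<Sum>v\<in>V. eqn s k v * x v) = s * (\<Sum>i\<le>m. x (i, k))" if "k \<in> {1..r}" for s k x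
  proof -
    have "(\<Sum>k'=1..r. eqn s k (i, k') * x (i, k')) = s * x (i, k)" for i
    proof -
      have "(\<Sum>k'=1..r. eqn s k (i, k') * x (i, k')) = (\<Sum>k'=1..r. if k' = k then s * x (i, k) else 0)"
        by (rule sum.cong) (auto simp: eqn_def)
      then show ?thesis using that by simp
    qed
    then show ?thesis by (simp add: sumV sum_distrib_left)
  qed
  have "\<exists>(\<rho>, c)\<in>BB. (\<Sum>v\<in>V. \<rho> v * x v) < c" for x
  proof (rule ccontr)
    assume "\<not> ?thesis"
    then have feas: "c \<le> (\<Sum>v\<in>V. \<rho> v * x v)" if "(\<rho>, c) \<in> BB" for \<rho> c
      using that by (force simp: not_less)
    define a where "a i = (\<Sum>k=1..r. Poly_Mapping.single k (x (i, k)))" for i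
    have la: "Poly_Mapping.lookup (a i) k = (if k \<in> {1..r} then x (i, k) else 0)" for i k
      unfolding a_def by (rule lookup_sum_single) simp
    have "a i \<in> \<Delta> i" if "i \<le> m" for i
    proof -
      have "c \<le> pairing (a i) u" if uc: "(u, c) \<in> B i" for u c
      proof -
        have "u \<in> coord_space r" using B(2)[OF \<open>i \<le> m\<close>] uc by auto
        then have "pairing (a i) u = (\<Sum>v\<in>V. row i u v * x v)"
          using \<open>i \<le> m\<close> by (simp add: row_sum pairing_coord_space a_def lookup_sum_single)
        moreover have "(row i u, c) \<in> BB" using uc \<open>i \<le> m\<close> by (force simp: BB_def)
        ultimately show ?thesis using feas by simp
      qed
      then show ?thesis using B(3)[OF that] by (auto simp: a_def sum_single_coord_space simp del: One_nat_def)
    qed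
    moreover have "(\<Sum>i\<le>m. a i) = 0"
    proof (rule poly_mapping_eqI)
      fix k
      show "Poly_Mapping.lookup (\<Sum>i\<le>m. a i) k = Poly_Mapping.lookup 0 k"
      proof (cases "k \<in> {1..r}")
        case True
        then have "(eqn 1 k, 0) \<in> BB" "(eqn (- 1) k, 0) \<in> BB" by (auto simp: BB_def)
        from this[THEN feas] have "(\<Sum>i\<le>m. x (i, k)) = 0"
          by (simp add: eqn_sum[OF True])
        then show ?thesis using True by (simp add: lookup_sum la del: One_nat_def)
      next
        case False
        then have "Poly_Mapping.lookup (a i) k = 0" for i unfolding la by (rule if_not_P)
        then show ?thesis by (simp add: lookup_sum)
      qed
    qed
    ultimately have "0 \<in> (\<Sum>i\<le>m. \<Delta> i)"
      by (auto simp: set_sum_alt intro!: exI[of _ a])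
    with zero show False ..
  qed
  moreover have "finite BB" "finite V" using B(1) by (auto simp: BB_def V_def)
  ultimately obtain \<rho> \<gamma> where \<rho>: "(\<rho>, \<gamma>) \<in> conic_hull BB" "\<And>v. v \<in> V \<Longrightarrow> \<rho> v = 0" "0 < \<gamma>"
    using farkas[of V BB] by blast
  \<comment> \<open>Each consequence of the system splits into a part \<open>u\<close> from the equation, common to all blocks, and
    lower bounds \<open>l i\<close> for what remains in block \<open>i\<close>.\<close>
  have "\<exists>u l. (\<forall>i\<le>m. \<forall>a\<in>\<Delta> i. l i + (\<Sum>k=1..r. u k * Poly_Mapping.lookup a k)
        \<le> (\<Sum>k=1..r. fst x (i, k) * Poly_Mapping.lookup a k)) \<and> snd x = (\<Sum>i\<le>m. l i)"
    if "x \<in> conic_hull BB" for x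
    using that
  proof (induction rule: conic_hull.induct)
    case (gen x)
    then consider (row) i u c where "i \<le> m" "(u, c) \<in> B i" "x = (row i u, c)"
      | (eqn) s k where "k \<in> {1..r}" "x = (eqn s k, 0)"
      by (auto simp: BB_def)
    then show ?case
    proof cases
      case row
      have "c \<le> (\<Sum>k=1..r. of_int (Poly_Mapping.lookup u k) * Poly_Mapping.lookup a k)" if "a \<in> \<Delta> i" for a
      proof -
        have "u \<in> coord_space r" using B(2)[OF row(1)] row(2) by blast
        moreover have "c \<le> pairing a u" using that row(2) unfolding B(3)[OF row(1)] by blast
        ultimately show ?thesis by (simp only: pairing_coord_space mult.commute[of "of_int _"])
      qed
      then show ?thesis using row
        by (intro exI[of _ "\<lambda>_. 0"] exI[of _ "\<lambda>i'. if i' = i then c else 0"]) (auto simp: row_def)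
    next
      case eqn
      have "(\<Sum>k'=1..r. eqn s k (i, k') * Poly_Mapping.lookup a k')
        = (\<Sum>k'=1..r. (if k' = k then s else 0) * Poly_Mapping.lookup a k')" for a i
        by (rule sum.cong) (auto simp: eqn_def)
      then show ?thesis using eqn
        by (intro exI[of _ "\<lambda>k'. if k' = k then s else 0"] exI[of _ "\<lambda>_. 0"]) (auto simp: eqn_def)
    qed
  next
    case (add \<rho> c \<rho>' c')
    from add.IH(1) obtain u l where
      *: "\<And>i a. i \<le> m \<Longrightarrow> a \<in> \<Delta> i \<Longrightarrow> l i + (\<Sum>k=1..r. u k * Poly_Mapping.lookup a k)
        \<le> (\<Sum>k=1..r. \<rho> (i, k) * Poly_Mapping.lookup a k)" "c = (\<Sum>i\<le>m. l i)"
      unfolding fst_conv snd_conv by blast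
    from add.IH(2) obtain u' l' where
      **: "\<And>i a. i \<le> m \<Longrightarrow> a \<in> \<Delta> i \<Longrightarrow> l' i + (\<Sum>k=1..r. u' k * Poly_Mapping.lookup a k)
        \<le> (\<Sum>k=1..r. \<rho>' (i, k) * Poly_Mapping.lookup a k)" "c' = (\<Sum>i\<le>m. l' i)"
      unfolding fst_conv snd_conv by blast
    have "l i + l' i + (\<Sum>k=1..r. (u k + u' k) * Poly_Mapping.lookup a k)
        \<le> (\<Sum>k=1..r. (\<rho> (i, k) + \<rho>' (i, k)) * Poly_Mapping.lookup a k)" if "i \<le> m" "a \<in> \<Delta> i" for i a
      using add_mono[OF *(1)[OF that] **(1)[OF that]] by (simp add: sum.distrib distrib_right)
    then show ?case using *(2) **(2)
      by (intro exI[of _ "\<lambda>k. u k + u' k"] exI[of _ "\<lambda>i. l i + l' i"]) (simp add: sum.distrib)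
  next
    case (scale \<rho> c s)
    from scale.IH obtain u l where
      *: "\<forall>i\<le>m. \<forall>a\<in>\<Delta> i. l i + (\<Sum>k=1..r. u k * Poly_Mapping.lookup a k)
        \<le> (\<Sum>k=1..r. \<rho> (i, k) * Poly_Mapping.lookup a k)" "c = (\<Sum>i\<le>m. l i)"
      unfolding fst_conv snd_conv by blast
    have "s * l i + (\<Sum>k=1..r. s * u k * Poly_Mapping.lookup a k)
        \<le> (\<Sum>k=1..r. s * \<rho> (i, k) * Poly_Mapping.lookup a k)" if "i \<le> m" "a \<in> \<Delta> i" for i a
      using mult_left_mono[OF *(1)[rule_format, OF that] \<open>0 \<le> s\<close>]
      by (simp add: distrib_left sum_distrib_left mult.assoc)
    then show ?case using *(2)
      by (intro exI[of _ "\<lambda>k. s * u k"] exI[of _ "\<lambda>i. s * l i"]) (simp add: sum_distrib_left)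
  qed
  from this[OF \<rho>(1)] obtain u l where
    *: "\<forall>i\<le>m. \<forall>a\<in>\<Delta> i. l i + (\<Sum>k=1..r. u k * Poly_Mapping.lookup a k)
        \<le> (\<Sum>k=1..r. \<rho> (i, k) * Poly_Mapping.lookup a k)" "\<gamma> = (\<Sum>i\<le>m. l i)"
    unfolding fst_conv snd_conv by (elim exE conjE) (rule that)
  have "l i \<le> (\<Sum>k=1..r. - u k * Poly_Mapping.lookup a k)" if "i \<le> m" "a \<in> \<Delta> i" for i a
  proof -
    have "(\<Sum>k=1..r. \<rho> (i, k) * Poly_Mapping.lookup a k) = 0"
      using that \<rho>(2) by (intro sum.neutral) (auto simp: V_def)
    then show ?thesis using *(1)[rule_format, OF that] by (simp add: sum_negf)
  qed
  moreover have "0 < (\<Sum>i\<le>m. l i)" using \<rho>(3) *(2) by simp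
  ultimately show ?thesis by (intro exI[of _ "\<lambda>k. - u k"] exI[of _ l] conjI allI impI ballI)
qed

lemma clear_denominators:
  fixes u :: "'a \<Rightarrow> rat"
  assumes "finite A"
  shows "\<exists>N::int. 0 < N \<and> (\<forall>k\<in>A. of_int N * u k \<in> \<int>)"
  using assms
proof (induction A rule: finite_induct)
  case empty
  show ?case by (rule exI[of _ 1]) simp
next
  case (insert x A)
  then obtain N where N: "0 < N" "\<And>k. k \<in> A \<Longrightarrow> of_int N * u k \<in> \<int>" by auto
  obtain p q where pq: "quotient_of (u x) = (p, q)" by (cases "quotient_of (u x)")
  then have q: "0 < q" "u x = of_int p / of_int q"
    by (auto simp: quotient_of_denom_pos quotient_of_div)
  have "of_int (N * q) * u k \<in> \<int>" if "k \<in> A" for k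
  proof -
    have "of_int (N * q) * u k = of_int q * (of_int N * u k)" by simp
    then show ?thesis using N(2)[OF that] by (simp only: Ints_mult Ints_of_int)
  qed
  moreover have "of_int (N * q) * u x \<in> \<int>"
  proof -
    have "of_int (N * q) * u x = of_int (N * p)" using q by simp
    then show ?thesis by (simp only: Ints_of_int)
  qed
  moreover have "0 < N * q" using N(1) q(1) by simp
  ultimately show ?case by (intro exI[of _ "N * q"] conjI ballI) auto
qed

text \<open>
  Scaling makes the separating form integral and its bounds large, and rounding the \<open>m + 1\<close> bounds down
  loses less than \<open>m + 1\<close> in total.
\<close>

lemma integral_separation:
  fixes \<Delta> :: "nat \<Rightarrow> (nat \<Rightarrow>\<^sub>0 rat) set"
  assumes "\<And>i. i \<le> m \<Longrightarrow> rat_polyhedron r (\<Delta> i)" "0 \<notin> (\<Sum>i\<le>m. \<Delta> i)"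
  shows "\<exists>u\<in>coord_space r. \<exists>n::nat \<Rightarrow> int.
           (\<forall>i\<le>m. \<forall>a\<in>\<Delta> i. of_int (n i) \<le> pairing a u) \<and> 1 \<le> (\<Sum>i\<le>m. n i)"
proof -
  have "\<exists>u l. (\<forall>i\<le>m. \<forall>a\<in>\<Delta> i. l i \<le> (\<Sum>k=1..r. u k * Poly_Mapping.lookup a k)) \<and> 0 < (\<Sum>i\<le>m. l i)"
    using assms by (rule separate_polyhedra)
  then obtain u l where "\<forall>i\<le>m. \<forall>a\<in>\<Delta> i. l i \<le> (\<Sum>k=1..r. u k * Poly_Mapping.lookup a k)"
      "0 < (\<Sum>i\<le>m. l i)"
    by (elim exE conjE) (rule that)
  note ul = this(1)[rule_format] this(2)
  obtain N :: int where N: "0 < N" "\<forall>k\<in>{1..r}. of_int N * u k \<in> \<int>"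
    using clear_denominators[of "{1..r}" u] by auto
  define z where "z k = \<lfloor>of_int N * u k\<rfloor>" for k
  have z: "of_int N * u k = of_int (z k)" if "k \<in> {1..r}" for k
    using N(2) that unfolding z_def by (auto elim: Ints_cases)
  obtain M :: nat where M: "of_nat (m + 2) < of_nat M * (\<Sum>i\<le>m. l i)"
    using ex_less_of_nat_mult[OF ul(2), of "of_nat (m + 2)"] by (elim exE) (rule that)
  define s :: int where "s = int M * N"
  define U where "U = (\<Sum>k=1..r. Poly_Mapping.single k (int M * z k))"
  define n where "n i = \<lfloor>of_int s * l i\<rfloor>" for i
  have U: "U \<in> coord_space r" unfolding U_def by (rule sum_single_coord_space)
  have pU: "pairing a U = of_int s * (\<Sum>k=1..r. u k * Poly_Mapping.lookup a k)" for a
  proof -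
    have "pairing a U = (\<Sum>k=1..r. Poly_Mapping.lookup a k * of_int (int M * z k))"
      unfolding pairing_coord_space[OF U] by (rule sum.cong) (simp_all add: U_def lookup_sum_single)
    also have "\<dots> = (\<Sum>k=1..r. of_int s * (u k * Poly_Mapping.lookup a k))"
    proof (rule sum.cong)
      fix k assume "k \<in> {1..r}"
      show "Poly_Mapping.lookup a k * of_int (int M * z k) = of_int s * (u k * Poly_Mapping.lookup a k)"
        by (simp add: s_def z[OF \<open>k \<in> {1..r}\<close>, symmetric] mult_ac)
    qed simp
    finally show ?thesis by (simp add: sum_distrib_left)
  qed
  have s: "0 \<le> s" using N by (simp add: s_def)
  have "of_int (n i) \<le> pairing a U" if "i \<le> m" "a \<in> \<Delta> i" for i a
  proof -
    have "of_int (n i) \<le> of_int s * l i" by (simp add: n_def)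
    also have "\<dots> \<le> pairing a U"
      unfolding pU using ul(1)[OF that] s by (intro mult_left_mono) auto
    finally show ?thesis .
  qed
  moreover have "1 \<le> (\<Sum>i\<le>m. n i)"
  proof -
    have "(of_nat M * (\<Sum>i\<le>m. l i)) * 1 \<le> (of_nat M * (\<Sum>i\<le>m. l i)) * (of_int N :: rat)"
      using N ul(2) by (intro mult_left_mono) auto
    then have "of_nat (m + 2) < of_int s * (\<Sum>i\<le>m. l i)"
      using M by (simp add: s_def algebra_simps)
    moreover have "(\<Sum>i\<le>m. of_int s * l i - 1) \<le> (\<Sum>i\<le>m. of_int (n i) :: rat)"
    proof (rule sum_mono)
      show "of_int s * l i - 1 \<le> (of_int (n i) :: rat)" for i
        unfolding n_def by linarith
    qed
    ultimately have "of_nat (m + 2) - of_nat (m + 1) < (\<Sum>i\<le>m. of_int (n i) :: rat)"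
      by (simp add: sum_subtractf sum_distrib_left)
    then have "(1::rat) < of_int (\<Sum>i\<le>m. n i)" by simp
    then show ?thesis by linarith
  qed
  ultimately show ?thesis using U by blast
qed

section \<open>Lattice points of the dual cone\<close>

text \<open>
  The exponent of \<open>y\<^sub>i\<close> in \<open>z\<^sup>v\<close> under \<open>z\<^sub>i = y\<^sub>i / y\<^sub>0\<close>. In these coordinates the \<open>m + 1\<close> hyperplanes of \<open>\<P>\<^sup>m\<close> play
  the same role; the price is the relation \<open>\<Sum>\<^sub>i hom_exp m v i = 0\<close>.
\<close>

definition hom_exp :: "nat \<Rightarrow> (nat \<Rightarrow>\<^sub>0 int) \<Rightarrow> nat \<Rightarrow> int" where
  "hom_exp m v i = (if i = 0 then - (\<Sum>j=1..m. Poly_Mapping.lookup v j) else Poly_Mapping.lookup v i)"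

lemma atMost_eq_insert_0: "{..m} = insert 0 {1..m::nat}" by auto

lemma sum_hom_exp: "(\<Sum>i\<le>m. hom_exp m v i) = 0"
  by (simp add: atMost_eq_insert_0 hom_exp_def)

lemma hom_exp_surj:
  assumes "(\<Sum>i\<le>m. n i) = 0"
  obtains v where "v \<in> coord_space m" "\<And>i. i \<le> m \<Longrightarrow> hom_exp m v i = n i"
proof
  let ?v = "\<Sum>k=1..m. Poly_Mapping.single k (n k)"
  show "?v \<in> coord_space m" by (rule sum_single_coord_space)
  have "n 0 + (\<Sum>i=1..m. n i) = 0" using assms by (simp add: atMost_eq_insert_0)
  then show "hom_exp m ?v i = n i" if "i \<le> m" for i
    using that by (auto simp: hom_exp_def lookup_sum_single simp del: One_nat_def)
qed

lemma pairing_e_vec: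
  assumes "v \<in> coord_space m" "i \<le> m"
  shows "pairing (e_vec m i) v = of_int (hom_exp m v i)"
proof -
  have s: "pairing (Poly_Mapping.single j 1) v = (of_int (Poly_Mapping.lookup v j) :: rat)"
    if "1 \<le> j" "j \<le> m" for j
  proof -
    have "pairing (Poly_Mapping.single j 1) v
        = (\<Sum>k=1..m. if k = j then (of_int (Poly_Mapping.lookup v j) :: rat) else 0)"
      unfolding pairing_coord_space[OF assms(1)] by (rule sum.cong) (auto simp: lookup_single when_def)
    then show ?thesis using that by simp
  qed
  show ?thesis
    using assms(2) s[of i] by (auto simp: e_vec_def hom_exp_def pairing_uminus_left pairing_sum_left s)
qed

text \<open>
  A generator \<open>(a, e\<^sub>i)\<close> of the cone pairs with \<open>(u, v)\<close> to \<open>\<langle>a, u\<rangle>\<close> plus the exponent of \<open>y\<^sub>i\<close> in \<open>z\<^sup>v\<close>. Hence the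
  monomials of degree \<open>u\<close> in \<open>A(C)\<close> are those with bounded pole order along each \<open>y\<^sub>i = 0\<close>, and this set
  is closed under raising the exponents.
\<close>

lemma dual_pts2_iff:
  "(u, v) \<in> dual_pts2 r m (big_cone m \<sigma> \<Delta>) \<longleftrightarrow>
     u \<in> coord_space r \<and> v \<in> coord_space m \<and> (\<forall>a\<in>\<sigma>. 0 \<le> pairing a u) \<and>
     (\<forall>i\<le>m. \<forall>a\<in>\<Delta> i. 0 \<le> pairing a u + of_int (hom_exp m v i))" (is "?l \<longleftrightarrow> ?r")
proof
  let ?X = "\<sigma> \<times> {0} \<union> (\<Union>i\<le>m. \<Delta> i \<times> {e_vec m i})"
  {
    assume l: ?l
    have "0 \<le> pairing (fst x) u + pairing (snd x) v" if "x \<in> ?X" for x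
    proof -
      have "x \<in> big_cone m \<sigma> \<Delta>"
        unfolding big_cone_def cone_gen_def using that
        by (auto intro!: exI[of _ "{x}"] exI[of _ "\<lambda>_. 1"] poly_mapping_eqI simp: pscale_def prod_eq_iff lookup_vscale)
      then show ?thesis using l by (cases x) (auto simp: dual_pts2_def)
    qed
    then show ?r using l by (fastforce simp: dual_pts2_def pairing_e_vec)
  }
  {
    assume r: ?r
    have "0 \<le> pairing (fst x) u + pairing (snd x) v" if x: "x \<in> ?X" for x
      using r x by (auto simp: pairing_e_vec)
    note gens = this
    have "0 \<le> pairing (fst (\<Sum>x\<in>F. pscale (c x) x)) u + pairing (snd (\<Sum>x\<in>F. pscale (c x) x)) v"
      if F: "F \<subseteq> ?X" "\<forall>x\<in>F. 0 \<le> c x" for F c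
    proof -
      have "0 \<le> (\<Sum>x\<in>F. c x * (pairing (fst x) u + pairing (snd x) v))"
      proof (rule sum_nonneg)
        fix x assume "x \<in> F"
        then have "0 \<le> c x" "0 \<le> pairing (fst x) u + pairing (snd x) v"
          using F gens[of x] by blast+
        then show "0 \<le> c x * (pairing (fst x) u + pairing (snd x) v)" by (rule mult_nonneg_nonneg)
      qed
      then show ?thesis
        by (simp add: fst_sum snd_sum pairing_sum_left pscale_def pairing_vscale sum.distrib distrib_left)
    qed
    then show ?l using r by (auto simp: dual_pts2_def big_cone_def cone_gen_def prod_eq_iff)
  }
qed

text \<open>
  There is a monomial of \<open>A(C)\<close> that is divisible by \<open>y\<^bsub>i0\<^esub>\<close> in its degree, in the sense that it remains in
  \<open>A(C)\<close> after \<open>y\<^bsub>i0\<^esub>\<close> is exchanged for any other coordinate. If some \<open>\<Delta>\<^sub>l\<close> is empty, poles along \<open>y\<^sub>l\<close> are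
  free and the degree \<open>u = 0\<close> serves. Otherwise \<open>\<Sum>\<^sub>i \<Delta>\<^sub>i\<close> misses the origin, since with the origin it
  would contain the whole tailcone \<open>\<sigma>\<close>, and a separating form \<open>u\<close> has \<open>\<Sum>\<^sub>i \<lfloor>\<Delta>\<^sub>i(u)\<rfloor> \<ge> 1\<close>.
\<close>

lemma slack_point:
  assumes "\<And>i. i \<le> m \<Longrightarrow> \<Delta> i = {} \<or> rat_polyhedron r (\<Delta> i) \<and> tailcone r (\<Delta> i) = \<sigma>"
    and sub: "(\<Sum>i\<le>m. \<Delta> i) \<subset> \<sigma>" and i0: "i0 \<le> m"
  shows "\<exists>u\<in>coord_space r. \<exists>v\<in>coord_space m. (\<forall>a\<in>\<sigma>. 0 \<le> pairing a u) \<and>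
    (\<forall>i\<le>m. \<forall>a\<in>\<Delta> i. (if i = i0 then 1 else 0) \<le> pairing a u + of_int (hom_exp m v i))"
proof (cases "\<exists>l\<le>m. \<Delta> l = {}")
  case True
  then obtain l where l: "l \<le> m" "\<Delta> l = {}" by blast
  obtain v where v: "v \<in> coord_space m"
    "\<And>i. i \<le> m \<Longrightarrow> hom_exp m v i = (if i = i0 then 1 else 0) - (if i = l then 1 else 0)"
    using hom_exp_surj[of "\<lambda>i. (if i = i0 then 1 else 0) - (if i = l then 1 else 0)" m] i0 l
    by (auto simp: sum_subtractf)
  have "(0 :: nat \<Rightarrow>\<^sub>0 int) \<in> coord_space r" by (simp add: coord_space_def)
  then show ?thesis
  proof (intro bexI conjI ballI allI impI)
    fix i a assume "i \<le> m" "a \<in> \<Delta> i"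
    then have "hom_exp m v i = (if i = i0 then 1 else 0)" using v(2)[of i] l(2) by auto
    then show "(if i = i0 then 1 else 0) \<le> pairing a 0 + of_int (hom_exp m v i)" by simp
  qed (simp_all add: v(1))
next
  case False
  then have P: "rat_polyhedron r (\<Delta> i)" "tailcone r (\<Delta> i) = \<sigma>" "\<Delta> i \<noteq> {}" if "i \<le> m" for i
    using assms(1) that by auto
  have "0 \<notin> (\<Sum>i\<le>m. \<Delta> i)"
  proof
    assume "0 \<in> (\<Sum>i\<le>m. \<Delta> i)"
    then obtain a where a: "0 = (\<Sum>i\<le>m. a i)" "\<And>i. i \<le> m \<Longrightarrow> a i \<in> \<Delta> i"
      by (auto simp: set_sum_alt)
    have "s \<in> (\<Sum>i\<le>m. \<Delta> i)" if "s \<in> \<sigma>" for s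
    proof -
      have "(a(0 := a 0 + s)) i \<in> \<Delta> i" if "i \<le> m" for i
        using \<open>s \<in> \<sigma>\<close> P(2)[of 0] a(2) that by (auto simp: tailcone_def)
      moreover have "(\<Sum>i\<le>m. (a(0 := a 0 + s)) i) = s"
      proof -
        have "(\<Sum>i\<le>m. (a(0 := a 0 + s)) i) = (a 0 + s) + (\<Sum>i=1..m. a i)"
          by (simp add: atMost_eq_insert_0)
        also have "\<dots> = s + (\<Sum>i\<le>m. a i)" by (simp add: atMost_eq_insert_0)
        finally show ?thesis using a(1) by simp
      qed
      ultimately show ?thesis by (auto simp: set_sum_alt intro!: exI[of _ "a(0 := a 0 + s)"])
    qed
    then show False using sub by blast
  qed
  with P(1) have "\<exists>u\<in>coord_space r. \<exists>n::nat \<Rightarrow> int.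
      (\<forall>i\<le>m. \<forall>a\<in>\<Delta> i. of_int (n i) \<le> pairing a u) \<and> 1 \<le> (\<Sum>i\<le>m. n i)"
    by (intro integral_separation) auto
  then obtain u and n :: "nat \<Rightarrow> int" where
    u: "u \<in> coord_space r" and n0: "\<forall>i\<le>m. \<forall>a\<in>\<Delta> i. of_int (n i) \<le> pairing a u"
      "1 \<le> (\<Sum>i\<le>m. n i)" by (elim bexE exE conjE) (rule that)
  note n = n0(1)[rule_format] n0(2)
  have "0 \<le> pairing s u" if "s \<in> \<sigma>" for s
  proof (rule ccontr)
    assume neg: "\<not> 0 \<le> pairing s u"
    obtain a where a: "a \<in> \<Delta> 0" using P(3)[of 0] by auto
    have step: "x + s \<in> \<Delta> 0" if "x \<in> \<Delta> 0" for x
      using P(2)[of 0] \<open>s \<in> \<sigma>\<close> that by (auto simp: tailcone_def)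
    have *: "\<exists>x\<in>\<Delta> 0. pairing x u = pairing a u + of_nat k * pairing s u" for k
    proof (induction k)
      case (Suc k)
      then obtain x where "x \<in> \<Delta> 0" "pairing x u = pairing a u + of_nat k * pairing s u" by blast
      with step[of x] show ?case
        by (intro bexI[of _ "x + s"]) (auto simp: pairing_add_left algebra_simps)
    qed (use a in auto)
    obtain k :: nat where "pairing a u - of_int (n 0) < of_nat k * (- pairing s u)"
      using ex_less_of_nat_mult[of "- pairing s u"] neg by auto
    moreover have "of_int (n 0) \<le> pairing a u + of_nat k * pairing s u"
      using *[of k] n(1)[of 0] by (metis zero_le)
    ultimately show False by simp
  qed
  moreover
  \<comment> \<open>Exponents equal to the lowest admissible ones plus the slack at \<open>i0\<close>; the surplus, which is
    nonnegative, goes to \<open>y\<^sub>0\<close> so that the total degree is zero.\<close>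
  define e where "e i = - n i + (if i = i0 then 1 else 0)
    + (if i = 0 then (\<Sum>i\<le>m. n i) - 1 else 0)" for i
  have "(\<Sum>i\<le>m. e i) = 0" using i0 by (simp add: e_def sum.distrib sum_negf sum_subtractf)
  then obtain v where v: "v \<in> coord_space m" "\<And>i. i \<le> m \<Longrightarrow> hom_exp m v i = e i"
    by (rule hom_exp_surj) auto
  have "(if i = i0 then 1 else 0) \<le> pairing a u + of_int (hom_exp m v i)" if "i \<le> m" "a \<in> \<Delta> i" for i a
  proof -
    have "(if i = i0 then 1 else 0) \<le> n i + e i" using n(2) by (auto simp: e_def)
    then have "of_int (if i = i0 then 1 else 0) \<le> (of_int (n i + e i) :: rat)"
      by (rule of_int_le_iff[THEN iffD2])
    then show ?thesis using n(1)[OF that] v(2)[OF that(1)] by (auto split: if_splits)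
  qed
  ultimately show ?thesis using u v(1) by blast
qed

section \<open>Polynomials over infinite fields\<close>

text \<open>
  Over a finite field the polynomial \<open>1 + \<Prod>\<^sub>a (X - a)\<close> has no root.
\<close>

lemma infinite_UNIV_alg_closed: "infinite (UNIV :: 'k::alg_closed_field set)"
proof
  assume fin: "finite (UNIV :: 'k set)"
  define P where "P = (\<Prod>a\<in>(UNIV :: 'k set). [:- a, 1:])"
  have "degree P = card (UNIV :: 'k set)"
    unfolding P_def by (subst degree_prod_eq_sum_degree) auto
  then have "0 < degree P" using fin by (simp add: card_gt_0_iff)
  then have "0 < degree (P + 1)" by (simp add: degree_add_eq_left)
  then obtain x where "poly (P + 1) x = 0" using alg_closed_imp_poly_has_root by blast
  moreover have "poly P x = 0" unfolding P_def poly_prod using fin by (simp add: prod_zero_iff)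
  ultimately show False by simp
qed

lemma poly_eq_0_if_vanishes:
  fixes P Q :: "'k::field poly"
  assumes "infinite (UNIV :: 'k set)" "Q \<noteq> 0" "\<And>t. poly Q t \<noteq> 0 \<Longrightarrow> poly P t = 0"
  shows "P = 0"
proof (rule ccontr)
  assume "P \<noteq> 0"
  then have "finite {t. poly (P * Q) t = 0}" using assms(2) by (intro poly_roots_finite) simp
  moreover have "{t. poly (P * Q) t = 0} = UNIV" using assms(3) by auto
  ultimately have "finite (UNIV :: 'k set)" by (simp only:)
  then show False using assms(1) by contradiction
qed

section \<open>Sums over the terms of a polynomial\<close>

definition filter_keys :: "('e \<Rightarrow> bool) \<Rightarrow> ('e \<Rightarrow>\<^sub>0 'k::comm_monoid_add) \<Rightarrow> ('e \<Rightarrow>\<^sub>0 'k)" where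
  "filter_keys P f = (\<Sum>e\<in>{e \<in> Poly_Mapping.keys f. P e}. Poly_Mapping.single e (Poly_Mapping.lookup f e))"

lemma lookup_filter_keys:
  "Poly_Mapping.lookup (filter_keys P f) e = (if P e then Poly_Mapping.lookup f e else 0)"
  by (auto simp: filter_keys_def lookup_sum_single in_keys_iff)

lemma keys_filter_keys: "Poly_Mapping.keys (filter_keys P f) = {e \<in> Poly_Mapping.keys f. P e}"
  by (auto simp: in_keys_iff lookup_filter_keys split: if_splits)

lemma initial_form_eq_filter:
  "initial_form wt f = filter_keys (\<lambda>e. \<forall>e'\<in>Poly_Mapping.keys f. wt e \<le> wt e') f"
  by (simp add: initial_form_def filter_keys_def)

lemma poly_mapping_decompose:
  "f = (\<Sum>e\<in>Poly_Mapping.keys f. Poly_Mapping.single e (Poly_Mapping.lookup f e))"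
  by (rule poly_mapping_eqI) (auto simp: lookup_sum_single in_keys_iff)

text \<open>
  Evaluations, restrictions, graded pieces and truncations of polynomials all have the form
  \<open>\<Sum>\<^sub>e F e (lookup f e)\<close> with \<open>F e\<close> additive. Such a sum may be taken over any finite set that contains
  the support, which makes it additive in \<open>f\<close>; this is shown once here.
\<close>

locale keys_linear =
  fixes F :: "'e \<Rightarrow> 'a::ab_group_add \<Rightarrow> 'b::ab_group_add"
  assumes F_add: "F e (a + b) = F e a + F e b"
begin

definition total :: "('e \<Rightarrow>\<^sub>0 'a) \<Rightarrow> 'b" where
  "total f = (\<Sum>e\<in>Poly_Mapping.keys f. F e (Poly_Mapping.lookup f e))"

lemma F_zero [simp]: "F e 0 = 0"
  using F_add[of e 0 0] by simp

lemma total_superset: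
  "finite A \<Longrightarrow> Poly_Mapping.keys f \<subseteq> A \<Longrightarrow> total f = (\<Sum>e\<in>A. F e (Poly_Mapping.lookup f e))"
  unfolding total_def by (rule sum.mono_neutral_left) (auto simp: in_keys_iff)

lemma total_add: "total (f + g) = total f + total g"
proof -
  let ?A = "Poly_Mapping.keys f \<union> Poly_Mapping.keys g"
  show ?thesis using Poly_Mapping.keys_add[of f g]
    by (simp add: total_superset[of ?A] lookup_add F_add sum.distrib)
qed

lemma total_zero [simp]: "total 0 = 0"
  by (simp add: total_def)

lemma total_uminus: "total (- f) = - total f"
  using total_add[of f "- f"] by (simp add: add_eq_0_iff)

lemma total_diff: "total (f - g) = total f - total g"
  using total_add[of f "- g"] by (simp add: total_uminus)

lemma total_sum: "total (\<Sum>i\<in>A. f i) = (\<Sum>i\<in>A. total (f i))"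
  by (induction A rule: infinite_finite_induct) (simp_all add: total_add)

lemma total_single [simp]: "total (Poly_Mapping.single e a) = F e a"
  by (cases "a = 0") (simp_all add: total_def)

lemma total_filter_keys:
  "total (filter_keys P f) = (\<Sum>e\<in>Poly_Mapping.keys f. if P e then F e (Poly_Mapping.lookup f e) else 0)"
  by (subst total_superset[of "Poly_Mapping.keys f"]) (auto simp: keys_filter_keys lookup_filter_keys intro!: sum.cong)

end

section \<open>Laurent polynomials on a line\<close>

text \<open>
  The monomial \<open>y\<^sup>v y\<^sup>-\<^sup>\<delta>\<close>. If \<open>\<delta>\<close> bounds the exponents of \<open>v\<close> from below this is a monomial of degree
  \<open>-\<Sum>\<^sub>i \<delta>\<^sub>i\<close>, which does not depend on \<open>v\<close>: a common \<open>\<delta>\<close> turns a Laurent polynomial of degree zero into a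
  homogeneous polynomial.
\<close>

definition hom_monomial :: "nat \<Rightarrow> (nat \<Rightarrow> int) \<Rightarrow> (nat \<Rightarrow> 'a::comm_monoid_mult) \<Rightarrow> (nat \<Rightarrow>\<^sub>0 int) \<Rightarrow> 'a" where
  "hom_monomial m \<delta> Y v = (\<Prod>i\<le>m. Y i ^ nat (hom_exp m v i - \<delta> i))"

text \<open>
  The restriction of the homogeneous polynomial \<open>y\<^sup>-\<^sup>\<delta> g\<close> to the line with \<open>y\<^sub>i = Y i\<close> in a coordinate \<open>t\<close>.
\<close>

definition hom_eval :: "nat \<Rightarrow> (nat \<Rightarrow> int) \<Rightarrow> (nat \<Rightarrow> 'k poly) \<Rightarrow> ((nat \<Rightarrow>\<^sub>0 int) \<Rightarrow>\<^sub>0 'k::field) \<Rightarrow> 'k poly" where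
  "hom_eval m \<delta> Y = keys_linear.total (\<lambda>v c. smult c (hom_monomial m \<delta> Y v))"

interpretation hom_eval: keys_linear "\<lambda>v c. smult c (hom_monomial m \<delta> Y v)"
  rewrites "keys_linear.total (\<lambda>v c. smult c (hom_monomial m \<delta> Y v)) = hom_eval m \<delta> Y"
  for m \<delta> and Y :: "nat \<Rightarrow> 'k::field poly"
  by unfold_locales (simp_all add: smult_add_left hom_eval_def)

definition expo_bound :: "nat \<Rightarrow> (nat \<Rightarrow> int) \<Rightarrow> ((nat \<Rightarrow>\<^sub>0 int) \<Rightarrow>\<^sub>0 'k::zero) \<Rightarrow> bool" where
  "expo_bound m \<delta> g \<longleftrightarrow> Poly_Mapping.keys g \<subseteq> coord_space m \<and> (\<forall>v\<in>Poly_Mapping.keys g. \<forall>i\<le>m. \<delta> i \<le> hom_exp m v i)"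

lemma expo_bound_exists:
  "Poly_Mapping.keys g \<subseteq> coord_space m \<Longrightarrow> \<exists>\<delta>. expo_bound m \<delta> g"
  by (intro exI[of _ "\<lambda>i. Min ((\<lambda>v. hom_exp m v i) ` Poly_Mapping.keys g)"]) (simp add: expo_bound_def)

lemma prod_power_int:
  fixes y :: "'a::field"
  assumes "y \<noteq> 0"
  shows "(\<Prod>i\<in>A. y powi f i) = y powi (\<Sum>i\<in>A. f i)"
  by (induction A rule: infinite_finite_induct) (simp_all add: power_int_add assms)

lemma prod_quotient_power_int:
  fixes y :: "nat \<Rightarrow> 'a::field"
  assumes v: "v \<in> coord_space m" and y: "y 0 \<noteq> 0"
  shows "(\<Prod>i\<in>Poly_Mapping.keys v. (y i / y 0) powi Poly_Mapping.lookup v i) = (\<Prod>i\<le>m. y i powi hom_exp m v i)"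
proof -
  have "(\<Prod>i\<in>Poly_Mapping.keys v. (y i / y 0) powi Poly_Mapping.lookup v i)
    = (\<Prod>i=1..m. (y i / y 0) powi Poly_Mapping.lookup v i)"
    using v by (intro prod.mono_neutral_left) (auto simp: coord_space_def in_keys_iff)
  also have "\<dots> = (\<Prod>i=1..m. y i powi Poly_Mapping.lookup v i) / y 0 powi (\<Sum>i=1..m. Poly_Mapping.lookup v i)"
    using y by (simp add: power_int_divide_distrib prod_dividef prod_power_int)
  also have "\<dots> = (\<Prod>i\<le>m. y i powi hom_exp m v i)"
    by (simp add: atMost_eq_insert_0 hom_exp_def power_int_minus field_simps)
  finally show ?thesis .
qed

lemma prod_quotient_hom_monomial:
  fixes y :: "nat \<Rightarrow> 'a::field"
  assumes "v \<in> coord_space m" "\<And>i. i \<le> m \<Longrightarrow> y i \<noteq> 0" "\<And>i. i \<le> m \<Longrightarrow> \<delta> i \<le> hom_exp m v i"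
  shows "(\<Prod>i\<in>Poly_Mapping.keys v. (y i / y 0) powi Poly_Mapping.lookup v i)
    = (\<Prod>i\<le>m. y i powi \<delta> i) * hom_monomial m \<delta> y v"
proof -
  have "y i powi hom_exp m v i = y i powi \<delta> i * y i ^ nat (hom_exp m v i - \<delta> i)" if "i \<le> m" for i
    using assms(2,3)[OF that] by (simp flip: power_int_add power_int_of_nat)
  then show ?thesis
    using assms by (simp add: prod_quotient_power_int hom_monomial_def flip: prod.distrib)
qed

lemma laurent_eval_eq_hom:
  fixes y z :: "nat \<Rightarrow> 'k::field"
  assumes g: "expo_bound m \<delta> g" and y: "\<And>i. i \<le> m \<Longrightarrow> y i \<noteq> 0"
    and z: "\<And>i. i \<in> {1..m} \<Longrightarrow> z i = y i / y 0"
  shows "laurent_eval g z = (\<Prod>i\<le>m. y i powi \<delta> i) *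
    (\<Sum>v\<in>Poly_Mapping.keys g. Poly_Mapping.lookup g v * hom_monomial m \<delta> y v)"
proof -
  have "(\<Prod>i\<in>Poly_Mapping.keys v. z i powi Poly_Mapping.lookup v i) = (\<Prod>i\<le>m. y i powi \<delta> i) * hom_monomial m \<delta> y v"
    if v: "v \<in> Poly_Mapping.keys g" for v
  proof -
    have "v \<in> coord_space m" using g v by (auto simp: expo_bound_def)
    then have "(\<Prod>i\<in>Poly_Mapping.keys v. z i powi Poly_Mapping.lookup v i)
      = (\<Prod>i\<in>Poly_Mapping.keys v. (y i / y 0) powi Poly_Mapping.lookup v i)"
      by (intro prod.cong) (use z in \<open>auto simp: coord_space_def\<close>)
    also have "\<dots> = (\<Prod>i\<le>m. y i powi \<delta> i) * hom_monomial m \<delta> y v"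
      by (rule prod_quotient_hom_monomial) (use g v y in \<open>auto simp: expo_bound_def\<close>)
    finally show ?thesis .
  qed
  then show ?thesis by (simp add: laurent_eval_def sum_distrib_left mult.left_commute)
qed

lemma poly_hom_eval:
  "poly (hom_eval m \<delta> Y g) t
     = (\<Sum>v\<in>Poly_Mapping.keys g. Poly_Mapping.lookup g v * hom_monomial m \<delta> (\<lambda>i. poly (Y i) t) v)"
  by (simp add: hom_eval.total_def poly_sum hom_monomial_def poly_prod)

lemma sum_expo_diff:
  assumes "\<And>i. i \<le> m \<Longrightarrow> \<delta> i \<le> hom_exp m v i"
  shows "(\<Sum>i\<le>m. nat (hom_exp m v i - \<delta> i)) = nat (- (\<Sum>i\<le>m. \<delta> i))"
proof -
  have "int (\<Sum>i\<le>m. nat (hom_exp m v i - \<delta> i)) = (\<Sum>i\<le>m. hom_exp m v i - \<delta> i)"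
    using assms by simp
  also have "\<dots> = - (\<Sum>i\<le>m. \<delta> i)" by (simp add: sum_subtractf sum_hom_exp)
  finally show ?thesis by linarith
qed

lemma degree_hom_monomial:
  fixes Y :: "nat \<Rightarrow> 'k::field poly"
  assumes "\<And>i. i \<le> m \<Longrightarrow> degree (Y i) \<le> 1" "\<And>i. i \<le> m \<Longrightarrow> \<delta> i \<le> hom_exp m v i"
  shows "degree (hom_monomial m \<delta> Y v) \<le> nat (- (\<Sum>i\<le>m. \<delta> i))"
proof -
  have "degree (hom_monomial m \<delta> Y v) \<le> (\<Sum>i\<le>m. degree (Y i ^ nat (hom_exp m v i - \<delta> i)))"
    unfolding hom_monomial_def using degree_prod_sum_le[of "{..m}" "\<lambda>i. Y i ^ nat (hom_exp m v i - \<delta> i)"]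
    by (simp add: o_def)
  also have "\<dots> \<le> (\<Sum>i\<le>m. nat (hom_exp m v i - \<delta> i))"
  proof (rule sum_mono)
    fix i assume "i \<in> {..m}"
    then have "degree (Y i) * nat (hom_exp m v i - \<delta> i) \<le> 1 * nat (hom_exp m v i - \<delta> i)"
      using assms(1) by (intro mult_right_mono) auto
    then show "degree (Y i ^ nat (hom_exp m v i - \<delta> i)) \<le> nat (hom_exp m v i - \<delta> i)"
      using degree_power_le[of "Y i" "nat (hom_exp m v i - \<delta> i)"] by linarith
  qed
  also have "\<dots> = nat (- (\<Sum>i\<le>m. \<delta> i))" by (rule sum_expo_diff[OF assms(2)])
  finally show ?thesis .
qed

text \<open>
  The coefficient in the top degree is the value at the point \<open>t = \<infinity>\<close>, that is, at \<open>[q]\<close>.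
\<close>

lemma coeff_hom_monomial:
  fixes p q :: "nat \<Rightarrow> 'k::field"
  assumes "\<And>i. i \<le> m \<Longrightarrow> q i \<noteq> 0" "\<And>i. i \<le> m \<Longrightarrow> \<delta> i \<le> hom_exp m v i"
  shows "coeff (hom_monomial m \<delta> (\<lambda>i. [:p i, q i:]) v) (nat (- (\<Sum>i\<le>m. \<delta> i))) = hom_monomial m \<delta> q v"
proof -
  let ?Y = "\<lambda>i. [:p i, q i:] ^ nat (hom_exp m v i - \<delta> i)"
  have "degree (\<Prod>i\<le>m. ?Y i) = (\<Sum>i\<le>m. degree (?Y i))"
    using assms(1) by (intro degree_prod_eq_sum_degree) auto
  also have "\<dots> = (\<Sum>i\<le>m. nat (hom_exp m v i - \<delta> i))"
    using assms(1) by (intro sum.cong) (simp_all add: degree_power_eq)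
  also have "\<dots> = nat (- (\<Sum>i\<le>m. \<delta> i))" by (rule sum_expo_diff[OF assms(2)])
  finally have "coeff (\<Prod>i\<le>m. ?Y i) (nat (- (\<Sum>i\<le>m. \<delta> i))) = lead_coeff (\<Prod>i\<le>m. ?Y i)" by simp
  also have "\<dots> = (\<Prod>i\<le>m. q i ^ nat (hom_exp m v i - \<delta> i))"
    unfolding lead_coeff_prod using assms(1) by (intro prod.cong) (simp_all add: lead_coeff_power)
  finally show ?thesis by (simp add: hom_monomial_def)
qed

lemma proj_pt_self: "y \<in> proj_pt y"
  unfolding proj_pt_def by (auto intro!: exI[of _ 1])

lemma proj_pt_scale:
  assumes "c \<noteq> 0" shows "proj_pt (\<lambda>i. c * y i) = proj_pt y"
proof -
  have "\<exists>c'. (\<lambda>i. d * y i) = (\<lambda>i. c' * (c * y i)) \<and> c' \<noteq> 0" if "d \<noteq> 0" for d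
    using assms that by (intro exI[of _ "d / c"]) auto
  moreover have "\<exists>c'. (\<lambda>i. d * (c * y i)) = (\<lambda>i. c' * y i) \<and> c' \<noteq> 0" if "d \<noteq> 0" for d
    using assms that by (intro exI[of _ "d * c"]) auto
  ultimately show ?thesis unfolding proj_pt_def by (auto simp: set_eq_iff)
qed

lemma line_basis_points:
  "line_basis m L (p, q) \<Longrightarrow> L = {proj_pt (\<lambda>i. s * p i + t * q i) | s t. (s, t) \<noteq> (0, 0)}"
  unfolding line_basis_def prod.case by (elim conjE)

lemma line_basis_mem_iff:
  assumes "line_basis m L (p, q)" "y \<noteq> (\<lambda>_. 0)"
  shows "proj_pt y \<in> L \<longleftrightarrow> (\<exists>s t. y = (\<lambda>i. s * p i + t * q i))"
proof
  assume "proj_pt y \<in> L"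
  then obtain s t where "proj_pt y = proj_pt (\<lambda>i. s * p i + t * q i)"
    unfolding line_basis_points[OF assms(1)] by blast
  then have "y \<in> proj_pt (\<lambda>i. s * p i + t * q i)" using proj_pt_self[of y] by simp
  then obtain c where c: "y = (\<lambda>i. c * (s * p i + t * q i))" unfolding proj_pt_def by blast
  have "y = (\<lambda>i. (c * s) * p i + (c * t) * q i)" unfolding c by (rule ext) (simp add: algebra_simps)
  then show "\<exists>s t. y = (\<lambda>i. s * p i + t * q i)" by (intro exI)
next
  assume "\<exists>s t. y = (\<lambda>i. s * p i + t * q i)"
  then obtain s t where st: "y = (\<lambda>i. s * p i + t * q i)" by (elim exE)
  have "(s, t) \<noteq> (0, 0)" using assms(2) unfolding st by auto
  then show "proj_pt y \<in> L" unfolding line_basis_points[OF assms(1)] st by blast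
qed

lemma open_part_iff:
  assumes "line_basis m L (p, q)"
  shows "z \<in> open_part m L \<longleftrightarrow> z \<in> split_torus m \<and> (\<exists>s t. z(0 := 1) = (\<lambda>i. s * p i + t * q i))"
proof -
  have "z(0 := 1) \<noteq> (\<lambda>_. 0)" by (metis fun_upd_same zero_neq_one)
  then show ?thesis using line_basis_mem_iff[OF assms] by (simp add: open_part_def torus_pt_def)
qed

definition normalize_pt :: "nat \<Rightarrow> (nat \<Rightarrow> 'k::field) \<Rightarrow> nat \<Rightarrow> 'k" where
  "normalize_pt m y i = (if i \<in> {1..m} then y i / y 0 else 0)"

lemma normalize_pt_torus: "(\<And>i. i \<le> m \<Longrightarrow> y i \<noteq> 0) \<Longrightarrow> normalize_pt m y \<in> split_torus m"
  by (auto simp: split_torus_def normalize_pt_def)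

lemma normalize_pt_upd:
  "y \<in> hcoords m \<Longrightarrow> y 0 \<noteq> 0 \<Longrightarrow> (normalize_pt m y)(0 := 1) = (\<lambda>i. inverse (y 0) * y i)"
  by (auto simp: fun_eq_iff normalize_pt_def hcoords_def field_simps)

lemma line_basis_hcoords:
  assumes "line_basis m L (p, q)"
  shows "(\<lambda>i. s * p i + t * q i) \<in> hcoords m"
proof -
  have "p \<in> hcoords m" "q \<in> hcoords m"
    using assms unfolding line_basis_def prod.case by blast+
  then show ?thesis by (simp add: hcoords_def)
qed

lemma normalize_pt_open_part:
  assumes pq: "line_basis m L (p, q)" and y: "y = (\<lambda>i. s * p i + t * q i)" "\<And>i. i \<le> m \<Longrightarrow> y i \<noteq> 0"
  shows "normalize_pt m y \<in> open_part m L"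
proof -
  have "y \<in> hcoords m" unfolding y(1) by (rule line_basis_hcoords[OF pq])
  then have "(normalize_pt m y)(0 := 1) = (\<lambda>i. inverse (y 0) * y i)"
    using y(2) by (intro normalize_pt_upd) auto
  also have "\<dots> = (\<lambda>i. (inverse (y 0) * s) * p i + (inverse (y 0) * t) * q i)"
    unfolding y(1) by (rule ext) (simp only: distrib_left mult.assoc)
  finally show ?thesis
    using normalize_pt_torus[of m y, OF y(2)] unfolding open_part_iff[OF pq] by blast
qed

lemma split_torus_upd: "z \<in> split_torus m \<Longrightarrow> i \<le> m \<Longrightarrow> (z(0 := 1)) i \<noteq> 0"
  by (cases "i = 0") (simp_all add: split_torus_def)

lemma open_part_nonzero:
  assumes "line_basis m L (p, q)" "open_part m L \<noteq> {}" "i \<le> m"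
  shows "[:p i, q i:] \<noteq> 0"
proof -
  obtain z s t where z: "z \<in> split_torus m" "z(0 := 1) = (\<lambda>i. s * p i + t * q i)"
    using assms(2) open_part_iff[OF assms(1)] by blast
  have "s * p i + t * q i \<noteq> 0" using split_torus_upd[OF z(1) assms(3)] unfolding z(2) .
  then show ?thesis by auto
qed

lemma open_part_nonempty:
  fixes p q :: "nat \<Rightarrow> 'k::field"
  assumes inf: "infinite (UNIV :: 'k set)" and pq: "line_basis m L (p, q)"
    and nz: "\<And>i. i \<le> m \<Longrightarrow> [:p i, q i:] \<noteq> 0"
  shows "open_part m L \<noteq> {}"
proof -
  have "(\<Prod>i\<le>m. [:p i, q i:]) \<noteq> 0" using nz by auto
  then obtain t where t: "poly (\<Prod>i\<le>m. [:p i, q i:]) t \<noteq> 0"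
    using poly_eq_0_if_vanishes[OF inf one_neq_zero] by blast
  have "normalize_pt m (\<lambda>i. 1 * p i + t * q i) \<in> open_part m L"
    by (rule normalize_pt_open_part[OF pq refl]) (use t in \<open>auto simp: poly_prod\<close>)
  then show ?thesis by blast
qed

text \<open>
  At almost all \<open>t\<close> the point \<open>[p + t q]\<close> lies in the torus, where \<open>g\<close> and the polynomial in \<open>t\<close> differ by
  a nonzero factor; a polynomial with infinitely many roots vanishes. Conversely the polynomial
  controls \<open>g\<close> at all torus points of \<open>L\<close>, the one at \<open>t = \<infinity>\<close> through its top coefficient. So membership
  in \<open>I(L)\<close> can be tested in any basis of the line.
\<close>

lemma line_ideal_iff:
  fixes p q :: "nat \<Rightarrow> 'k::field"
  assumes inf: "infinite (UNIV :: 'k set)" and pq: "line_basis m L (p, q)"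
    and nz: "\<And>i. i \<le> m \<Longrightarrow> [:p i, q i:] \<noteq> 0" and g: "expo_bound m \<delta> g"
  shows "g \<in> line_ideal m L \<longleftrightarrow> hom_eval m \<delta> (\<lambda>i. [:p i, q i:]) g = 0" (is "_ \<longleftrightarrow> ?P = 0")
proof
  assume "g \<in> line_ideal m L"
  show "?P = 0"
  proof (rule poly_eq_0_if_vanishes[OF inf])
    show "(\<Prod>i\<le>m. [:p i, q i:]) \<noteq> 0" using nz by auto
    fix t assume "poly (\<Prod>i\<le>m. [:p i, q i:]) t \<noteq> 0"
    then have y: "1 * p i + t * q i \<noteq> 0" if "i \<le> m" for i using that by (auto simp: poly_prod)
    let ?y = "\<lambda>i. 1 * p i + t * q i"
    have "normalize_pt m ?y \<in> open_part m L" by (rule normalize_pt_open_part[OF pq refl y])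
    then have "0 = laurent_eval g (normalize_pt m ?y)"
      using \<open>g \<in> line_ideal m L\<close> by (simp add: line_ideal_def)
    also have "\<dots> = (\<Prod>i\<le>m. ?y i powi \<delta> i) * poly ?P t"
      unfolding poly_hom_eval
      by (subst laurent_eval_eq_hom[OF g, of ?y]) (use y in \<open>auto simp: normalize_pt_def\<close>)
    finally show "poly ?P t = 0" using y by simp
  qed
next
  assume P: "?P = 0"
  have "laurent_eval g z = 0" if "z \<in> open_part m L" for z
  proof -
    obtain s t where z: "z \<in> split_torus m" "z(0 := 1) = (\<lambda>i. s * p i + t * q i)"
      using \<open>z \<in> open_part m L\<close> open_part_iff[OF pq] by blast
    have st: "s * p i + t * q i = (if i = 0 then 1 else z i)" for i
      using fun_cong[OF z(2), of i] by auto
    have nz': "s * p i + t * q i \<noteq> 0" if "i \<le> m" for i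
      unfolding st using z(1) that by (auto simp: split_torus_def)
    show ?thesis
    proof (cases "s = 0")
      case False
      have y: "p i + t / s * q i = (s * p i + t * q i) / s" for i using False by (simp add: field_simps)
      have "p i + t / s * q i \<noteq> 0" if "i \<le> m" for i unfolding y using False nz'[OF that] by simp
      moreover have "z i = (p i + t / s * q i) / (p 0 + t / s * q 0)" if "i \<in> {1..m}" for i
        unfolding y st using False that by simp
      ultimately have "laurent_eval g z = (\<Prod>i\<le>m. (p i + t / s * q i) powi \<delta> i) * poly ?P (t / s)"
        unfolding poly_hom_eval
        by (subst laurent_eval_eq_hom[OF g, of "\<lambda>i. p i + t / s * q i"]) simp_all
      then show ?thesis using P by simp
    next
      case True
      then have q: "q i \<noteq> 0" if "i \<le> m" for i using nz'[OF that] by auto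
      have t: "t * q i = (if i = 0 then 1 else z i)" for i using st[of i] True by simp
      have "coeff ?P (nat (- (\<Sum>i\<le>m. \<delta> i)))
        = (\<Sum>v\<in>Poly_Mapping.keys g. Poly_Mapping.lookup g v * hom_monomial m \<delta> q v)"
        unfolding hom_eval.total_def coeff_sum coeff_smult
        by (intro sum.cong refl arg_cong2[where f = "(*)"] coeff_hom_monomial)
           (use q g in \<open>auto simp: expo_bound_def\<close>)
      moreover have "laurent_eval g z = (\<Prod>i\<le>m. q i powi \<delta> i) *
        (\<Sum>v\<in>Poly_Mapping.keys g. Poly_Mapping.lookup g v * hom_monomial m \<delta> q v)"
      proof (rule laurent_eval_eq_hom[OF g q])
        fix i assume "i \<in> {1..m}"
        then have "z i = t * q i" "t * q 0 = 1" using t[of i] t[of 0] by auto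
        then show "z i = q i / q 0" by (metis mult.commute mult_eq_0_iff nonzero_eq_divide_eq one_neq_zero mult.left_commute mult_1_right)
      qed
      ultimately show ?thesis using P by simp
    qed
  qed
  then show "g \<in> line_ideal m L"
    using g by (auto simp: line_ideal_def laurent_ring_def carrier_ring_def expo_bound_def)
qed

text \<open>
  The same polynomial in \<open>t\<close> decides vanishing in the function field, so that restriction to \<open>L\<close> as a
  rational function has the kernel \<open>I(L)\<close>.
\<close>

lemma sum_restrict_eq_0_iff:
  fixes Y :: "nat \<Rightarrow> 'k::field poly"
  assumes g: "expo_bound m \<delta> g" and nz: "\<And>i. i \<le> m \<Longrightarrow> Y i \<noteq> 0"
  shows "(\<Sum>v\<in>Poly_Mapping.keys g. Fraction_Field.Fract [:Poly_Mapping.lookup g v:] 1 *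
      (\<Prod>i\<in>Poly_Mapping.keys v. Fraction_Field.Fract (Y i) (Y 0) powi Poly_Mapping.lookup v i)) = 0
    \<longleftrightarrow> hom_eval m \<delta> Y g = 0"
proof -
  define emb :: "'k poly \<Rightarrow> 'k poly fract" where "emb a = Fraction_Field.Fract a 1" for a
  have emb_mult: "emb (a * b) = emb a * emb b" and emb_add: "emb (a + b) = emb a + emb b"
    and emb_0: "emb 0 = 0" and emb_1: "emb 1 = 1" for a b
    by (simp_all add: emb_def Zero_fract_def One_fract_def)
  have emb_smult: "emb (smult c P) = emb [:c:] * emb P" for c P
    using emb_mult[of "[:c:]" P] by simp
  have emb_eq_0: "emb a = 0 \<longleftrightarrow> a = 0" for a
    by (simp add: emb_def Zero_fract_def eq_fract)
  have emb_power: "emb (a ^ n) = emb a ^ n" for a n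
    by (induction n) (simp_all add: emb_mult emb_1)
  have emb_prod: "emb (prod f A) = (\<Prod>i\<in>A. emb (f i))" for f and A :: "nat set"
    by (induction A rule: infinite_finite_induct) (simp_all add: emb_mult emb_1)
  have emb_sum: "emb (sum f A) = (\<Sum>i\<in>A. emb (f i))" for f and A :: "(nat \<Rightarrow>\<^sub>0 int) set"
    by (induction A rule: infinite_finite_induct) (simp_all add: emb_add emb_0)
  have quot: "Fraction_Field.Fract (Y i) (Y 0) = emb (Y i) / emb (Y 0)" for i
    by (simp add: emb_def)
  let ?c = "\<Prod>i\<le>m. emb (Y i) powi \<delta> i"
  have "(\<Prod>i\<in>Poly_Mapping.keys v. Fraction_Field.Fract (Y i) (Y 0) powi Poly_Mapping.lookup v i)
      = ?c * emb (hom_monomial m \<delta> Y v)" if v: "v \<in> Poly_Mapping.keys g" for v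
  proof -
    have "emb (hom_monomial m \<delta> Y v) = hom_monomial m \<delta> (\<lambda>i. emb (Y i)) v"
      by (simp add: hom_monomial_def emb_prod emb_power)
    then show ?thesis unfolding quot
      by (subst prod_quotient_hom_monomial[where \<delta> = \<delta> and m = m])
         (use g v nz in \<open>auto simp: expo_bound_def emb_eq_0\<close>)
  qed
  then have "(\<Sum>v\<in>Poly_Mapping.keys g. Fraction_Field.Fract [:Poly_Mapping.lookup g v:] 1 *
      (\<Prod>i\<in>Poly_Mapping.keys v. Fraction_Field.Fract (Y i) (Y 0) powi Poly_Mapping.lookup v i))
     = (\<Sum>v\<in>Poly_Mapping.keys g. emb [:Poly_Mapping.lookup g v:] * (?c * emb (hom_monomial m \<delta> Y v)))"
    by (intro sum.cong) (simp_all add: emb_def)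
  also have "\<dots> = ?c * emb (hom_eval m \<delta> Y g)"
    by (simp add: hom_eval.total_def emb_sum sum_distrib_left emb_smult mult.left_commute)
  finally show ?thesis using nz by (auto simp: emb_eq_0)
qed

section \<open>Leading parts of polynomials in one variable\<close>

text \<open>
  Let \<open>t\<^sup>e\<close> have weight \<open>e \<theta>\<close>. The relation says that all terms of \<open>P\<close> have weight at least \<open>\<omega>\<close> and that \<open>P'\<close> is
  the part of weight \<open>\<omega>\<close>. This part may be zero, so \<open>\<omega>\<close> need not be the order of \<open>P\<close>; for this reason
  \<open>lead\<close> is a relation that is compatible with sums and products.
\<close>

definition lead :: "real \<Rightarrow> real \<Rightarrow> 'k::comm_ring_1 poly \<Rightarrow> 'k poly \<Rightarrow> bool" where
  "lead \<theta> \<omega> P P' \<longleftrightarrow> (\<forall>e. (real e * \<theta> < \<omega> \<longrightarrow> coeff P e = 0) \<and>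
     coeff P' e = (if real e * \<theta> = \<omega> then coeff P e else 0))"

lemma lead_zero: "lead \<theta> \<omega> 0 0"
  by (simp add: lead_def)

lemma lead_add: "lead \<theta> \<omega> P P' \<Longrightarrow> lead \<theta> \<omega> Q Q' \<Longrightarrow> lead \<theta> \<omega> (P + Q) (P' + Q')"
  by (simp add: lead_def)

lemma lead_sum: "(\<And>i. i \<in> A \<Longrightarrow> lead \<theta> \<omega> (P i) (P' i)) \<Longrightarrow> lead \<theta> \<omega> (\<Sum>i\<in>A. P i) (\<Sum>i\<in>A. P' i)"
  by (induction A rule: infinite_finite_induct) (auto simp: lead_zero lead_add)

lemma lead_smult: "lead \<theta> \<omega> P P' \<Longrightarrow> lead \<theta> \<omega> (smult c P) (smult c P')"
  by (simp add: lead_def)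

lemma lead_above: "lead \<theta> \<omega>' P P' \<Longrightarrow> \<omega> < \<omega>' \<Longrightarrow> lead \<theta> \<omega> P 0"
  by (auto simp: lead_def)

lemma lead_one: "lead \<theta> 0 1 1"
  by (auto simp: lead_def)

lemma lead_mult:
  assumes P: "lead \<theta> \<omega> P P'" and Q: "lead \<theta> \<eta> Q Q'"
  shows "lead \<theta> (\<omega> + \<eta>) (P * Q) (P' * Q')"
proof -
  have split: "real n * \<theta> = real i * \<theta> + real (n - i) * \<theta>" if "i \<le> n" for i n
    using that by (simp add: of_nat_diff algebra_simps)
  have low: "coeff P i * coeff Q (n - i) = 0" if "i \<le> n" "real n * \<theta> < \<omega> + \<eta>" for i n
  proof -
    have "real i * \<theta> < \<omega> \<or> real (n - i) * \<theta> < \<eta>" using split[OF that(1)] that(2) by linarith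
    then show ?thesis using P Q by (auto simp: lead_def)
  qed
  have eq: "coeff P' i * coeff Q' (n - i) = (if real n * \<theta> = \<omega> + \<eta> then coeff P i * coeff Q (n - i) else 0)"
    if le: "i \<le> n" for i n
  proof -
    consider "real i * \<theta> < \<omega>" | "real (n - i) * \<theta> < \<eta>" | "real i * \<theta> = \<omega>" "real (n - i) * \<theta> = \<eta>"
      | "real n * \<theta> > \<omega> + \<eta>" "real i * \<theta> \<noteq> \<omega> \<or> real (n - i) * \<theta> \<noteq> \<eta>"
      using split[OF le] by linarith
    then show ?thesis
    proof cases
      case 3
      then show ?thesis using P Q split[OF le] by (simp add: lead_def)
    qed (use P Q in \<open>auto simp: lead_def\<close>)
  qed
  show ?thesis unfolding lead_def coeff_mult
    using low eq by (auto intro!: sum.neutral sum.cong simp: eq)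
qed

lemma lead_power: "lead \<theta> \<omega> P P' \<Longrightarrow> lead \<theta> (real n * \<omega>) (P ^ n) (P' ^ n)"
proof (induction n)
  case (Suc n)
  then have "lead \<theta> (\<omega> + real n * \<omega>) (P * P ^ n) (P' * P' ^ n)" by (intro lead_mult) auto
  then show ?case by (simp add: algebra_simps)
qed (simp add: lead_one)

lemma lead_prod:
  assumes "finite A" "\<And>i. i \<in> A \<Longrightarrow> lead \<theta> (\<omega> i) (P i) (P' i)"
  shows "lead \<theta> (\<Sum>i\<in>A. \<omega> i) (\<Prod>i\<in>A. P i) (\<Prod>i\<in>A. P' i)"
  using assms by (induction A rule: finite_induct) (auto simp: lead_one intro!: lead_mult)

definition coord_weight :: "(nat \<Rightarrow>\<^sub>0 real) \<Rightarrow> nat \<Rightarrow> real" where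
  "coord_weight b i = (if i = 0 then 0 else Poly_Mapping.lookup b i)"

text \<open>
  A Laurent monomial of degree zero has the same weight when all \<open>y\<^sub>i\<close> are shifted by a constant \<open>w\<close>.
\<close>

lemma pairing_hom_exp:
  assumes "v \<in> coord_space m"
  shows "pairing b v = (\<Sum>i\<le>m. of_int (hom_exp m v i) * (coord_weight b i - w))"
proof -
  have "(\<Sum>i\<le>m. of_int (hom_exp m v i) * (coord_weight b i - w))
    = (\<Sum>i\<le>m. of_int (hom_exp m v i) * coord_weight b i) - w * of_int (\<Sum>i\<le>m. hom_exp m v i)"
    by (simp add: algebra_simps sum_subtractf sum_distrib_left)
  also have "\<dots> = (\<Sum>i=1..m. of_int (Poly_Mapping.lookup v i) * Poly_Mapping.lookup b i)"
    unfolding sum_hom_exp by (simp add: atMost_eq_insert_0 coord_weight_def hom_exp_def)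
  finally show ?thesis using assms by (simp add: pairing_coord_space mult.commute)
qed

text \<open>
  A homogeneous element is the initial form of its difference with any element of higher weights.
\<close>

lemma initial_form_diff:
  fixes g G :: "'e \<Rightarrow>\<^sub>0 'k::ab_group_add"
  assumes "g \<noteq> 0" "\<And>e. e \<in> Poly_Mapping.keys g \<Longrightarrow> wt e = \<kappa>" "\<And>e. e \<in> Poly_Mapping.keys G \<Longrightarrow> \<kappa> < wt e"
  shows "initial_form wt (g - G) = g"
proof (rule poly_mapping_eqI)
  fix e
  obtain e0 where e0: "e0 \<in> Poly_Mapping.keys g" using assms(1) by (metis keys_eq_empty ex_in_conv)
  have g0: "Poly_Mapping.lookup g e = 0" if "wt e \<noteq> \<kappa>" for e
    using assms(2) that by (auto simp: in_keys_iff)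
  have G0: "Poly_Mapping.lookup G e = 0" if "\<not> \<kappa> < wt e" for e
    using assms(3) that by (auto simp: in_keys_iff)
  have "e0 \<in> Poly_Mapping.keys (g - G)"
    using e0 assms(2)[OF e0] G0[of e0] by (simp add: in_keys_iff lookup_minus)
  moreover have "\<kappa> \<le> wt e" if "e \<in> Poly_Mapping.keys (g - G)" for e
  proof (rule ccontr)
    assume "\<not> \<kappa> \<le> wt e"
    then have "Poly_Mapping.lookup (g - G) e = 0" using g0[of e] G0[of e] by (simp add: lookup_minus)
    with that show False by (simp add: in_keys_iff)
  qed
  ultimately have "(\<forall>e'\<in>Poly_Mapping.keys (g - G). wt e \<le> wt e') \<longleftrightarrow> wt e \<le> \<kappa>" for e
    using assms(2)[OF e0] by (metis order_trans)
  then show "Poly_Mapping.lookup (initial_form wt (g - G)) e = Poly_Mapping.lookup g e"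
    using g0[of e] G0[of e] by (auto simp: initial_form_eq_filter lookup_filter_keys lookup_minus)
qed

section \<open>Adapted bases and the limit line\<close>

text \<open>
  A basis of a line that is adapted to the weight \<open>b\<close>: the coordinates \<open>y\<^sub>j\<close> and \<open>y\<^sub>k\<close> restrict to a basis of the
  linear forms on the line, and in \<open>y\<^sub>i = p\<^sub>i y\<^sub>j + q\<^sub>i y\<^sub>k\<close> the terms on the right that occur have at least
  the weight of \<open>y\<^sub>i\<close>. In the affine coordinate \<open>t\<close> one has \<open>y\<^sub>j = 1\<close> and \<open>y\<^sub>k = t\<close>.
  
  Keeping only the terms of the same weight as \<open>y\<^sub>i\<close> gives \<open>p0\<close> and \<open>q0\<close>, the initial forms of these
  linear equations. They define the limit line \<open>L0\<close>. The weights \<open>c\<close> are normalised to \<open>c j = 0\<close>, so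
  that \<open>t\<close> has weight \<open>c k\<close> and \<open>Y0 i\<close> is the part of weight \<open>c i\<close> of \<open>Y i\<close>.
\<close>

locale adapted_basis =
  fixes m :: nat and b :: "nat \<Rightarrow>\<^sub>0 real" and j k :: nat and p q :: "nat \<Rightarrow> 'k::field"
  assumes inf: "infinite (UNIV :: 'k set)"
    and jk: "j \<le> m" "k \<le> m" "p j = 1" "q j = 0" "p k = 0" "q k = 1"
    and p_weight: "i \<le> m \<Longrightarrow> p i \<noteq> 0 \<Longrightarrow> coord_weight b i \<le> coord_weight b j"
    and q_weight: "i \<le> m \<Longrightarrow> q i \<noteq> 0 \<Longrightarrow> coord_weight b i \<le> coord_weight b k"
    and hc: "p \<in> hcoords m" "q \<in> hcoords m"
begin

definition p0 :: "nat \<Rightarrow> 'k" where "p0 i = (if coord_weight b i = coord_weight b j then p i else 0)"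
definition q0 :: "nat \<Rightarrow> 'k" where "q0 i = (if coord_weight b i = coord_weight b k then q i else 0)"
definition Y :: "nat \<Rightarrow> 'k poly" where "Y i = [:p i, q i:]"
definition Y0 :: "nat \<Rightarrow> 'k poly" where "Y0 i = [:p0 i, q0 i:]"
definition c :: "nat \<Rightarrow> real" where "c i = coord_weight b i - coord_weight b j"
definition L0 :: "'k ppoint set" where "L0 = {proj_pt (\<lambda>i. s * p0 i + t * q0 i) | s t. (s, t) \<noteq> (0, 0)}"

lemma jk0: "p0 j = 1" "q0 j = 0" "p0 k = 0" "q0 k = 1"
  using jk by (simp_all add: p0_def q0_def)

lemma j_neq_k: "j \<noteq> k" using jk by auto

lemma line_basis_L0: "line_basis m L0 (p0, q0)"
proof -
  have "s = 0 \<and> t = 0" if "\<forall>i. s * p0 i + t * q0 i = 0" for s t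
    using that[rule_format, of j] that[rule_format, of k] by (simp add: jk0)
  moreover have "p0 \<in> hcoords m" "q0 \<in> hcoords m" using hc by (auto simp: hcoords_def p0_def q0_def)
  ultimately show ?thesis unfolding line_basis_def prod.case L0_def by blast
qed

lemma lead_Y:
  assumes "i \<le> m"
  shows "lead (c k) (c i) (Y i) (Y0 i)"
proof -
  have "coeff (Y0 i) e = (if real e * c k = c i then coeff (Y i) e else 0)" for e
  proof -
    consider "e = 0" | "e = 1" | "e \<ge> 2" by linarith
    then show ?thesis
      by cases (auto simp: Y_def Y0_def p0_def q0_def c_def coeff_eq_0 coeff_pCons split: nat.splits)
  qed
  moreover have "coeff (Y i) e = 0" if e: "real e * c k < c i" for e
  proof -
    consider "e = 0" | "e = 1" | "e \<ge> 2" by linarith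
    then show ?thesis
    proof cases
      case 1
      then show ?thesis using e p_weight[OF assms] by (force simp: Y_def c_def)
    next
      case 2
      then show ?thesis using e q_weight[OF assms] by (force simp: Y_def c_def)
    qed (auto simp: Y_def coeff_pCons split: nat.splits)
  qed
  ultimately show ?thesis by (simp add: lead_def)
qed

lemma lead_hom_monomial:
  assumes v: "v \<in> coord_space m" "\<And>i. i \<le> m \<Longrightarrow> \<delta> i \<le> hom_exp m v i"
  shows "lead (c k) (pairing b v - (\<Sum>i\<le>m. of_int (\<delta> i) * c i)) (hom_monomial m \<delta> Y v) (hom_monomial m \<delta> Y0 v)"
proof -
  have "lead (c k) (\<Sum>i\<le>m. real (nat (hom_exp m v i - \<delta> i)) * c i) (hom_monomial m \<delta> Y v) (hom_monomial m \<delta> Y0 v)"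
    unfolding hom_monomial_def by (intro lead_prod lead_power lead_Y) auto
  moreover have "(\<Sum>i\<le>m. real (nat (hom_exp m v i - \<delta> i)) * c i)
      = (\<Sum>i\<le>m. of_int (hom_exp m v i) * c i - of_int (\<delta> i) * c i)"
    using v(2) by (intro sum.cong) (simp_all add: left_diff_distrib)
  ultimately show ?thesis
    using pairing_hom_exp[OF v(1), of b "coord_weight b j"] by (simp add: sum_subtractf c_def)
qed

text \<open>
  Restriction to the line respects the weights: since \<open>Y0 i\<close> is the leading part of \<open>Y i\<close>, the leading
  part of \<open>g\<close> on \<open>L\<close> is the initial part of \<open>g\<close>, restricted to the limit line.
\<close>

lemma lead_hom_eval:
  assumes g: "expo_bound m \<delta> g" and \<kappa>: "\<And>v. v \<in> Poly_Mapping.keys g \<Longrightarrow> \<kappa> \<le> pairing b v"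
  shows "lead (c k) (\<kappa> - (\<Sum>i\<le>m. of_int (\<delta> i) * c i)) (hom_eval m \<delta> Y g)
           (hom_eval m \<delta> Y0 (filter_keys (\<lambda>v. pairing b v = \<kappa>) g))"
  unfolding hom_eval.total_filter_keys hom_eval.total_def[of m \<delta> Y]
proof (rule lead_sum)
  fix v assume v: "v \<in> Poly_Mapping.keys g"
  let ?a = "Poly_Mapping.lookup g v"
  have l: "lead (c k) (pairing b v - (\<Sum>i\<le>m. of_int (\<delta> i) * c i))
      (smult ?a (hom_monomial m \<delta> Y v)) (smult ?a (hom_monomial m \<delta> Y0 v))"
    by (intro lead_smult lead_hom_monomial) (use g v in \<open>auto simp: expo_bound_def\<close>)
  show "lead (c k) (\<kappa> - (\<Sum>i\<le>m. of_int (\<delta> i) * c i)) (smult ?a (hom_monomial m \<delta> Y v))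
      (if pairing b v = \<kappa> then smult ?a (hom_monomial m \<delta> Y0 v) else 0)"
  proof (cases "pairing b v = \<kappa>")
    case False
    then show ?thesis using lead_above[OF l] \<kappa>[OF v] by simp
  qed (use l in simp)
qed

text \<open>
  By \<open>lead_hom_eval\<close>, since the leading part of the zero polynomial is zero.
\<close>

lemma initial_part_vanishes:
  assumes "expo_bound m \<delta> g" "\<And>v. v \<in> Poly_Mapping.keys g \<Longrightarrow> \<kappa> \<le> pairing b v" "hom_eval m \<delta> Y g = 0"
  shows "hom_eval m \<delta> Y0 (filter_keys (\<lambda>v. pairing b v = \<kappa>) g) = 0"
  using lead_hom_eval[OF assms(1,2)] unfolding assms(3) lead_def by (intro poly_eqI) auto

text \<open>
  On the limit line a monomial restricts to a polynomial in which every power of \<open>t\<close> has the weight of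
  that monomial, up to the shift by \<open>\<delta>\<close>. So parts of different weights involve different powers of \<open>t\<close> and
  cannot cancel each other.
\<close>

lemma homogeneous_part_vanishes:
  assumes g: "expo_bound m \<delta> g" and van: "hom_eval m \<delta> Y0 g = 0"
  shows "hom_eval m \<delta> Y0 (filter_keys (\<lambda>v. pairing b v = \<kappa>) g) = 0"
proof (rule poly_eqI)
  fix e
  let ?d = "\<Sum>i\<le>m. of_int (\<delta> i) * c i"
  have *: "coeff (smult a (hom_monomial m \<delta> Y0 v)) e = 0"
    if "v \<in> Poly_Mapping.keys g" "real e * c k \<noteq> pairing b v - ?d" for v a
    using lead_hom_monomial[of v \<delta>] g that by (auto simp: lead_def expo_bound_def)
  show "coeff (hom_eval m \<delta> Y0 (filter_keys (\<lambda>v. pairing b v = \<kappa>) g)) e = coeff 0 e"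
  proof (cases "real e * c k = \<kappa> - ?d")
    case True
    have "coeff (hom_eval m \<delta> Y0 (filter_keys (\<lambda>v. pairing b v = \<kappa>) g)) e = coeff (hom_eval m \<delta> Y0 g) e"
      unfolding hom_eval.total_filter_keys hom_eval.total_def[of m \<delta> Y0] coeff_sum
    proof (rule sum.cong)
      fix v assume "v \<in> Poly_Mapping.keys g"
      then show "coeff (if pairing b v = \<kappa> then smult (Poly_Mapping.lookup g v) (hom_monomial m \<delta> Y0 v) else 0) e
        = coeff (smult (Poly_Mapping.lookup g v) (hom_monomial m \<delta> Y0 v)) e"
        using *[of v "Poly_Mapping.lookup g v"] True by auto
    qed simp
    then show ?thesis using van by simp
  next
    case False
    then show ?thesis
      unfolding hom_eval.total_filter_keys coeff_sum
      by (simp, intro sum.neutral) (use * in auto)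
  qed
qed

text \<open>
  The monomial \<open>y\<^sup>\<delta> y\<^sub>k\<^sup>e y\<^sub>j\<^sup>d\<close> restricts to the pure power \<open>t\<^sup>e\<close>, because \<open>y\<^sub>j = 1\<close> and \<open>y\<^sub>k = t\<close>.
\<close>

lemma hom_monomial_jk:
  assumes "\<And>i. i \<le> m \<Longrightarrow> hom_exp m v i = \<delta> i + (if i = k then int e else 0) + (if i = j then int d else 0)"
  shows "hom_monomial m \<delta> Y v = monom 1 e"
proof -
  have "hom_monomial m \<delta> Y v = (\<Prod>i\<le>m. (if i = k then Y k ^ e else 1) * (if i = j then Y j ^ d else 1))"
    unfolding hom_monomial_def using assms j_neq_k by (intro prod.cong) auto
  also have "\<dots> = Y k ^ e * Y j ^ d" using jk by (simp add: prod.distrib)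
  also have "\<dots> = monom 1 e" using jk by (simp add: Y_def monom_altdef flip: one_pCons)
  finally show ?thesis .
qed

lemma weight_jk:
  assumes v: "v \<in> coord_space m"
    and e: "\<And>i. i \<le> m \<Longrightarrow> hom_exp m v i = \<delta> i + (if i = k then int e else 0) + (if i = j then int d else 0)"
  shows "pairing b v = (\<Sum>i\<le>m. of_int (\<delta> i) * c i) + real e * c k"
proof -
  have "pairing b v = (\<Sum>i\<le>m. of_int (hom_exp m v i) * c i)"
    using pairing_hom_exp[OF v, of b "coord_weight b j"] by (simp add: c_def)
  also have "\<dots> = (\<Sum>i\<le>m. of_int (\<delta> i) * c i + ((if i = k then real e * c k else 0) + (if i = j then real d * c j else 0)))"
    using e by (intro sum.cong) (auto simp: algebra_simps)
  also have "\<dots> = (\<Sum>i\<le>m. of_int (\<delta> i) * c i) + (real e * c k + real d * c j)"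
    using jk by (simp add: sum.distrib)
  finally show ?thesis by (simp add: c_def)
qed

text \<open>
  The core of the argument. Restrict a homogeneous \<open>g\<close> of weight \<open>\<kappa>\<close> to \<open>L\<close>. Its leading part is the
  restriction to the limit line, which is zero, so only powers \<open>t\<^sup>e\<close> of higher weight remain. Each of them
  is the restriction of a monomial in \<open>y\<^sub>j\<close> and \<open>y\<^sub>k\<close> of the same degree and the same weight as \<open>t\<^sup>e\<close>.
  Subtracting these monomials yields an element of \<open>I(L)\<close> with initial form \<open>g\<close>. Their exponents again
  lie above \<open>\<delta>\<close>, so the correction stays in the same graded piece of \<open>A(C)\<close>.
  
  The hypothesis is stated for the given \<open>\<delta>\<close> and not as membership in the ideal of the limit line, so
  that it also covers a limit line on which some coordinate vanishes.
\<close>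

lemma lift_homogeneous:
  assumes g: "expo_bound m \<delta> g" and van: "hom_eval m \<delta> Y0 g = 0"
    and hom: "\<And>v. v \<in> Poly_Mapping.keys g \<Longrightarrow> pairing b v = \<kappa>"
  obtains G where "expo_bound m \<delta> G" "\<And>v. v \<in> Poly_Mapping.keys G \<Longrightarrow> \<kappa> < pairing b v"
    "hom_eval m \<delta> Y (g - G) = 0"
proof (cases "g = 0")
  case True
  then show ?thesis by (intro that[of 0]) (auto simp: expo_bound_def)
next
  case False
  let ?P = "hom_eval m \<delta> Y g"
  define D where "D = nat (- (\<Sum>i\<le>m. \<delta> i))"
  obtain v0 where "v0 \<in> Poly_Mapping.keys g" using False by (metis keys_eq_empty ex_in_conv)
  then have "(\<Sum>i\<le>m. \<delta> i) \<le> (\<Sum>i\<le>m. hom_exp m v0 i)"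
    using g by (intro sum_mono) (auto simp: expo_bound_def)
  then have D: "int D = - (\<Sum>i\<le>m. \<delta> i)" by (simp add: D_def sum_hom_exp)
  have "filter_keys (\<lambda>v. pairing b v = \<kappa>) g = g"
  proof (rule poly_mapping_eqI)
    fix v
    show "Poly_Mapping.lookup (filter_keys (\<lambda>v. pairing b v = \<kappa>) g) v = Poly_Mapping.lookup g v"
      using hom[of v] by (cases "v \<in> Poly_Mapping.keys g") (simp_all add: lookup_filter_keys in_keys_iff)
  qed
  then have lead: "lead (c k) (\<kappa> - (\<Sum>i\<le>m. of_int (\<delta> i) * c i)) ?P 0"
    using lead_hom_eval[OF g, of \<kappa>] hom van by simp
  have high: "\<kappa> - (\<Sum>i\<le>m. of_int (\<delta> i) * c i) < real e * c k" if "coeff ?P e \<noteq> 0" for e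
  proof (rule ccontr)
    assume "\<not> ?thesis"
    then consider "real e * c k < \<kappa> - (\<Sum>i\<le>m. of_int (\<delta> i) * c i)" | "real e * c k = \<kappa> - (\<Sum>i\<le>m. of_int (\<delta> i) * c i)"
      by linarith
    then show False using lead[unfolded lead_def, rule_format, of e] that by cases auto
  qed
  have degP: "degree ?P \<le> D"
    unfolding hom_eval.total_def D_def
    by (intro degree_sum_le order_trans[OF degree_smult_le] degree_hom_monomial)
       (use g in \<open>auto simp: expo_bound_def Y_def\<close>)
  have "\<exists>v\<in>coord_space m. \<forall>i\<le>m. hom_exp m v i = \<delta> i + (if i = k then int e else 0) + (if i = j then int (D - e) else 0)"
    if "e \<le> D" for e
  proof -
    have "(\<Sum>i\<le>m. \<delta> i + (if i = k then int e else 0) + (if i = j then int (D - e) else 0)) = 0"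
      using jk that D by (simp add: sum.distrib)
    then show ?thesis by (rule hom_exp_surj) (intro bexI allI impI)
  qed
  note exV = this
  define V where "V e = (SOME v. v \<in> coord_space m \<and>
      (\<forall>i\<le>m. hom_exp m v i = \<delta> i + (if i = k then int e else 0) + (if i = j then int (D - e) else 0)))" for e
  have VV: "V e \<in> coord_space m \<and>
      (\<forall>i\<le>m. hom_exp m (V e) i = \<delta> i + (if i = k then int e else 0) + (if i = j then int (D - e) else 0))"
    if "e \<le> D" for e
    using exV[OF that] unfolding V_def Bex_def by (rule someI_ex)
  note V = VV[THEN conjunct1] VV[THEN conjunct2, rule_format]
  define E where "E = {e. e \<le> D \<and> coeff ?P e \<noteq> 0}"
  define G where "G = (\<Sum>e\<in>E. Poly_Mapping.single (V e) (coeff ?P e))"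
  have keysG: "Poly_Mapping.keys G \<subseteq> V ` E"
    unfolding G_def by (rule order_trans[OF keys_sum]) (auto split: if_splits)
  have Gb: "expo_bound m \<delta> G"
    unfolding expo_bound_def
  proof (intro conjI subsetI ballI allI impI)
    fix v assume "v \<in> Poly_Mapping.keys G"
    then obtain e where e: "e \<le> D" "v = V e" using keysG by (auto simp: E_def)
    show "v \<in> coord_space m" unfolding e(2) by (rule V(1)[OF e(1)])
    show "\<delta> i \<le> hom_exp m v i" if "i \<le> m" for i
      unfolding e(2) V(2)[OF e(1) that] by simp
  qed
  have "\<kappa> < pairing b v" if "v \<in> Poly_Mapping.keys G" for v
  proof -
    obtain e where e: "e \<le> D" "coeff ?P e \<noteq> 0" "v = V e" using keysG \<open>v \<in> _\<close> by (auto simp: E_def)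
    then show ?thesis using high[OF e(2)] weight_jk[OF V(1) V(2), of e] by simp
  qed
  moreover have "hom_eval m \<delta> Y G = ?P"
  proof -
    have "hom_eval m \<delta> Y G = (\<Sum>e\<in>E. smult (coeff ?P e) (hom_monomial m \<delta> Y (V e)))"
      by (simp add: G_def hom_eval.total_sum)
    also have "\<dots> = (\<Sum>e\<in>E. monom (coeff ?P e) e)"
    proof (rule sum.cong)
      fix e assume "e \<in> E"
      then have "hom_monomial m \<delta> Y (V e) = monom 1 e"
        by (intro hom_monomial_jk[where d = "D - e"] V(2)) (auto simp: E_def)
      then show "smult (coeff ?P e) (hom_monomial m \<delta> Y (V e)) = monom (coeff ?P e) e"
        by (simp add: smult_monom)
    qed simp
    also have "\<dots> = (\<Sum>e\<le>D. monom (coeff ?P e) e)"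
      by (rule sum.mono_neutral_left) (auto simp: E_def)
    also have "\<dots> = ?P" by (rule poly_as_sum_of_monoms'[OF degP])
    finally show ?thesis .
  qed
  ultimately show ?thesis using Gb by (intro that[of G]) (auto simp: hom_eval.total_diff)
qed

end

lemma line_basis_span:
  fixes P Q p q :: "nat \<Rightarrow> 'a::field"
  assumes PQ: "line_basis m L (P, Q)" and pq: "p \<in> hcoords m" "q \<in> hcoords m"
    and ind: "\<And>s t. (\<And>i. s * p i + t * q i = 0) \<Longrightarrow> s = 0 \<and> t = 0"
    and to: "\<And>i. p i = a1 * P i + a2 * Q i" "\<And>i. q i = b1 * P i + b2 * Q i"
    and from_: "\<And>i. P i = c1 * p i + c2 * q i" "\<And>i. Q i = d1 * p i + d2 * q i"
  shows "line_basis m L (p, q)"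
proof -
  have PQind: "s = 0 \<and> t = 0" if "\<And>i. s * P i + t * Q i = 0" for s t
    using PQ that unfolding line_basis_def prod.case by blast
  have PQ_eq: "s * P i + t * Q i = (s * c1 + t * d1) * p i + (s * c2 + t * d2) * q i" for s t i
    unfolding from_ by (simp add: algebra_simps)
  have pq_eq: "s * p i + t * q i = (s * a1 + t * b1) * P i + (s * a2 + t * b2) * Q i" for s t i
    unfolding to by (simp add: algebra_simps)
  have PQ_ne: "(s * c1 + t * d1, s * c2 + t * d2) \<noteq> (0, 0)" if "(s, t) \<noteq> (0, 0)" for s t
  proof
    assume "(s * c1 + t * d1, s * c2 + t * d2) = (0, 0)"
    then have "s * P i + t * Q i = 0" for i unfolding PQ_eq by simp
    then show False using PQind[of s t] that by simp
  qed
  have pq_ne: "(s * a1 + t * b1, s * a2 + t * b2) \<noteq> (0, 0)" if "(s, t) \<noteq> (0, 0)" for s t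
  proof
    assume "(s * a1 + t * b1, s * a2 + t * b2) = (0, 0)"
    then have "s * p i + t * q i = 0" for i unfolding pq_eq by simp
    then show False using ind[of s t] that by simp
  qed
  have inc: "proj_pt (\<lambda>i. s * f i + t * g i) \<in> {proj_pt (\<lambda>i. s * f i + t * g i) | s t. (s, t) \<noteq> (0, 0)}"
    if "(s, t) \<noteq> (0, 0)" for s t and f g :: "nat \<Rightarrow> 'a"
    using that by blast
  have "L = {proj_pt (\<lambda>i. s * p i + t * q i) | s t. (s, t) \<noteq> (0, 0)}"
    unfolding line_basis_points[OF PQ]
  proof (intro subset_antisym subsetI; elim CollectE exE conjE; hypsubst)
    fix s t assume "(s, t) \<noteq> (0 :: 'a, 0 :: 'a)"
    then show "proj_pt (\<lambda>i. s * P i + t * Q i) \<in> {proj_pt (\<lambda>i. s * p i + t * q i) | s t. (s, t) \<noteq> (0, 0)}"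
      unfolding PQ_eq by (rule inc[OF PQ_ne])
    show "proj_pt (\<lambda>i. s * p i + t * q i) \<in> {proj_pt (\<lambda>i. s * P i + t * Q i) | s t. (s, t) \<noteq> (0, 0)}"
      using \<open>(s, t) \<noteq> (0, 0)\<close> unfolding pq_eq by (rule inc[OF pq_ne])
  qed
  moreover have "\<forall>s t. (\<forall>i. s * p i + t * q i = 0) \<longrightarrow> s = 0 \<and> t = 0"
    using ind by blast
  ultimately show ?thesis unfolding line_basis_def prod.case using pq by (intro conjI)
qed

text \<open>
  Among the pairs \<open>(y\<^sub>j, y\<^sub>k)\<close> with nonzero \<open>2 \<times> 2\<close> minor take one of maximal total weight. By Cramer's rule
  \<open>p i \<noteq> 0\<close> means that the pair \<open>(i, k)\<close> has a nonzero minor as well, so maximality bounds the weight of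
  \<open>y\<^sub>i\<close> by that of \<open>y\<^sub>j\<close>; similarly for \<open>q i\<close>.
\<close>

lemma adapted_basis_exists:
  fixes L :: "'k::field ppoint set"
  assumes inf: "infinite (UNIV :: 'k set)" and "is_line m L"
  obtains j k p q where "adapted_basis m b j k p q" "line_basis m L (p, q)"
proof -
  obtain P Q where PQ: "line_basis m L (P, Q)" using assms(2) unfolding is_line_def by auto
  have hc: "P \<in> hcoords m" "Q \<in> hcoords m" using PQ unfolding line_basis_def prod.case by blast+
  have ind: "s = 0 \<and> t = 0" if "\<And>i. s * P i + t * Q i = 0" for s t
    using PQ that unfolding line_basis_def prod.case by blast
  define det where "det i l = P i * Q l - P l * Q i" for i l
  define Z where "Z = {(i, l). i \<le> m \<and> l \<le> m \<and> det i l \<noteq> 0}"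
  have "Z \<noteq> {}"
  proof
    assume Z: "Z = {}"
    have det0: "det i l = 0" for i l
    proof (cases "i \<le> m \<and> l \<le> m")
      case False
      then show ?thesis using hc by (auto simp: det_def hcoords_def)
    qed (use Z in \<open>auto simp: Z_def\<close>)
    have "P i = 0" for i
    proof -
      have "Q i * P l + (- P i) * Q l = 0" for l using det0[of i l] by (simp add: det_def algebra_simps)
      then show ?thesis using ind[of "Q i" "- P i"] by simp
    qed
    then show False using ind[of 1 0] by simp
  qed
  have "Z \<subseteq> {..m} \<times> {..m}" by (auto simp: Z_def)
  then have finZ: "finite Z" by (rule finite_subset) simp
  define wt where "wt = (\<lambda>(i, l). coord_weight b i + coord_weight b l)"
  have "Max (wt ` Z) \<in> wt ` Z" using finZ \<open>Z \<noteq> {}\<close> by (intro Max_in) auto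
  then obtain j k where jk: "(j, k) \<in> Z" "wt (j, k) = Max (wt ` Z)" by force
  have max: "coord_weight b i + coord_weight b l \<le> coord_weight b j + coord_weight b k"
    if "i \<le> m" "l \<le> m" "det i l \<noteq> 0" for i l
  proof -
    have "wt (i, l) \<le> Max (wt ` Z)" using finZ that by (intro Max_ge) (auto simp: Z_def)
    then show ?thesis using jk(2) by (simp add: wt_def)
  qed
  have jk': "j \<le> m" "k \<le> m" "det j k \<noteq> 0" using jk(1) by (auto simp: Z_def)
  define p where "p i = det i k / det j k" for i
  define q where "q i = det j i / det j k" for i
  have pq: "p j = 1" "q j = 0" "p k = 0" "q k = 1" using jk'(3) by (simp_all add: p_def q_def) (simp_all add: det_def)
  have phc: "p \<in> hcoords m" "q \<in> hcoords m"
    using hc by (simp_all add: hcoords_def p_def q_def det_def)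
  have "adapted_basis m b j k p q"
  proof
    show "coord_weight b i \<le> coord_weight b j" if "i \<le> m" "p i \<noteq> 0" for i
      using max[OF that(1) jk'(2)] that(2) by (auto simp: p_def)
    show "coord_weight b i \<le> coord_weight b k" if "i \<le> m" "q i \<noteq> 0" for i
      using max[OF jk'(1) that(1)] that(2) by (auto simp: q_def)
  qed (fact inf jk' pq phc)+
  moreover have "line_basis m L (p, q)"
  proof (rule line_basis_span[OF PQ phc])
    show "s = 0 \<and> t = 0" if "\<And>i. s * p i + t * q i = 0" for s t
      using that[of j] that[of k] pq by simp
    show "p i = (Q k / det j k) * P i + (- P k / det j k) * Q i" for i
      by (simp add: p_def det_def diff_divide_distrib mult.commute)
    show "q i = (- Q j / det j k) * P i + (P j / det j k) * Q i" for i
      by (simp add: q_def det_def diff_divide_distrib mult.commute)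
    show "P i = P j * p i + P k * q i" for i
    proof -
      have "P j * det i k + P k * det j i = P i * det j k" by (simp add: det_def algebra_simps)
      then show ?thesis using jk'(3) by (simp add: p_def q_def flip: add_divide_distrib)
    qed
    show "Q i = Q j * p i + Q k * q i" for i
    proof -
      have "Q j * det i k + Q k * det j i = Q i * det j k" by (simp add: det_def algebra_simps)
      then show ?thesis using jk'(3) by (simp add: p_def q_def flip: add_divide_distrib)
    qed
  qed
  ultimately show ?thesis by (rule that)
qed

section \<open>Monoid algebras and their ideals\<close>

text \<open>
  If \<open>F\<close> is multiplicative on monomials, the sum is a ring homomorphism. This is demanded on a set
  \<open>M\<close> of exponents only, since exponents outside \<open>\<int>\<^sup>m\<close> would involve negative powers of zero.
\<close>

locale keys_multiplicative = keys_linear F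
  for F :: "'e::comm_monoid_add \<Rightarrow> 'a::comm_ring_1 \<Rightarrow> 'b::comm_ring_1" +
  fixes M :: "'e set"
  assumes F_mult: "e \<in> M \<Longrightarrow> e' \<in> M \<Longrightarrow> F (e + e') (a * a') = F e a * F e' a'"
begin

lemma total_mult:
  assumes "Poly_Mapping.keys f \<subseteq> M" "Poly_Mapping.keys g \<subseteq> M"
  shows "total (f * g) = total f * total g"
proof -
  let ?s = "\<lambda>f e. Poly_Mapping.single e (Poly_Mapping.lookup f e)"
  have "f * g = (\<Sum>e\<in>Poly_Mapping.keys f. ?s f e) * (\<Sum>e\<in>Poly_Mapping.keys g. ?s g e)"
    by (simp flip: poly_mapping_decompose)
  also have "\<dots> = (\<Sum>e\<in>Poly_Mapping.keys f. \<Sum>e'\<in>Poly_Mapping.keys g.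
      Poly_Mapping.single (e + e') (Poly_Mapping.lookup f e * Poly_Mapping.lookup g e'))"
    by (simp add: sum_product mult_single)
  finally have "total (f * g) = (\<Sum>e\<in>Poly_Mapping.keys f. \<Sum>e'\<in>Poly_Mapping.keys g.
      F (e + e') (Poly_Mapping.lookup f e * Poly_Mapping.lookup g e'))"
    by (simp add: total_sum)
  also have "\<dots> = (\<Sum>e\<in>Poly_Mapping.keys f. \<Sum>e'\<in>Poly_Mapping.keys g.
      F e (Poly_Mapping.lookup f e) * F e' (Poly_Mapping.lookup g e'))"
    using assms by (intro sum.cong refl F_mult) auto
  also have "\<dots> = total f * total g" by (simp add: total_def sum_product)
  finally show ?thesis .
qed

end

lemma carrier_ring_simps [simp]:
  "carrier (carrier_ring A) = A" "x \<otimes>\<^bsub>carrier_ring A\<^esub> y = x * y" "x \<oplus>\<^bsub>carrier_ring A\<^esub> y = x + y"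
  "\<one>\<^bsub>carrier_ring A\<^esub> = 1" "\<zero>\<^bsub>carrier_ring A\<^esub> = 0"
  by (simp_all add: carrier_ring_def)

definition supported :: "'e set \<Rightarrow> ('e \<Rightarrow>\<^sub>0 'k::zero) set" where
  "supported M = {f. Poly_Mapping.keys f \<subseteq> M}"

lemma mpoly_ring_supported: "mpoly_ring H = carrier_ring (supported {\<mu>. Poly_Mapping.keys \<mu> \<subseteq> H})"
  unfolding mpoly_ring_def supported_def by (rule arg_cong[where f = carrier_ring]) auto

lemma laurent_ring_supported: "laurent_ring m = carrier_ring (supported (coord_space m))"
  by (simp add: laurent_ring_def supported_def)

definition submonoid :: "'e::monoid_add set \<Rightarrow> bool" where
  "submonoid M \<longleftrightarrow> 0 \<in> M \<and> (\<forall>x\<in>M. \<forall>y\<in>M. x + y \<in> M)"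

lemma submonoid_coord_space: "submonoid (coord_space m :: (nat \<Rightarrow>\<^sub>0 int) set)"
  by (auto simp: submonoid_def coord_space_add) (simp add: coord_space_def)

lemma submonoid_exponents: "submonoid {\<mu> :: 'x \<Rightarrow>\<^sub>0 nat. Poly_Mapping.keys \<mu> \<subseteq> H}"
  using Poly_Mapping.keys_add unfolding submonoid_def by fastforce

context
  fixes M :: "'e::comm_monoid_add set"
  assumes M: "submonoid M"
begin

lemma supported_0: "0 \<in> supported M" by (simp add: supported_def)

lemma supported_1: "(1 :: 'e \<Rightarrow>\<^sub>0 'k::comm_ring_1) \<in> supported M"
  using M by (simp add: supported_def submonoid_def)

lemma supported_add: "f \<in> supported M \<Longrightarrow> g \<in> supported M \<Longrightarrow> f + g \<in> supported M"
  for f g :: "'e \<Rightarrow>\<^sub>0 'k::comm_ring_1"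
  using Poly_Mapping.keys_add[of f g] unfolding supported_def by blast

lemma supported_uminus: "f \<in> supported M \<Longrightarrow> - f \<in> supported M"
  for f :: "'e \<Rightarrow>\<^sub>0 'k::comm_ring_1"
  by (auto simp: supported_def in_keys_iff)

lemma supported_mult: "f \<in> supported M \<Longrightarrow> g \<in> supported M \<Longrightarrow> f * g \<in> supported M"
  for f g :: "'e \<Rightarrow>\<^sub>0 'k::comm_ring_1"
proof -
  assume "f \<in> supported M" "g \<in> supported M"
  then have "a + b \<in> M" if "a \<in> Poly_Mapping.keys f" "b \<in> Poly_Mapping.keys g" for a b
    using that M unfolding supported_def submonoid_def by blast
  then show ?thesis using keys_mult[of f g] unfolding supported_def by blast
qed

lemma cring_supported: "cring (carrier_ring (supported M :: ('e \<Rightarrow>\<^sub>0 'k::comm_ring_1) set))"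
proof (rule cringI)
  show "abelian_group (carrier_ring (supported M :: ('e \<Rightarrow>\<^sub>0 'k) set))"
  proof (rule abelian_groupI)
    fix x assume "x \<in> carrier (carrier_ring (supported M :: ('e \<Rightarrow>\<^sub>0 'k) set))"
    then show "\<exists>y\<in>carrier (carrier_ring (supported M)). y \<oplus>\<^bsub>carrier_ring (supported M)\<^esub> x = \<zero>\<^bsub>carrier_ring (supported M)\<^esub>"
      by (intro bexI[of _ "- x"]) (simp_all add: supported_uminus)
  qed (simp_all add: supported_add supported_0 add_ac)
  show "comm_monoid (carrier_ring (supported M :: ('e \<Rightarrow>\<^sub>0 'k) set))"
    by (rule comm_monoidI) (simp_all add: supported_mult supported_1 mult_ac)
qed (simp add: distrib_right)

lemma ideal_supportedI:
  fixes I :: "('e \<Rightarrow>\<^sub>0 'k::comm_ring_1) set"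
  assumes "I \<subseteq> supported M" "0 \<in> I" "\<And>f g. f \<in> I \<Longrightarrow> g \<in> I \<Longrightarrow> f + g \<in> I"
    and mult: "\<And>f g. f \<in> supported M \<Longrightarrow> g \<in> I \<Longrightarrow> f * g \<in> I"
  shows "ideal I (carrier_ring (supported M))"
proof -
  let ?R = "carrier_ring (supported M :: ('e \<Rightarrow>\<^sub>0 'k) set)"
  interpret cring ?R by (rule cring_supported)
  have neg: "\<ominus>\<^bsub>?R\<^esub> f = - f" if "f \<in> I" for f
    using that assms(1) by (intro minus_equality) (auto simp: supported_uminus)
  have uminus: "- f \<in> I" if "f \<in> I" for f
    using mult[OF supported_uminus[OF supported_1] that] by simp
  show ?thesis
  proof (rule idealI)
    show "ring ?R" by (rule ring_axioms)
    show "subgroup I (add_monoid ?R)"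
    proof (rule add.subgroupI)
      show "\<ominus>\<^bsub>?R\<^esub> a \<in> I" if "a \<in> I" for a
        using neg[OF that] uminus[OF that] by simp
    qed (use assms in auto)
  next
    fix a x assume "a \<in> I" "x \<in> carrier ?R"
    then show "x \<otimes>\<^bsub>?R\<^esub> a \<in> I" "a \<otimes>\<^bsub>?R\<^esub> x \<in> I"
      using mult[of x a] by (simp_all add: mult.commute[of a x])
  qed
qed

lemma sum_in_ideal:
  fixes I :: "('e \<Rightarrow>\<^sub>0 'k::comm_ring_1) set"
  assumes "ideal I (carrier_ring (supported M))" "\<And>x. x \<in> A \<Longrightarrow> f x \<in> I"
  shows "(\<Sum>x\<in>A. f x) \<in> I"
proof -
  interpret I: ideal I "carrier_ring (supported M)" by fact
  show ?thesis using assms(2)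
  proof (induction A rule: infinite_finite_induct)
    case (insert x A)
    then show ?case using additive_subgroup.a_closed[OF I.is_additive_subgroup, of "f x" "sum f A"] by simp
  qed (use additive_subgroup.zero_closed[OF I.is_additive_subgroup] in auto)
qed

lemma ideal_genideal:
  fixes X :: "('e \<Rightarrow>\<^sub>0 'k::comm_ring_1) set"
  assumes "X \<subseteq> supported M"
  shows "ideal (genideal (carrier_ring (supported M)) X) (carrier_ring (supported M))"
proof -
  interpret cring "carrier_ring (supported M :: ('e \<Rightarrow>\<^sub>0 'k) set)" by (rule cring_supported)
  show ?thesis using assms by (intro genideal_ideal) simp
qed

end

lemma genideal_superset: "X \<subseteq> genideal R X"
  unfolding genideal_def by blast

lemma genideal_least: "ideal I R \<Longrightarrow> X \<subseteq> I \<Longrightarrow> genideal R X \<subseteq> I"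
  unfolding genideal_def by blast

lemma initial_form_min:
  "\<exists>\<kappa>. (\<forall>e\<in>Poly_Mapping.keys f. \<kappa> \<le> wt e) \<and> initial_form wt f = filter_keys (\<lambda>e. wt e = \<kappa>) f"
proof (intro exI conjI ballI)
  let ?k = "Min (wt ` Poly_Mapping.keys f)"
  show le: "?k \<le> wt e" if "e \<in> Poly_Mapping.keys f" for e using that by (intro Min_le) auto
  show "initial_form wt f = filter_keys (\<lambda>e. wt e = ?k) f"
  proof (rule poly_mapping_eqI)
    fix e
    show "Poly_Mapping.lookup (initial_form wt f) e = Poly_Mapping.lookup (filter_keys (\<lambda>e. wt e = ?k) f) e"
    proof (cases "e \<in> Poly_Mapping.keys f")
      case True
      then have "?k \<in> wt ` Poly_Mapping.keys f" by (intro Min_in) auto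
      then obtain e0 where "e0 \<in> Poly_Mapping.keys f" "wt e0 = ?k" by force
      then have "(\<forall>e'\<in>Poly_Mapping.keys f. wt e \<le> wt e') \<longleftrightarrow> wt e = ?k"
        using le True by (metis order_antisym)
      then show ?thesis by (simp add: initial_form_eq_filter lookup_filter_keys)
    qed (simp add: initial_form_eq_filter lookup_filter_keys in_keys_iff)
  qed
qed

lemma initial_form_supported: "f \<in> supported M \<Longrightarrow> initial_form wt f \<in> supported M"
  by (auto simp: supported_def initial_form_eq_filter keys_filter_keys)

interpretation filter_keys: keys_linear "\<lambda>e (c::'k::ab_group_add). if P e then Poly_Mapping.single e c else 0"
  rewrites "keys_linear.total (\<lambda>e (c::'k). if P e then Poly_Mapping.single e c else 0) = filter_keys P"
  for P :: "'e \<Rightarrow> bool"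
proof -
  show l: "keys_linear (\<lambda>e (c::'k). if P e then Poly_Mapping.single e c else 0)"
    by unfold_locales (simp add: single_add)
  show "keys_linear.total (\<lambda>e (c::'k). if P e then Poly_Mapping.single e c else 0) = filter_keys P"
    by (rule ext) (simp add: keys_linear.total_def[OF l] filter_keys_def sum.inter_filter)
qed

lemma prod_power_int_coord_space:
  fixes z :: "nat \<Rightarrow> 'a::field"
  assumes "v \<in> coord_space m"
  shows "(\<Prod>i\<in>Poly_Mapping.keys v. z i powi Poly_Mapping.lookup v i) = (\<Prod>i=1..m. z i powi Poly_Mapping.lookup v i)"
  using assms by (intro prod.mono_neutral_left) (auto simp: coord_space_def in_keys_iff)

lemma prod_power_int_add:
  fixes z :: "nat \<Rightarrow> 'a::field"
  assumes "v \<in> coord_space m" "v' \<in> coord_space m" "\<And>i. i \<in> {1..m} \<Longrightarrow> z i \<noteq> 0"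
  shows "(\<Prod>i\<in>Poly_Mapping.keys (v + v'). z i powi Poly_Mapping.lookup (v + v') i)
    = (\<Prod>i\<in>Poly_Mapping.keys v. z i powi Poly_Mapping.lookup v i) * (\<Prod>i\<in>Poly_Mapping.keys v'. z i powi Poly_Mapping.lookup v' i)"
  unfolding prod_power_int_coord_space[OF coord_space_add[OF assms(1,2)]] prod_power_int_coord_space[OF assms(1)]
      prod_power_int_coord_space[OF assms(2)] prod.distrib[symmetric]
  using assms(3) by (intro prod.cong) (simp_all add: lookup_add power_int_add)

interpretation laurent_eval: keys_linear "\<lambda>v c. c * (\<Prod>i\<in>Poly_Mapping.keys v. z i powi Poly_Mapping.lookup v i)"
  rewrites "keys_linear.total (\<lambda>v c. c * (\<Prod>i\<in>Poly_Mapping.keys v. z i powi Poly_Mapping.lookup v i)) = (\<lambda>f. laurent_eval f z)"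
  for z :: "nat \<Rightarrow> 'k::field"
proof -
  show l: "keys_linear (\<lambda>v c. c * (\<Prod>i\<in>Poly_Mapping.keys v. z i powi Poly_Mapping.lookup v i))"
    by unfold_locales (simp add: distrib_right)
  show "keys_linear.total (\<lambda>v c. c * (\<Prod>i\<in>Poly_Mapping.keys v. z i powi Poly_Mapping.lookup v i)) = (\<lambda>f. laurent_eval f z)"
    by (rule ext) (simp only: keys_linear.total_def[OF l] laurent_eval_def)
qed

lemma laurent_eval_mult:
  fixes z :: "nat \<Rightarrow> 'k::field"
  assumes z: "z \<in> split_torus m" and "f \<in> supported (coord_space m)" "g \<in> supported (coord_space m)"
  shows "laurent_eval (f * g) z = laurent_eval f z * laurent_eval g z"
proof -
  let ?F = "\<lambda>v c. c * (\<Prod>i\<in>Poly_Mapping.keys v. z i powi Poly_Mapping.lookup v i)"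
  have lin: "keys_linear ?F" by unfold_locales (simp add: distrib_right)
  have tot: "keys_linear.total ?F h = laurent_eval h z" for h
    unfolding keys_linear.total_def[OF lin] laurent_eval_def ..
  have "keys_multiplicative ?F (coord_space m)"
  proof (intro keys_multiplicative.intro keys_multiplicative_axioms.intro lin)
    fix v v' :: "nat \<Rightarrow>\<^sub>0 int" and c c' :: 'k
    assume "v \<in> coord_space m" "v' \<in> coord_space m"
    from prod_power_int_add[OF this, of z] show "c * c' * (\<Prod>i\<in>Poly_Mapping.keys (v + v'). z i powi Poly_Mapping.lookup (v + v') i)
      = c * (\<Prod>i\<in>Poly_Mapping.keys v. z i powi Poly_Mapping.lookup v i)
        * (c' * (\<Prod>i\<in>Poly_Mapping.keys v'. z i powi Poly_Mapping.lookup v' i))"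
      using z by (simp add: split_torus_def mult_ac)
  qed
  from keys_multiplicative.total_mult[OF this, of f g] show ?thesis
    using assms(2,3) unfolding supported_def tot by simp
qed

lemma ideal_line_ideal: "ideal (line_ideal m L :: ((nat \<Rightarrow>\<^sub>0 int) \<Rightarrow>\<^sub>0 'k::field) set) (laurent_ring m)"
  unfolding laurent_ring_supported
proof (rule ideal_supportedI[OF submonoid_coord_space])
  let ?I = "line_ideal m L :: ((nat \<Rightarrow>\<^sub>0 int) \<Rightarrow>\<^sub>0 'k) set"
  have mem: "f \<in> ?I \<longleftrightarrow> f \<in> supported (coord_space m) \<and> (\<forall>z\<in>open_part m L. laurent_eval f z = 0)" for f
    by (simp add: line_ideal_def laurent_ring_supported)
  show "?I \<subseteq> supported (coord_space m)" using mem by blast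
  show "0 \<in> ?I" by (simp add: mem supported_def laurent_eval_def)
  show "f + g \<in> ?I" if "f \<in> ?I" "g \<in> ?I" for f g
    using that by (simp add: mem supported_add[OF submonoid_coord_space] laurent_eval.total_add)
  show "f * g \<in> ?I" if "f \<in> supported (coord_space m)" "g \<in> ?I" for f g
    using that by (auto simp: mem supported_mult[OF submonoid_coord_space] open_part_def laurent_eval_mult)
qed

lemma line_ideal_supported: "f \<in> line_ideal m L \<Longrightarrow> f \<in> supported (coord_space m)"
  by (simp add: line_ideal_def laurent_ring_supported)

section \<open>The ideals of the embedded varieties\<close>

text \<open>
  The exponent of the image of \<open>x\<^sup>\<mu>\<close> under \<open>x\<^sub>h \<mapsto> \<chi>\<^sup>h\<close>. The inner sum is the multiple \<open>\<mu>(h) \<cdot> h\<close>.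
\<close>

definition expo_deg :: "(expo \<Rightarrow>\<^sub>0 nat) \<Rightarrow> expo" where
  "expo_deg \<mu> = (\<Sum>h\<in>Poly_Mapping.keys \<mu>. \<Sum>i<Poly_Mapping.lookup \<mu> h. h)"

lemma expo_deg_superset:
  "finite A \<Longrightarrow> Poly_Mapping.keys \<mu> \<subseteq> A \<Longrightarrow> expo_deg \<mu> = (\<Sum>h\<in>A. \<Sum>i<Poly_Mapping.lookup \<mu> h. h)"
  unfolding expo_deg_def by (rule sum.mono_neutral_left) (auto simp: in_keys_iff)

lemma sum_const_add: "(\<Sum>i<a + b. h) = (\<Sum>i<a. h) + (\<Sum>i<b::nat. h)" for h :: "'a::comm_monoid_add"
  by (induction b) (simp_all add: add_ac)

lemma expo_deg_add: "expo_deg (\<mu> + \<nu>) = expo_deg \<mu> + expo_deg \<nu>"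
proof -
  let ?A = "Poly_Mapping.keys \<mu> \<union> Poly_Mapping.keys \<nu>"
  show ?thesis using Poly_Mapping.keys_add[of \<mu> \<nu>]
    by (simp add: expo_deg_superset[of ?A] lookup_add sum_const_add sum.distrib)
qed

lemma expo_deg_0 [simp]: "expo_deg 0 = 0" by (simp add: expo_deg_def)

lemma expo_deg_single [simp]: "expo_deg (Poly_Mapping.single h 1) = h"
  by (simp add: expo_deg_def)

lemma expo_deg_closed:
  assumes "0 \<in> D" "\<And>x y. x \<in> D \<Longrightarrow> y \<in> D \<Longrightarrow> x + y \<in> D" "Poly_Mapping.keys \<mu> \<subseteq> D"
  shows "expo_deg \<mu> \<in> D"
proof -
  have mult: "(\<Sum>i<n. h) \<in> D" if "h \<in> D" for h and n :: nat
    by (induction n) (simp_all add: assms(1,2) that)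
  have sum: "(\<Sum>h\<in>A. g h) \<in> D" if "\<And>h. h \<in> A \<Longrightarrow> g h \<in> D" for g :: "expo \<Rightarrow> expo" and A
    using that by (induction A rule: infinite_finite_induct) (simp_all add: assms(1,2))
  show ?thesis unfolding expo_deg_def
    by (rule sum, rule mult) (use assms(3) in blast)
qed

lemma expo_deg_sum_list:
  assumes "set hs \<subseteq> H"
  obtains \<mu> where "Poly_Mapping.keys \<mu> \<subseteq> H" "expo_deg \<mu> = sum_list hs"
proof -
  have "\<exists>\<mu>. Poly_Mapping.keys \<mu> \<subseteq> H \<and> expo_deg \<mu> = sum_list hs" using assms
  proof (induction hs)
    case Nil
    show ?case by (rule exI[of _ 0]) simp
  next
    case (Cons h hs)
    then obtain \<mu> where \<mu>: "Poly_Mapping.keys \<mu> \<subseteq> H" "expo_deg \<mu> = sum_list hs" by auto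
    have "Poly_Mapping.keys (Poly_Mapping.single h 1 + \<mu>) \<subseteq> H"
      using Poly_Mapping.keys_add[of "Poly_Mapping.single h 1" \<mu>] \<mu>(1) Cons.prems by auto
    moreover have "expo_deg (Poly_Mapping.single h 1 + \<mu>) = sum_list (h # hs)"
      unfolding expo_deg_add expo_deg_single \<mu>(2) by simp
    ultimately show ?case by (intro exI conjI)
  qed
  then show ?thesis by (elim exE conjE) (rule that)
qed

lemma toric_map_eq:
  fixes f :: "(expo \<Rightarrow>\<^sub>0 nat) \<Rightarrow>\<^sub>0 'k::field"
  shows "toric_map f = (\<Sum>\<mu>\<in>Poly_Mapping.keys f. Poly_Mapping.single (expo_deg \<mu>) (Poly_Mapping.lookup f \<mu>))"
proof -
  have pow: "Poly_Mapping.single h (1::'k) ^ n = Poly_Mapping.single (\<Sum>i<n. h) 1" for h :: expo and n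
    by (induction n) (simp_all add: mult_single add.commute)
  have prod: "(\<Prod>h\<in>A. Poly_Mapping.single (g h) (1::'k)) = Poly_Mapping.single (\<Sum>h\<in>A. g h) 1"
    for g :: "expo \<Rightarrow> expo" and A
    by (induction A rule: infinite_finite_induct) (simp_all add: mult_single)
  show ?thesis
    unfolding toric_map_def pow prod by (simp add: mult_single expo_deg_def)
qed

definition zpow :: "nat \<Rightarrow> 'k::field ppoint set \<Rightarrow> (nat \<Rightarrow>\<^sub>0 int) \<Rightarrow> 'k poly fract" where
  "zpow m L v = (\<Prod>i\<in>Poly_Mapping.keys v. z_on_line m L i powi Poly_Mapping.lookup v i)"

definition kconst :: "'k::field \<Rightarrow> 'k poly fract" where
  "kconst c = Fraction_Field.Fract [:c:] 1"

lemma kconst_add: "kconst (a + b) = kconst a + kconst b"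
  by (simp add: kconst_def)

lemma kconst_mult: "kconst (a * b) = kconst a * kconst b"
  by (simp add: kconst_def mult.commute)

lemma kconst_1: "kconst 1 = 1"
  by (simp add: kconst_def One_fract_def flip: one_pCons)

interpretation restrict: keys_linear "\<lambda>(x :: expo) c. Poly_Mapping.single (fst x) (kconst c * zpow m L (snd x))"
  rewrites "keys_linear.total (\<lambda>(x :: expo) c. Poly_Mapping.single (fst x) (kconst c * zpow m L (snd x))) = restrict_map m L"
  for m and L :: "'k::field ppoint set"
proof -
  show l: "keys_linear (\<lambda>(x :: expo) c. Poly_Mapping.single (fst x) (kconst c * zpow m L (snd x)))"
    by unfold_locales (simp only: kconst_add distrib_right single_add)
  show "keys_linear.total (\<lambda>(x :: expo) c. Poly_Mapping.single (fst x) (kconst c * zpow m L (snd x))) = restrict_map m L"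
    by (rule ext, unfold keys_linear.total_def[OF l]) (simp add: restrict_map_def zpow_def kconst_def case_prod_unfold)
qed

definition J_eval :: "nat \<Rightarrow> 'k::field ppoint set \<Rightarrow> ((expo \<Rightarrow>\<^sub>0 nat) \<Rightarrow>\<^sub>0 'k) \<Rightarrow> ((nat \<Rightarrow>\<^sub>0 int) \<Rightarrow>\<^sub>0 'k poly fract)" where
  "J_eval m L f = restrict_map m L (toric_map f)"

interpretation J_eval: keys_linear "\<lambda>\<mu> c. Poly_Mapping.single (fst (expo_deg \<mu>)) (kconst c * zpow m L (snd (expo_deg \<mu>)))"
  rewrites "keys_linear.total (\<lambda>\<mu> c. Poly_Mapping.single (fst (expo_deg \<mu>)) (kconst c * zpow m L (snd (expo_deg \<mu>))))
    = J_eval m L"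
  for m and L :: "'k::field ppoint set"
proof -
  show l: "keys_linear (\<lambda>\<mu> c. Poly_Mapping.single (fst (expo_deg \<mu>)) (kconst c * zpow m L (snd (expo_deg \<mu>))))"
    by unfold_locales (simp only: kconst_add distrib_right single_add)
  show "keys_linear.total (\<lambda>\<mu> c. Poly_Mapping.single (fst (expo_deg \<mu>)) (kconst c * zpow m L (snd (expo_deg \<mu>))))
    = J_eval m L"
    by (rule ext) (simp add: keys_linear.total_def[OF l] J_eval_def toric_map_eq restrict.total_sum)
qed

text \<open>
  The Laurent polynomial in \<open>z\<close> that is the coefficient of \<open>\<chi>\<^sup>u\<close> in the image of \<open>f\<close> in \<open>A(C)\<close>.
\<close>

definition component :: "(nat \<Rightarrow>\<^sub>0 int) \<Rightarrow> ((expo \<Rightarrow>\<^sub>0 nat) \<Rightarrow>\<^sub>0 'k::field) \<Rightarrow> ((nat \<Rightarrow>\<^sub>0 int) \<Rightarrow>\<^sub>0 'k)" where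
  "component u f = (\<Sum>\<mu>\<in>Poly_Mapping.keys f.
     if fst (expo_deg \<mu>) = u then Poly_Mapping.single (snd (expo_deg \<mu>)) (Poly_Mapping.lookup f \<mu>) else 0)"

interpretation component: keys_linear "\<lambda>\<mu> (c::'k::field). if fst (expo_deg \<mu>) = u then Poly_Mapping.single (snd (expo_deg \<mu>)) c else 0"
  rewrites "keys_linear.total (\<lambda>\<mu> (c::'k). if fst (expo_deg \<mu>) = u then Poly_Mapping.single (snd (expo_deg \<mu>)) c else 0) = component u"
  for u
proof -
  show l: "keys_linear (\<lambda>\<mu> (c::'k). if fst (expo_deg \<mu>) = u then Poly_Mapping.single (snd (expo_deg \<mu>)) c else 0)"
    by unfold_locales (simp add: single_add)
  show "keys_linear.total (\<lambda>\<mu> (c::'k). if fst (expo_deg \<mu>) = u then Poly_Mapping.single (snd (expo_deg \<mu>)) c else 0) = component u"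
    by (rule ext) (simp only: keys_linear.total_def[OF l] component_def)
qed

lemma keys_component:
  "Poly_Mapping.keys (component u f) \<subseteq> {snd (expo_deg \<mu>) | \<mu>. \<mu> \<in> Poly_Mapping.keys f \<and> fst (expo_deg \<mu>) = u}"
  unfolding component_def by (rule order_trans[OF keys_sum]) (auto split: if_splits)

definition zeval :: "nat \<Rightarrow> 'k::field ppoint set \<Rightarrow> ((nat \<Rightarrow>\<^sub>0 int) \<Rightarrow>\<^sub>0 'k) \<Rightarrow> 'k poly fract" where
  "zeval m L g = (\<Sum>v\<in>Poly_Mapping.keys g. kconst (Poly_Mapping.lookup g v) * zpow m L v)"

interpretation zeval: keys_linear "\<lambda>v c. kconst c * zpow m L v"
  rewrites "keys_linear.total (\<lambda>v c. kconst c * zpow m L v) = zeval m L"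
  for m and L :: "'k::field ppoint set"
proof -
  show l: "keys_linear (\<lambda>v c. kconst c * zpow m L v)"
    by unfold_locales (simp only: kconst_add distrib_right)
  show "keys_linear.total (\<lambda>v c. kconst c * zpow m L v) = zeval m L"
    by (rule ext) (simp only: keys_linear.total_def[OF l] zeval_def)
qed

lemma lookup_J_eval: "Poly_Mapping.lookup (J_eval m L f) u = zeval m L (component u f)"
proof -
  have "zeval m L (component u f) = (\<Sum>\<mu>\<in>Poly_Mapping.keys f. if fst (expo_deg \<mu>) = u
      then kconst (Poly_Mapping.lookup f \<mu>) * zpow m L (snd (expo_deg \<mu>)) else 0)"
    unfolding component_def zeval.total_sum
    by (intro sum.cong refl) (simp add: zeval.total_single)
  then show ?thesis
    unfolding J_eval.total_def lookup_sum lookup_single by (simp add: when_def)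
qed

locale torus_line =
  fixes m :: nat and L :: "'k::field ppoint set"
  assumes infinite_field: "infinite (UNIV :: 'k set)"
    and line: "is_line m L" and meets: "open_part m L \<noteq> {}"
begin

lemma basis: "line_basis m L (the_basis m L)"
  using line unfolding is_line_def the_basis_def by (rule someI_ex)

lemma z_on_line_nonzero: "i \<le> m \<Longrightarrow> z_on_line m L i \<noteq> 0"
proof -
  assume i: "i \<le> m"
  obtain p q where pq: "the_basis m L = (p, q)" by (cases "the_basis m L")
  have "[:p i, q i:] \<noteq> 0" "[:p 0, q 0:] \<noteq> 0"
    using open_part_nonzero[OF _ meets] basis i unfolding pq by blast+
  then show ?thesis by (simp add: z_on_line_def pq Zero_fract_def eq_fract)
qed

lemma zeval_eq_0_iff:
  assumes "g \<in> supported (coord_space m)"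
  shows "zeval m L g = 0 \<longleftrightarrow> g \<in> line_ideal m L"
proof -
  obtain p q where pq: "the_basis m L = (p, q)" by (cases "the_basis m L")
  have pqL: "line_basis m L (p, q)" using basis unfolding pq .
  obtain \<delta> where \<delta>: "expo_bound m \<delta> g"
    using expo_bound_exists[OF assms[unfolded supported_def mem_Collect_eq]] by (elim exE)
  have nz: "[:p i, q i:] \<noteq> 0" if "i \<le> m" for i using open_part_nonzero[OF pqL meets that] .
  have "g \<in> line_ideal m L \<longleftrightarrow> hom_eval m \<delta> (\<lambda>i. [:p i, q i:]) g = 0"
    by (rule line_ideal_iff[OF infinite_field pqL nz \<delta>])
  also have "\<dots> \<longleftrightarrow> zeval m L g = 0"
    unfolding zeval_def zpow_def z_on_line_def pq kconst_def prod.case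
    by (rule sum_restrict_eq_0_iff[OF \<delta> nz, symmetric])
  finally show ?thesis by (rule sym)
qed

end

text \<open>
  \<open>D\<close> is the semigroup of exponents of \<open>A(C)\<close>, and \<open>E\<close> the exponents of monomials in \<open>S\<close>.
\<close>

locale generated_cone =
  fixes r m :: nat and \<sigma> :: "(nat \<Rightarrow>\<^sub>0 rat) set" and \<Delta> :: "nat \<Rightarrow> (nat \<Rightarrow>\<^sub>0 rat) set" and H :: "expo set"
  assumes generates: "{sum_list hs | hs. set hs \<subseteq> H} = dual_pts2 r m (big_cone m \<sigma> \<Delta>)"
begin

abbreviation D where "D \<equiv> dual_pts2 r m (big_cone m \<sigma> \<Delta>)"
abbreviation E where "E \<equiv> {\<mu> :: expo \<Rightarrow>\<^sub>0 nat. Poly_Mapping.keys \<mu> \<subseteq> H}"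

lemma expo_deg_D:
  assumes "\<mu> \<in> E"
  shows "expo_deg \<mu> \<in> D"
proof (rule expo_deg_closed)
  have "h \<in> D" if "h \<in> H" for h
  proof -
    have "sum_list [h] \<in> {sum_list hs | hs. set hs \<subseteq> H}" using that by (intro CollectI exI[of _ "[h]"]) simp
    then show ?thesis unfolding generates by simp
  qed
  then show "Poly_Mapping.keys \<mu> \<subseteq> D" using assms by blast
qed (fact dual_pts2_zero dual_pts2_add)+

lemma snd_expo_deg: "\<mu> \<in> E \<Longrightarrow> snd (expo_deg \<mu>) \<in> coord_space m"
  using expo_deg_D[of \<mu>] unfolding dual_pts2_def by (simp only: case_prod_unfold mem_Collect_eq)

lemma expo_deg_surj:
  assumes "x \<in> D"
  obtains \<mu> where "\<mu> \<in> E" "expo_deg \<mu> = x"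
proof -
  obtain hs where "set hs \<subseteq> H" "x = sum_list hs" using assms unfolding generates[symmetric] by blast
  then show ?thesis using expo_deg_sum_list that by (metis mem_Collect_eq)
qed

lemma component_supported: "f \<in> supported E \<Longrightarrow> component u f \<in> supported (coord_space m)"
  using keys_component[of u f] snd_expo_deg unfolding supported_def by blast

lemma ideal_J_eq: "ideal_J r m \<sigma> \<Delta> H L = {f \<in> supported E. J_eval m L f = 0}"
  by (simp add: ideal_J_def a_kernel_def' mpoly_ring_supported alg_L_def J_eval_def)

text \<open>
  The algebra \<open>A(L)\<close> is graded by \<open>M\<close>, so an element of \<open>S\<close> restricts to zero if and only if the coefficient
  of each \<open>\<chi>\<^sup>u\<close> does, and that is a condition on Laurent polynomials alone.
\<close>

lemma ideal_J_iff:
  assumes "torus_line m L"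
  shows "f \<in> ideal_J r m \<sigma> \<Delta> H L \<longleftrightarrow> f \<in> supported E \<and> (\<forall>u. component u f \<in> line_ideal m L)"
proof -
  have "J_eval m L f = 0 \<longleftrightarrow> (\<forall>u. zeval m L (component u f) = 0)"
    by (simp add: poly_mapping_eq_iff fun_eq_iff lookup_J_eval)
  then show ?thesis
    unfolding ideal_J_eq using torus_line.zeval_eq_0_iff[OF assms] component_supported by blast
qed

lemma J_eval_mult:
  fixes L :: "'k::field ppoint set"
  assumes "torus_line m L" "f \<in> supported E" "g \<in> supported E"
  shows "J_eval m L (f * g) = J_eval m L f * J_eval m L g"
proof -
  interpret torus_line m L by fact
  let ?F = "\<lambda>\<mu> c. Poly_Mapping.single (fst (expo_deg \<mu>)) (kconst c * zpow m L (snd (expo_deg \<mu>)))"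
  have "zpow m L (v + v') = zpow m L v * zpow m L v'" if "v \<in> coord_space m" "v' \<in> coord_space m" for v v'
    unfolding zpow_def using that z_on_line_nonzero by (intro prod_power_int_add) auto
  note zpow_add = this
  have lin: "keys_linear ?F"
    by unfold_locales (simp only: kconst_add distrib_right single_add)
  have tot: "keys_linear.total ?F h = J_eval m L h" for h
    by (simp only: keys_linear.total_def[OF lin] J_eval.total_def)
  have "keys_multiplicative ?F E"
  proof (intro keys_multiplicative.intro keys_multiplicative_axioms.intro lin)
    fix \<mu> \<nu> :: "expo \<Rightarrow>\<^sub>0 nat" and c c' :: 'k
    assume "\<mu> \<in> E" "\<nu> \<in> E"
    then have "zpow m L (snd (expo_deg (\<mu> + \<nu>))) = zpow m L (snd (expo_deg \<mu>)) * zpow m L (snd (expo_deg \<nu>))"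
      unfolding expo_deg_add snd_add by (intro zpow_add snd_expo_deg)
    then show "?F (\<mu> + \<nu>) (c * c') = ?F \<mu> c * ?F \<nu> c'"
      unfolding mult_single kconst_mult by (simp only: expo_deg_add fst_add mult_ac)
  qed
  from keys_multiplicative.total_mult[OF this, of f g] show ?thesis
    using assms(2,3) unfolding supported_def tot by simp
qed

lemma ideal_ideal_J:
  assumes "torus_line m L"
  shows "ideal (ideal_J r m \<sigma> \<Delta> H L) (mpoly_ring H)"
  unfolding mpoly_ring_supported ideal_J_eq
  by (rule ideal_supportedI[OF submonoid_exponents])
     (auto simp: supported_0[OF submonoid_exponents] supported_add[OF submonoid_exponents]
        supported_mult[OF submonoid_exponents] J_eval.total_add J_eval_mult[OF assms])

text \<open>
  \<open>J(L)\<close> is the kernel of a homomorphism to polynomials over the function field of \<open>L\<close> with exponents in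
  an ordered abelian group, and these form a domain.
\<close>

lemma prime_ideal_J:
  assumes L: "torus_line m L"
  shows "primeideal (ideal_J r m \<sigma> \<Delta> H L) (mpoly_ring H)"
proof (rule primeideal.intro)
  show "ideal (ideal_J r m \<sigma> \<Delta> H L) (mpoly_ring H)" by (rule ideal_ideal_J[OF L])
  show "cring (mpoly_ring H)" unfolding mpoly_ring_supported by (rule cring_supported[OF submonoid_exponents])
  show "primeideal_axioms (ideal_J r m \<sigma> \<Delta> H L) (mpoly_ring H)"
  proof
    have "J_eval m L (Poly_Mapping.single 0 1) = 1"
      by (simp only: J_eval.total_single expo_deg_0) (simp add: zpow_def kconst_1)
    then have "J_eval m L 1 \<noteq> 0" by simp
    then have "1 \<notin> ideal_J r m \<sigma> \<Delta> H L" by (simp add: ideal_J_eq)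
    then show "carrier (mpoly_ring H) \<noteq> ideal_J r m \<sigma> \<Delta> H L"
      using supported_1[OF submonoid_exponents] unfolding mpoly_ring_supported by auto
  next
    fix f g
    assume "f \<in> carrier (mpoly_ring H)" "g \<in> carrier (mpoly_ring H)" "f \<otimes>\<^bsub>mpoly_ring H\<^esub> g \<in> ideal_J r m \<sigma> \<Delta> H L"
    then show "f \<in> ideal_J r m \<sigma> \<Delta> H L \<or> g \<in> ideal_J r m \<sigma> \<Delta> H L"
      by (auto simp: mpoly_ring_supported ideal_J_eq J_eval_mult[OF L])
  qed
qed

end

section \<open>The limit line as a closure\<close>

interpretation mpoly_eval: keys_linear "\<lambda>\<mu> c. c * (\<Prod>i\<in>Poly_Mapping.keys \<mu>. y i ^ Poly_Mapping.lookup \<mu> i)"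
  rewrites "keys_linear.total (\<lambda>\<mu> c. c * (\<Prod>i\<in>Poly_Mapping.keys \<mu>. y i ^ Poly_Mapping.lookup \<mu> i)) = (\<lambda>F. mpoly_eval F y)"
  for y :: "nat \<Rightarrow> 'k::field"
proof -
  show l: "keys_linear (\<lambda>\<mu> c. c * (\<Prod>i\<in>Poly_Mapping.keys \<mu>. y i ^ Poly_Mapping.lookup \<mu> i))"
    by unfold_locales (simp add: distrib_right)
  show "keys_linear.total (\<lambda>\<mu> c. c * (\<Prod>i\<in>Poly_Mapping.keys \<mu>. y i ^ Poly_Mapping.lookup \<mu> i)) = (\<lambda>F. mpoly_eval F y)"
    by (rule ext) (simp only: keys_linear.total_def[OF l] mpoly_eval_def)
qed

lemma mpoly_eval_poly:
  "mpoly_eval F (\<lambda>i. poly (Y i) x)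
     = poly (\<Sum>\<mu>\<in>Poly_Mapping.keys F. smult (Poly_Mapping.lookup F \<mu>) (\<Prod>i\<in>Poly_Mapping.keys \<mu>. Y i ^ Poly_Mapping.lookup \<mu> i)) x"
  by (simp add: mpoly_eval_def poly_sum poly_prod)

lemma torus_pt_normalize:
  assumes "y \<in> hcoords m" "y 0 \<noteq> 0"
  shows "torus_pt (normalize_pt m y) = proj_pt y"
  unfolding torus_pt_def normalize_pt_upd[OF assms] by (rule proj_pt_scale) (use assms in simp)

text \<open>
  Join the given vector to one that represents a torus point. Almost all points on the joining line lie
  in the torus, so \<open>F\<close> vanishes at them and then, as a polynomial in the parameter, at the given vector.
\<close>

lemma mpoly_eval_vanishes_on_span:
  fixes p q :: "nat \<Rightarrow> 'k::field"
  assumes inf: "infinite (UNIV :: 'k set)" and pq: "line_basis m L (p, q)" and ne: "open_part m L \<noteq> {}"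
    and van: "\<And>P y. P \<in> torus_pt ` open_part m L \<Longrightarrow> y \<in> P \<Longrightarrow> mpoly_eval F y = 0"
  shows "mpoly_eval F (\<lambda>i. s * p i + t * q i) = 0"
proof -
  obtain z s0 t0 where z: "z \<in> split_torus m" "z(0 := 1) = (\<lambda>i. s0 * p i + t0 * q i)"
    using ne open_part_iff[OF pq] by blast
  define Y where "Y i = [:s * p i + t * q i, s0 * p i + t0 * q i:]" for i
  define R where "R = (\<Sum>\<mu>\<in>Poly_Mapping.keys F. smult (Poly_Mapping.lookup F \<mu>)
      (\<Prod>i\<in>Poly_Mapping.keys \<mu>. Y i ^ Poly_Mapping.lookup \<mu> i))"
  have "Y i \<noteq> 0" if "i \<le> m" for i
    using split_torus_upd[OF z(1) that] unfolding z(2) Y_def by simp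
  then have "(\<Prod>i\<le>m. Y i) \<noteq> 0" by simp
  have "R = 0"
  proof (rule poly_eq_0_if_vanishes[OF inf \<open>(\<Prod>i\<le>m. Y i) \<noteq> 0\<close>])
    fix x assume "poly (\<Prod>i\<le>m. Y i) x \<noteq> 0"
    then have nz: "poly (Y i) x \<noteq> 0" if "i \<le> m" for i using that by (simp add: poly_prod)
    have y: "(\<lambda>i. poly (Y i) x) = (\<lambda>i. (s + x * s0) * p i + (t + x * t0) * q i)"
      by (rule ext) (simp add: Y_def algebra_simps)
    have mem: "normalize_pt m (\<lambda>i. poly (Y i) x) \<in> open_part m L"
      by (rule normalize_pt_open_part[OF pq y nz])
    have "(\<lambda>i. poly (Y i) x) \<in> hcoords m" unfolding y by (rule line_basis_hcoords[OF pq])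
    then have "torus_pt (normalize_pt m (\<lambda>i. poly (Y i) x)) = proj_pt (\<lambda>i. poly (Y i) x)"
      by (rule torus_pt_normalize) (use nz in simp)
    then have "mpoly_eval F (\<lambda>i. poly (Y i) x) = 0"
      using van[OF imageI[OF mem], of "\<lambda>i. poly (Y i) x"] proj_pt_self[of "\<lambda>i. poly (Y i) x"] by simp
    then show "poly R x = 0" unfolding mpoly_eval_poly R_def .
  qed
  then have "mpoly_eval F (\<lambda>i. poly (Y i) 0) = 0" unfolding mpoly_eval_poly R_def by simp
  then show ?thesis by (simp add: Y_def)
qed

text \<open>
  The exponent \<open>v\<close> with \<open>z\<^sup>v = y\<^sub>i / y\<^sub>0\<close>.
\<close>

definition axis :: "nat \<Rightarrow> (nat \<Rightarrow>\<^sub>0 int)" where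
  "axis i = (if i = 0 then 0 else Poly_Mapping.single i 1)"

lemma axis_coord_space: "i \<le> m \<Longrightarrow> axis i \<in> coord_space m"
  by (auto simp: axis_def coord_space_def)

lemma hom_exp_axis:
  assumes "i \<le> m" "l \<le> m"
  shows "hom_exp m (axis i) l = (if l = i then 1 else 0) - (if l = 0 then 1 else 0)"
  using assms by (auto simp: hom_exp_def axis_def lookup_single when_def)

lemma pairing_axis: "pairing b (axis i) = coord_weight b i" for b :: "nat \<Rightarrow>\<^sub>0 real"
  by (simp add: axis_def coord_weight_def pairing_def)

lemma laurent_eval_axis: "laurent_eval (Poly_Mapping.single (axis i) a) z = a * (z(0 := 1)) i"
  by (simp add: laurent_eval.total_single axis_def)

context adapted_basis
begin

text \<open>
  The linear equation \<open>y\<^sub>i = P\<^sub>i y\<^sub>j + Q\<^sub>i y\<^sub>k\<close> of a line, divided by \<open>y\<^sub>0\<close>. Its exponents are bounded below by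
  \<open>-1\<close> at \<open>y\<^sub>0\<close> and by \<open>0\<close> elsewhere, which is the \<open>\<delta>\<close> used for it below.
\<close>

definition lin_form :: "(nat \<Rightarrow> 'k) \<Rightarrow> (nat \<Rightarrow> 'k) \<Rightarrow> nat \<Rightarrow> (nat \<Rightarrow>\<^sub>0 int) \<Rightarrow>\<^sub>0 'k" where
  "lin_form P Q i = Poly_Mapping.single (axis i) 1 - Poly_Mapping.single (axis j) (P i) - Poly_Mapping.single (axis k) (Q i)"

lemma hom_monomial_axis:
  assumes "i \<le> m"
  shows "hom_monomial m (\<lambda>l. if l = 0 then - 1 else 0) X (axis i) = X i"
proof -
  have "hom_monomial m (\<lambda>l. if l = 0 then - 1 else 0) X (axis i) = (\<Prod>l\<le>m. if l = i then X i else 1)"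
    unfolding hom_monomial_def using assms by (intro prod.cong) (auto simp: hom_exp_axis)
  then show ?thesis using assms by simp
qed

lemma keys_lin_form:
  "v \<in> Poly_Mapping.keys (lin_form P Q i) \<Longrightarrow> v = axis i \<or> v = axis j \<and> P i \<noteq> 0 \<or> v = axis k \<and> Q i \<noteq> 0"
  by (auto simp: lin_form_def in_keys_iff lookup_minus lookup_single when_def split: if_splits)

lemma expo_bound_lin_form:
  assumes "i \<le> m"
  shows "expo_bound m (\<lambda>l. if l = 0 then - 1 else 0) (lin_form P Q i)"
  unfolding expo_bound_def
proof (intro conjI subsetI ballI allI impI)
  fix v assume "v \<in> Poly_Mapping.keys (lin_form P Q i)"
  then obtain i' where i': "i' \<le> m" "v = axis i'"
    using keys_lin_form[of v P Q i] assms jk(1,2) by blast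
  show "v \<in> coord_space m" unfolding i'(2) by (rule axis_coord_space[OF i'(1)])
  show "(if l = 0 then - 1 else 0) \<le> hom_exp m v l" if "l \<le> m" for l
    unfolding i'(2) hom_exp_axis[OF i'(1) that] by simp
qed

lemma hom_eval_lin_form:
  assumes "i \<le> m" "X j = [:1, 0:]" "X k = [:0, 1:]" "X i = [:P i, Q i:]"
  shows "hom_eval m (\<lambda>l. if l = 0 then - 1 else 0) X (lin_form P Q i) = 0"
  unfolding lin_form_def hom_eval.total_diff hom_eval.total_single
  using assms jk by (simp add: hom_monomial_axis)

lemma lin_form_weight:
  assumes "v \<in> Poly_Mapping.keys (lin_form p0 q0 i)"
  shows "pairing b v = coord_weight b i"
proof -
  from keys_lin_form[OF assms] show ?thesis by (auto simp: pairing_axis p0_def q0_def split: if_splits)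
qed

end

lemma solve_linear_relation: "a - b * c - d * e = 0 \<Longrightarrow> a = c * b + e * d" for a :: "'a::comm_ring"
  by (simp add: algebra_simps)

locale adapted_line = adapted_basis m b j k p q
  for m b j k and p q :: "nat \<Rightarrow> 'k::field" +
  fixes L :: "'k ppoint set"
  assumes basis_L: "line_basis m L (p, q)" and meets_L: "open_part m L \<noteq> {}"
begin

lemma p0_q0_outside:
  assumes "\<not> i \<le> m"
  shows "p0 i = 0" "q0 i = 0"
  using hc assms by (auto simp: hcoords_def p0_def q0_def)

lemma Y_nonzero: "i \<le> m \<Longrightarrow> Y i \<noteq> 0"
  unfolding Y_def by (rule open_part_nonzero[OF basis_L meets_L])

lemma line_ideal_L_iff: "expo_bound m \<delta> g \<Longrightarrow> g \<in> line_ideal m L \<longleftrightarrow> hom_eval m \<delta> Y g = 0"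
  using line_ideal_iff[OF inf basis_L, of \<delta> g] Y_nonzero unfolding Y_def by blast

end

locale limit_line = adapted_line m b j k p q L
  for m b j k and p q :: "nat \<Rightarrow> 'k::field" and L +
  assumes Y0_nonzero: "i \<le> m \<Longrightarrow> Y0 i \<noteq> 0"
begin

lemma line_ideal_L0_iff: "expo_bound m \<delta> g \<Longrightarrow> g \<in> line_ideal m L0 \<longleftrightarrow> hom_eval m \<delta> Y0 g = 0"
  using line_ideal_iff[OF inf line_basis_L0, of \<delta> g] Y0_nonzero unfolding Y0_def by blast

lemma meets_L0: "open_part m L0 \<noteq> {}"
  by (rule open_part_nonempty[OF inf line_basis_L0]) (use Y0_nonzero in \<open>simp add: Y0_def\<close>)

lemma expo_bound_filter: "expo_bound m \<delta> g \<Longrightarrow> expo_bound m \<delta> (filter_keys P g)"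
  for g :: "(nat \<Rightarrow>\<^sub>0 int) \<Rightarrow>\<^sub>0 'k"
  by (auto simp: expo_bound_def keys_filter_keys)

lemma initial_part_line_ideal:
  assumes "g \<in> line_ideal m L" "\<And>v. v \<in> Poly_Mapping.keys g \<Longrightarrow> \<kappa> \<le> pairing b v"
  shows "filter_keys (\<lambda>v. pairing b v = \<kappa>) g \<in> line_ideal m L0"
proof -
  obtain \<delta> where \<delta>: "expo_bound m \<delta> g"
    using expo_bound_exists line_ideal_supported[OF assms(1)] unfolding supported_def by blast
  have "hom_eval m \<delta> Y g = 0" using assms(1) line_ideal_L_iff[OF \<delta>] by blast
  from initial_part_vanishes[OF \<delta> assms(2) this]
  show ?thesis unfolding line_ideal_L0_iff[OF expo_bound_filter[OF \<delta>]] .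
qed

lemma homogeneous_part_line_ideal:
  assumes "g \<in> line_ideal m L0"
  shows "filter_keys (\<lambda>v. pairing b v = \<kappa>) g \<in> line_ideal m L0"
proof -
  obtain \<delta> where \<delta>: "expo_bound m \<delta> g"
    using expo_bound_exists line_ideal_supported[OF assms(1)] unfolding supported_def by blast
  have "hom_eval m \<delta> Y0 g = 0" using assms line_ideal_L0_iff[OF \<delta>] by blast
  from homogeneous_part_vanishes[OF \<delta> this]
  show ?thesis unfolding line_ideal_L0_iff[OF expo_bound_filter[OF \<delta>]] .
qed

text \<open>
  Each equation of the limit line is homogeneous and vanishes on it, so it lifts to \<open>I(L)\<close> unless it
  is identically zero, as the equations with index \<open>j\<close> and \<open>k\<close> are.
\<close>

lemma lin_form_initial:
  assumes "i \<le> m"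
  shows "lin_form p0 q0 i \<in> initial_form (pairing b) ` line_ideal m L \<union> {0}"
proof (cases "lin_form p0 q0 i = 0")
  case False
  let ?g = "lin_form p0 q0 i" and ?\<delta> = "\<lambda>l. if l = 0 then - 1 else 0"
  note bound = expo_bound_lin_form[OF assms, of p0 q0]
  have van: "hom_eval m ?\<delta> Y0 ?g = 0"
    by (rule hom_eval_lin_form[OF assms]) (simp_all add: Y0_def jk0)
  obtain G where G: "expo_bound m ?\<delta> G" "\<And>v. v \<in> Poly_Mapping.keys G \<Longrightarrow> coord_weight b i < pairing b v"
      "hom_eval m ?\<delta> Y (?g - G) = 0"
    using lift_homogeneous[OF bound van lin_form_weight] by blast
  have "expo_bound m ?\<delta> (?g - G)"
    using bound G(1) keys_diff[of ?g G] unfolding expo_bound_def by blast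
  then have "?g - G \<in> line_ideal m L" using line_ideal_L_iff G(3) by blast
  moreover have "initial_form (pairing b) (?g - G) = ?g"
    by (rule initial_form_diff[OF False lin_form_weight G(2)])
  ultimately show ?thesis by (metis UnI1 imageI)
qed simp

lemma initial_forms_line_ideal: "initial_form (pairing b) ` line_ideal m L \<subseteq> line_ideal m L0"
proof
  fix g assume "g \<in> initial_form (pairing b) ` line_ideal m L"
  then obtain f where f: "f \<in> line_ideal m L" "g = initial_form (pairing b) f" by blast
  obtain \<kappa> where \<kappa>: "\<forall>e\<in>Poly_Mapping.keys f. \<kappa> \<le> pairing b e"
    "initial_form (pairing b) f = filter_keys (\<lambda>e. pairing b e = \<kappa>) f"
    using initial_form_min[of f "pairing b"] by (elim exE conjE)
  show "g \<in> line_ideal m L0" unfolding f(2) \<kappa>(2) by (rule initial_part_line_ideal[OF f(1) \<kappa>(1)[rule_format]])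
qed

text \<open>
  Initial forms of \<open>I(L)\<close> vanish on the limit line, and among them are its linear equations.
\<close>

lemma torus_locus_initial:
  "torus_locus m (initial_ideal (laurent_ring m) (pairing b) (line_ideal m L)) = open_part m L0" (is "?T = _")
proof (intro subset_antisym subsetI)
  fix z assume "z \<in> open_part m L0"
  have "initial_ideal (laurent_ring m) (pairing b) (line_ideal m L) \<subseteq> line_ideal m L0"
    unfolding initial_ideal_def by (rule genideal_least[OF ideal_line_ideal initial_forms_line_ideal])
  then have "laurent_eval f z = 0"
    if "f \<in> initial_ideal (laurent_ring m) (pairing b) (line_ideal m L)" for f
    using that \<open>z \<in> open_part m L0\<close> by (auto simp: line_ideal_def)
  moreover have "z \<in> split_torus m" using \<open>z \<in> open_part m L0\<close> by (simp add: open_part_def)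
  ultimately show "z \<in> ?T" unfolding torus_locus_def by blast
next
  fix z assume z: "z \<in> ?T"
  let ?y = "z(0 := 1)"
  have zt: "z \<in> split_torus m" using z by (simp add: torus_locus_def)
  have "?y i = ?y j * p0 i + ?y k * q0 i" for i
  proof (cases "i \<le> m")
    case True
    have "laurent_eval (lin_form p0 q0 i) z = 0"
    proof (cases "lin_form p0 q0 i = 0")
      case False
      then have "lin_form p0 q0 i \<in> initial_ideal (laurent_ring m) (pairing b) (line_ideal m L)"
        using lin_form_initial[OF True]
          genideal_superset[of "initial_form (pairing b) ` line_ideal m L" "laurent_ring m"]
        unfolding initial_ideal_def by blast
      then show ?thesis using z by (simp add: torus_locus_def)
    qed (simp add: laurent_eval_def)
    then have "?y i - p0 i * ?y j - q0 i * ?y k = 0"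
      unfolding lin_form_def laurent_eval.total_diff laurent_eval_axis mult_1_left .
    then show ?thesis by (rule solve_linear_relation)
  next
    case False
    then have "z i = 0" "i \<noteq> 0" using zt by (auto simp: split_torus_def)
    moreover have "p0 i = 0" "q0 i = 0" using False by (rule p0_q0_outside)+
    ultimately show ?thesis by simp
  qed
  then have "?y = (\<lambda>i. ?y j * p0 i + ?y k * q0 i)" by (rule ext)
  then show "z \<in> open_part m L0" unfolding open_part_iff[OF line_basis_L0] using zt by (intro conjI exI)
qed

text \<open>
  A form that vanishes at the torus points of \<open>L0\<close> vanishes on \<open>L0\<close>; conversely the linear equations
  of \<open>L0\<close> cut it out.
\<close>

lemma closure_L0: "proj_closure m (torus_pt ` open_part m L0) = L0"
proof (intro subset_antisym subsetI)
  fix P assume P: "P \<in> L0"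
  then obtain s t where st: "(s, t) \<noteq> (0, 0)" "P = proj_pt (\<lambda>i. s * p0 i + t * q0 i)"
    unfolding L0_def by blast
  have "(\<lambda>i. s * p0 i + t * q0 i) \<noteq> (\<lambda>_. 0)"
  proof
    assume "(\<lambda>i. s * p0 i + t * q0 i) = (\<lambda>_. 0)"
    from fun_cong[OF this, of j] fun_cong[OF this, of k] show False using st(1) by (simp add: jk0)
  qed
  then have "P \<in> proj_space m"
    unfolding proj_space_def st(2) using line_basis_hcoords[OF line_basis_L0] by blast
  moreover have "mpoly_eval F y = 0"
    if F: "\<forall>P'\<in>torus_pt ` open_part m L0. \<forall>y\<in>P'. mpoly_eval F y = 0" and y: "y \<in> P" for F y
  proof -
    obtain d where d: "y = (\<lambda>i. d * (s * p0 i + t * q0 i))" using y unfolding st(2) proj_pt_def by blast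
    have "y = (\<lambda>i. (d * s) * p0 i + (d * t) * q0 i)" unfolding d by (rule ext) (simp add: algebra_simps)
    then show ?thesis
      using mpoly_eval_vanishes_on_span[OF inf line_basis_L0 meets_L0, of F "d * s" "d * t"] F by simp
  qed
  ultimately show "P \<in> proj_closure m (torus_pt ` open_part m L0)"
    unfolding proj_closure_def by blast
next
  fix P assume P: "P \<in> proj_closure m (torus_pt ` open_part m L0)"
  then obtain y where y: "P = proj_pt y" "y \<in> hcoords m" "y \<noteq> (\<lambda>_. 0)"
    unfolding proj_closure_def proj_space_def by blast
  have "y i = y j * p0 i + y k * q0 i" for i
  proof (cases "i \<le> m")
    case True
    let ?e = "\<lambda>i. Poly_Mapping.single i (1::nat)"
    define F where "F = Poly_Mapping.single (?e i) 1 - Poly_Mapping.single (?e j) (p0 i) - Poly_Mapping.single (?e k) (q0 i)"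
    have keysF: "Poly_Mapping.keys F \<subseteq> {?e i, ?e j, ?e k}"
      by (auto simp: F_def in_keys_iff lookup_minus lookup_single when_def split: if_splits)
    have evalF: "mpoly_eval F x = x i - p0 i * x j - q0 i * x k" for x
      unfolding F_def mpoly_eval.total_diff mpoly_eval.total_single by simp
    have "F \<in> carrier (mpoly_ring {0..m})"
      using keysF True jk(1,2) unfolding mpoly_ring_supported carrier_ring_simps supported_def by fastforce
    moreover have "homogeneous_mpoly F"
      unfolding homogeneous_mpoly_def using keysF by (intro exI[of _ 1]) fastforce
    moreover have "mpoly_eval F x = 0" if x: "P' \<in> torus_pt ` open_part m L0" "x \<in> P'" for P' x
    proof -
      obtain z where z: "z \<in> open_part m L0" "x \<in> torus_pt z" using x by blast
      obtain s t where st: "z(0 := 1) = (\<lambda>i. s * p0 i + t * q0 i)"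
        using z(1) unfolding open_part_iff[OF line_basis_L0] by blast
      obtain d where "x = (\<lambda>i. d * (z(0 := 1)) i)" using z(2) unfolding torus_pt_def proj_pt_def by blast
      then have "x = (\<lambda>i. d * (s * p0 i + t * q0 i))" unfolding st .
      then show ?thesis unfolding evalF by (simp add: jk0 algebra_simps)
    qed
    ultimately have "mpoly_eval F y = 0"
      using P proj_pt_self[of y] unfolding proj_closure_def y(1) by blast
    then show ?thesis unfolding evalF by (rule solve_linear_relation)
  next
    case False
    then have "y i = 0" using y(2) by (simp add: hcoords_def)
    moreover have "p0 i = 0" "q0 i = 0" using False by (rule p0_q0_outside)+
    ultimately show ?thesis by simp
  qed
  then have "y = (\<lambda>i. y j * p0 i + y k * q0 i)" by (rule ext)
  then show "P \<in> L0" unfolding y(1) line_basis_mem_iff[OF line_basis_L0 y(3)] by (intro exI)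
qed

lemma closure_torus_locus_initial:
  "proj_closure m (torus_pt ` torus_locus m (initial_ideal (laurent_ring m) (pairing b) (line_ideal m L))) = L0"
  unfolding torus_locus_initial by (rule closure_L0)

end

section \<open>Tropical points are linear weights\<close>

text \<open>
  Gaussian elimination over the integers. Pick a vector with nonzero entry in the coordinate \<open>n\<close> and use it
  to clear this entry in all others; each integral relation of the new vectors yields one of the old
  vectors. Only integral relations enter, although the weights are real.
\<close>

lemma linear_weight_if_relations:
  fixes x :: "'i \<Rightarrow> 'v \<Rightarrow> int" and w :: "'i \<Rightarrow> real"
  assumes "finite V" "finite I"
    and "\<And>k. (\<And>l. l \<in> V \<Longrightarrow> (\<Sum>i\<in>I. k i * x i l) = 0) \<Longrightarrow> (\<Sum>i\<in>I. of_int (k i) * w i) = 0"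
  shows "\<exists>c. \<forall>i\<in>I. w i = (\<Sum>l\<in>V. c l * of_int (x i l))"
  using assms(1,3)
proof (induction V arbitrary: x w rule: finite_induct)
  case empty
  have "w i = 0" if "i \<in> I" for i
  proof -
    have "(\<Sum>j\<in>I. of_int (if j = i then 1 else 0) * w j) = 0" by (rule empty) simp
    moreover have "(\<Sum>j\<in>I. of_int (if j = i then 1 else 0) * w j) = (\<Sum>j\<in>I. if j = i then w i else 0)"
      by (rule sum.cong) auto
    ultimately show ?thesis using that assms(2) by simp
  qed
  then show ?case by simp
next
  case (insert n V)
  show ?case
  proof (cases "\<forall>i\<in>I. x i n = 0")
    case True
    have "\<exists>c. \<forall>i\<in>I. w i = (\<Sum>l\<in>V. c l * of_int (x i l))"
    proof (rule insert.IH)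
      fix k assume k: "\<And>l. l \<in> V \<Longrightarrow> (\<Sum>i\<in>I. k i * x i l) = 0"
      show "(\<Sum>i\<in>I. of_int (k i) * w i) = 0"
      proof (rule insert.prems)
        fix l assume "l \<in> insert n V"
        then show "(\<Sum>i\<in>I. k i * x i l) = 0" using k True by (cases "l = n") auto
      qed
    qed
    then obtain c where "\<forall>i\<in>I. w i = (\<Sum>l\<in>V. c l * of_int (x i l))" by blast
    then show ?thesis using True insert.hyps by (intro exI[of _ c]) simp
  next
    case False
    then obtain i0 where i0: "i0 \<in> I" "x i0 n \<noteq> 0" by blast
    define x' where "x' i l = x i0 n * x i l - x i n * x i0 l" for i l
    define w' where "w' i = of_int (x i0 n) * w i - of_int (x i n) * w i0" for i
    have "\<exists>c. \<forall>i\<in>I. w' i = (\<Sum>l\<in>V. c l * of_int (x' i l))"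
    proof (rule insert.IH)
      fix k assume k: "\<And>l. l \<in> V \<Longrightarrow> (\<Sum>i\<in>I. k i * x' i l) = 0"
      define s where "s = (\<Sum>i\<in>I. k i * x i n)"
      define k' where "k' i = k i * x i0 n - (if i = i0 then s else 0)" for i
      have k'x: "(\<Sum>i\<in>I. k' i * x i l) = (\<Sum>i\<in>I. k i * x' i l)" for l
      proof -
        have "(\<Sum>i\<in>I. k' i * x i l) = (\<Sum>i\<in>I. k i * x i0 n * x i l - (if i = i0 then s * x i0 l else 0))"
          by (rule sum.cong) (auto simp: k'_def left_diff_distrib)
        also have "\<dots> = (\<Sum>i\<in>I. k i * x i0 n * x i l) - s * x i0 l"
          using i0(1) assms(2) by (simp add: sum_subtractf)
        also have "\<dots> = (\<Sum>i\<in>I. k i * x' i l)"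
          by (simp add: x'_def s_def right_diff_distrib sum_subtractf sum_distrib_left mult_ac)
        finally show ?thesis .
      qed
      have "(\<Sum>i\<in>I. of_int (k' i) * w i) = 0"
      proof (rule insert.prems)
        fix l assume "l \<in> insert n V"
        then consider "l = n" | "l \<in> V" by blast
        then show "(\<Sum>i\<in>I. k' i * x i l) = 0"
          unfolding k'x using k by cases (simp_all add: x'_def)
      qed
      moreover have "(\<Sum>i\<in>I. of_int (k' i) * w i) = (\<Sum>i\<in>I. of_int (k i) * w' i)"
      proof -
        have "(\<Sum>i\<in>I. of_int (k' i) * w i)
            = (\<Sum>i\<in>I. of_int (k i) * of_int (x i0 n) * w i - (if i = i0 then of_int s * w i0 else 0))"
          by (rule sum.cong) (auto simp: k'_def left_diff_distrib)
        also have "\<dots> = (\<Sum>i\<in>I. of_int (k i) * of_int (x i0 n) * w i) - of_int s * w i0"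
          using i0(1) assms(2) by (simp add: sum_subtractf)
        also have "\<dots> = (\<Sum>i\<in>I. of_int (k i) * w' i)"
          by (simp add: w'_def s_def right_diff_distrib sum_subtractf sum_distrib_left mult_ac)
        finally show ?thesis .
      qed
      ultimately show "(\<Sum>i\<in>I. of_int (k i) * w' i) = 0" by simp
    qed
    then obtain c where c: "\<forall>i\<in>I. w' i = (\<Sum>l\<in>V. c l * of_int (x' i l))" by blast
    define cn where "cn = (w i0 - (\<Sum>l\<in>V. c l * of_int (x i0 l))) / of_int (x i0 n)"
    have w0: "w i0 = cn * of_int (x i0 n) + (\<Sum>l\<in>V. c l * of_int (x i0 l))"
      using i0(2) by (simp add: cn_def)
    have "w i = cn * of_int (x i n) + (\<Sum>l\<in>V. c l * of_int (x i l))" if "i \<in> I" for i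
    proof -
      have "of_int (x i0 n) * w i = w' i + of_int (x i n) * w i0" by (simp add: w'_def)
      also have "w' i = of_int (x i0 n) * (\<Sum>l\<in>V. c l * of_int (x i l)) - of_int (x i n) * (\<Sum>l\<in>V. c l * of_int (x i0 l))"
        using c that by (simp add: x'_def right_diff_distrib sum_subtractf sum_distrib_left mult_ac)
      also have "\<dots> + of_int (x i n) * w i0 = of_int (x i0 n) * (cn * of_int (x i n) + (\<Sum>l\<in>V. c l * of_int (x i l)))"
        unfolding w0 by (simp add: algebra_simps)
      finally show ?thesis using i0(2) by simp
    qed
    moreover have "(\<Sum>l\<in>insert n V. (c(n := cn)) l * of_int (x i l)) = cn * of_int (x i n) + (\<Sum>l\<in>V. c l * of_int (x i l))" for i
    proof -
      have "(\<Sum>l\<in>V. (c(n := cn)) l * of_int (x i l)) = (\<Sum>l\<in>V. c l * of_int (x i l))"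
        using insert.hyps by (intro sum.cong) auto
      then show ?thesis using insert.hyps by simp
    qed
    ultimately show ?thesis by (intro exI[of _ "c(n := cn)"]) simp
  qed
qed

lemma single_neq_0: "a \<noteq> 0 \<Longrightarrow> Poly_Mapping.single e a \<noteq> 0"
  by (metis lookup_single_eq lookup_zero)

lemma lookup_expo_deg:
  assumes "finite A" "Poly_Mapping.keys \<mu> \<subseteq> A"
  shows "Poly_Mapping.lookup (fst (expo_deg \<mu>)) l = (\<Sum>h\<in>A. int (Poly_Mapping.lookup \<mu> h) * Poly_Mapping.lookup (fst h) l)"
    and "Poly_Mapping.lookup (snd (expo_deg \<mu>)) l = (\<Sum>h\<in>A. int (Poly_Mapping.lookup \<mu> h) * Poly_Mapping.lookup (snd h) l)"
  by (simp_all add: expo_deg_superset[OF assms] fst_sum snd_sum lookup_sum del: sum_constant)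
     (simp_all add: sum_constant)

lemma poly_weight_superset:
  assumes "finite A" "Poly_Mapping.keys \<mu> \<subseteq> A"
  shows "poly_weight w \<mu> = (\<Sum>h\<in>A. real (Poly_Mapping.lookup \<mu> h) * w h)"
  unfolding poly_weight_def using assms by (intro sum.mono_neutral_left) (auto simp: in_keys_iff)

context generated_cone
begin

lemma H_D: "h \<in> H \<Longrightarrow> h \<in> D"
  using expo_deg_D[of "Poly_Mapping.single h 1"] by (simp del: One_nat_def)

text \<open>
  If two monomials have the same image in \<open>A(C)\<close>, their difference lies in \<open>J(L)\<close>. Were their weights
  different, its initial form would be a monomial.
\<close>

lemma binomial_weight:
  assumes trop: "w \<in> trop_X r m \<sigma> \<Delta> H (L :: 'k::field ppoint set)" and \<mu>\<nu>: "\<mu> \<in> E" "\<nu> \<in> E" "expo_deg \<mu> = expo_deg \<nu>"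
  shows "poly_weight w \<nu> \<le> poly_weight w \<mu>"
proof (rule ccontr)
  assume less: "\<not> poly_weight w \<nu> \<le> poly_weight w \<mu>"
  let ?f = "Poly_Mapping.single \<mu> (1 :: 'k) - Poly_Mapping.single \<nu> 1"
  have "?f \<in> supported E"
    using \<mu>\<nu>(1,2) keys_diff[of "Poly_Mapping.single \<mu> (1 :: 'k)" "Poly_Mapping.single \<nu> 1"]
    by (auto simp: supported_def)
  moreover have "J_eval m L ?f = 0"
    unfolding J_eval.total_diff J_eval.total_single \<mu>\<nu>(3) by simp
  ultimately have "?f \<in> ideal_J r m \<sigma> \<Delta> H L" unfolding ideal_J_eq by simp
  moreover have "initial_form (poly_weight w) ?f = Poly_Mapping.single \<mu> 1"
    by (rule initial_form_diff[where \<kappa> = "poly_weight w \<mu>"]) (use less in \<open>auto simp: single_neq_0\<close>)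
  ultimately have "Poly_Mapping.single \<mu> 1 \<in> initial_form (poly_weight w) ` ideal_J r m \<sigma> \<Delta> H L"
    by (metis imageI)
  then have "Poly_Mapping.single \<mu> 1 \<in> initial_ideal (mpoly_ring H) (poly_weight w) (ideal_J r m \<sigma> \<Delta> H L)"
    unfolding initial_ideal_def by (rule subsetD[OF genideal_superset])
  then show False using trop \<mu>\<nu>(1) unfolding trop_X_def by blast
qed

text \<open>
  By the previous lemma \<open>w\<close> respects all integral relations between the elements of \<open>H\<close>: such a relation \<open>k\<close>
  is the difference of its positive part \<open>\<mu>\<close> and its negative part \<open>\<nu>\<close>. So \<open>w\<close> is induced by a linear
  form.
\<close>

lemma trop_in_image:
  assumes fin: "finite H" and trop: "w \<in> trop_X r m \<sigma> \<Delta> H (L :: 'k::field ppoint set)"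
  shows "w \<in> weight_map H ` (coord_space r \<times> coord_space m)"
proof -
  define x :: "expo \<Rightarrow> nat + nat \<Rightarrow> int"
    where "x h = case_sum (Poly_Mapping.lookup (fst h)) (Poly_Mapping.lookup (snd h))" for h
  let ?V = "{1..r} <+> {1..m}"
  have coord: "fst h \<in> coord_space r" "snd h \<in> coord_space m" if "h \<in> H" for h
    using H_D[OF that] unfolding dual_pts2_def by (simp_all add: case_prod_unfold)
  have "\<exists>c. \<forall>h\<in>H. w h = (\<Sum>l\<in>?V. c l * of_int (x h l))"
  proof (rule linear_weight_if_relations)
    show "finite ?V" by simp
    show "finite H" by fact
    fix k assume k: "\<And>l. l \<in> ?V \<Longrightarrow> (\<Sum>h\<in>H. k h * x h l) = 0"
    define \<mu> where "\<mu> = (\<Sum>h\<in>H. Poly_Mapping.single h (nat (k h)))"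
    define \<nu> where "\<nu> = (\<Sum>h\<in>H. Poly_Mapping.single h (nat (- k h)))"
    have l\<mu>: "Poly_Mapping.lookup \<mu> h = (if h \<in> H then nat (k h) else 0)" for h
      unfolding \<mu>_def by (rule lookup_sum_single[OF fin])
    have l\<nu>: "Poly_Mapping.lookup \<nu> h = (if h \<in> H then nat (- k h) else 0)" for h
      unfolding \<nu>_def by (rule lookup_sum_single[OF fin])
    have E: "\<mu> \<in> E" "\<nu> \<in> E" by (auto simp: in_keys_iff l\<mu> l\<nu> split: if_splits)
    then have keys: "Poly_Mapping.keys \<mu> \<subseteq> H" "Poly_Mapping.keys \<nu> \<subseteq> H" by auto
    have diff: "int (nat (k h)) - int (nat (- k h)) = k h" for h by simp
    have eq: "(\<Sum>h\<in>H. int (nat (k h)) * y h) = (\<Sum>h\<in>H. int (nat (- k h)) * y h)"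
      if "(\<Sum>h\<in>H. k h * y h) = 0" for y
    proof -
      have "(\<Sum>h\<in>H. int (nat (k h)) * y h) - (\<Sum>h\<in>H. int (nat (- k h)) * y h)
          = (\<Sum>h\<in>H. (int (nat (k h)) - int (nat (- k h))) * y h)"
        unfolding left_diff_distrib sum_subtractf ..
      then show ?thesis using that unfolding diff by simp
    qed
    have fst_rel: "(\<Sum>h\<in>H. k h * Poly_Mapping.lookup (fst h) l) = 0" for l
    proof (cases "l \<in> {1..r}")
      case True
      then have "(\<Sum>h\<in>H. k h * x h (Inl l)) = 0" by (intro k InlI)
      then show ?thesis by (simp add: x_def)
    next
      case False
      then have "Poly_Mapping.lookup (fst h) l = 0" if "h \<in> H" for h
        using coord(1)[OF that] unfolding coord_space_def by (auto simp: in_keys_iff)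
      then show ?thesis by simp
    qed
    have snd_rel: "(\<Sum>h\<in>H. k h * Poly_Mapping.lookup (snd h) l) = 0" for l
    proof (cases "l \<in> {1..m}")
      case True
      then have "(\<Sum>h\<in>H. k h * x h (Inr l)) = 0" by (intro k InrI)
      then show ?thesis by (simp add: x_def)
    next
      case False
      then have "Poly_Mapping.lookup (snd h) l = 0" if "h \<in> H" for h
        using coord(2)[OF that] unfolding coord_space_def by (auto simp: in_keys_iff)
      then show ?thesis by simp
    qed
    have "expo_deg \<mu> = expo_deg \<nu>"
    proof (rule prod_eqI)
      show "fst (expo_deg \<mu>) = fst (expo_deg \<nu>)"
        by (rule poly_mapping_eqI)
           (use eq[OF fst_rel] in \<open>simp add: lookup_expo_deg(1)[OF fin keys(1)] lookup_expo_deg(1)[OF fin keys(2)] l\<mu> l\<nu>\<close>)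
      show "snd (expo_deg \<mu>) = snd (expo_deg \<nu>)"
        by (rule poly_mapping_eqI)
           (use eq[OF snd_rel] in \<open>simp add: lookup_expo_deg(2)[OF fin keys(1)] lookup_expo_deg(2)[OF fin keys(2)] l\<mu> l\<nu>\<close>)
    qed
    then have "poly_weight w \<mu> = poly_weight w \<nu>"
      using binomial_weight[OF trop E] binomial_weight[OF trop E(2,1)] by (intro order_antisym) simp_all
    then have "(\<Sum>h\<in>H. real (nat (k h)) * w h) = (\<Sum>h\<in>H. real (nat (- k h)) * w h)"
      by (simp add: poly_weight_superset[OF fin keys(1)] poly_weight_superset[OF fin keys(2)] l\<mu> l\<nu>)
    then have "(\<Sum>h\<in>H. (real (nat (k h)) - real (nat (- k h))) * w h) = 0"
      unfolding left_diff_distrib sum_subtractf by simp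
    moreover have "real (nat (k h)) - real (nat (- k h)) = of_int (k h)" for h by simp
    ultimately show "(\<Sum>h\<in>H. of_int (k h) * w h) = 0" by simp
  qed
  then obtain c where c: "\<And>h. h \<in> H \<Longrightarrow> w h = (\<Sum>l\<in>?V. c l * of_int (x h l))" by blast
  define a where "a = (\<Sum>l=1..r. Poly_Mapping.single l (c (Inl l)))"
  define b where "b = (\<Sum>l=1..m. Poly_Mapping.single l (c (Inr l)))"
  have la: "Poly_Mapping.lookup a l = (if l \<in> {1..r} then c (Inl l) else 0)" for l
    unfolding a_def by (rule lookup_sum_single) simp
  have lb: "Poly_Mapping.lookup b l = (if l \<in> {1..m} then c (Inr l) else 0)" for l
    unfolding b_def by (rule lookup_sum_single) simp
  have "w h = pairing a (fst h) + pairing b (snd h)" if h: "h \<in> H" for h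
  proof -
    have "pairing a (fst h) = (\<Sum>l=1..r. c (Inl l) * of_int (x h (Inl l)))"
      unfolding pairing_coord_space[OF coord(1)[OF h]] by (rule sum.cong) (simp_all add: la x_def)
    moreover have "pairing b (snd h) = (\<Sum>l=1..m. c (Inr l) * of_int (x h (Inr l)))"
      unfolding pairing_coord_space[OF coord(2)[OF h]] by (rule sum.cong) (simp_all add: lb x_def)
    ultimately show ?thesis unfolding c[OF h] by (simp add: sum.Plus)
  qed
  then have "w = weight_map H (a, b)"
    using trop unfolding weight_map_def trop_X_def
    by (intro extensionalityI[of _ H]) (auto simp: case_prod_unfold)
  moreover have "a \<in> coord_space r" "b \<in> coord_space m" unfolding a_def b_def by (rule sum_single_coord_space)+
  ultimately show ?thesis by blast
qed

end

section \<open>Initial ideals\<close>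

text \<open>
  The weight \<open>w = \<phi>(a, b)\<close> of a monomial of \<open>S\<close> is the weight of its image in \<open>A(C)\<close>, and in a fixed degree
  \<open>u\<close> it differs from the \<open>b\<close>-weight by the constant \<open>\<langle>a, u\<rangle>\<close>.
\<close>

locale toric_degeneration = generated_cone r m \<sigma> \<Delta> H + adapted_line m b j k p q L
  for r m \<sigma> \<Delta> H b j k and p q :: "nat \<Rightarrow> 'k::field" and L +
  fixes a :: "nat \<Rightarrow>\<^sub>0 real" and w :: "expo \<Rightarrow> real"
  assumes weight: "h \<in> H \<Longrightarrow> w h = pairing a (fst h) + pairing b (snd h)"
begin

lemma torus_line_L: "torus_line m L"
  using inf basis_L meets_L by unfold_locales (auto simp: is_line_def)

lemma poly_weight_eq:
  assumes "\<mu> \<in> E"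
  shows "poly_weight w \<mu> = pairing a (fst (expo_deg \<mu>)) + pairing b (snd (expo_deg \<mu>))"
proof -
  have "poly_weight w \<mu> = (\<Sum>h\<in>Poly_Mapping.keys \<mu>. real (Poly_Mapping.lookup \<mu> h) * (pairing a (fst h) + pairing b (snd h)))"
    unfolding poly_weight_def using assms weight by (intro sum.cong) auto
  then show ?thesis
    by (simp add: expo_deg_def fst_sum snd_sum pairing_sum_right sum.distrib distrib_left del: sum_constant)
       (simp add: sum_constant)
qed

text \<open>
  The lift of \<open>lift_homogeneous\<close>, carried from Laurent polynomials to \<open>S\<close>. The correction lies in \<open>A(C)\<close> by
  the hypothesis on \<open>\<delta>\<close>, and each of its monomials is the image of a monomial of \<open>S\<close> because \<open>H\<close> generates
  the semigroup. Elements of the toric ideal, for which \<open>component u f = 0\<close>, are included.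
\<close>

lemma homogeneous_initial_form:
  assumes f: "f \<in> supported E" "f \<noteq> 0"
    and deg: "\<And>\<mu>. \<mu> \<in> Poly_Mapping.keys f \<Longrightarrow> fst (expo_deg \<mu>) = u"
      "\<And>\<mu>. \<mu> \<in> Poly_Mapping.keys f \<Longrightarrow> pairing b (snd (expo_deg \<mu>)) = \<kappa>"
    and \<delta>: "expo_bound m \<delta> (component u f)"
    and cone: "\<And>v. v \<in> coord_space m \<Longrightarrow> (\<And>i. i \<le> m \<Longrightarrow> \<delta> i \<le> hom_exp m v i) \<Longrightarrow> (u, v) \<in> D"
    and van: "hom_eval m \<delta> Y0 (component u f) = 0"
  shows "f \<in> initial_form (poly_weight w) ` ideal_J r m \<sigma> \<Delta> H L"
proof -
  let ?g = "component u f"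
  have "pairing b v = \<kappa>" if "v \<in> Poly_Mapping.keys ?g" for v
    using that keys_component[of u f] deg(2) by auto
  then obtain G where G: "expo_bound m \<delta> G" "\<And>v. v \<in> Poly_Mapping.keys G \<Longrightarrow> \<kappa> < pairing b v"
      "hom_eval m \<delta> Y (?g - G) = 0"
    using lift_homogeneous[OF \<delta> van] by blast
  define M where "M v = (SOME \<mu>. \<mu> \<in> E \<and> expo_deg \<mu> = (u, v))" for v
  have M: "M v \<in> E" "expo_deg (M v) = (u, v)" if "v \<in> Poly_Mapping.keys G" for v
  proof -
    have "(u, v) \<in> D" using G(1) that by (intro cone) (auto simp: expo_bound_def)
    then have "\<exists>\<mu>. \<mu> \<in> E \<and> expo_deg \<mu> = (u, v)" by (rule expo_deg_surj) blast
    then have "M v \<in> E \<and> expo_deg (M v) = (u, v)" unfolding M_def by (rule someI_ex)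
    then show "M v \<in> E" "expo_deg (M v) = (u, v)" by blast+
  qed
  define F where "F = (\<Sum>v\<in>Poly_Mapping.keys G. Poly_Mapping.single (M v) (Poly_Mapping.lookup G v))"
  have keysF: "Poly_Mapping.keys F \<subseteq> M ` Poly_Mapping.keys G"
    unfolding F_def by (rule order_trans[OF keys_sum]) (auto split: if_splits)
  then have F: "F \<in> supported E" using M(1) unfolding supported_def by blast
  have compF: "component u' F = (if u' = u then G else 0)" for u'
  proof -
    have "component u' F = (\<Sum>v\<in>Poly_Mapping.keys G. if u' = u then Poly_Mapping.single v (Poly_Mapping.lookup G v) else 0)"
      unfolding F_def component.total_sum component.total_single
      by (rule sum.cong) (auto simp: M(2))
    then show ?thesis by (simp flip: poly_mapping_decompose)
  qed
  have compf: "component u' f = 0" if "u' \<noteq> u" for u'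
    unfolding component_def using deg(1) that by (intro sum.neutral) auto
  have "component u' (f - F) \<in> line_ideal m L" for u'
  proof (cases "u' = u")
    case True
    have "expo_bound m \<delta> (?g - G)"
      using \<delta> G(1) keys_diff[of ?g G] unfolding expo_bound_def by blast
    then show ?thesis using G(3) line_ideal_L_iff True by (simp add: component.total_diff compF)
  next
    case False
    have "(0 :: (nat \<Rightarrow>\<^sub>0 int) \<Rightarrow>\<^sub>0 'k) \<in> line_ideal m L"
      by (simp add: line_ideal_def laurent_ring_supported supported_def laurent_eval_def)
    then show ?thesis using False by (simp add: component.total_diff compF compf)
  qed
  moreover have "f - F \<in> supported E"
    using f(1) F keys_diff[of f F] unfolding supported_def by blast
  ultimately have "f - F \<in> ideal_J r m \<sigma> \<Delta> H L" unfolding ideal_J_iff[OF torus_line_L] by blast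
  moreover have "initial_form (poly_weight w) (f - F) = f"
  proof (rule initial_form_diff[where \<kappa> = "pairing a u + \<kappa>"])
    show "poly_weight w \<mu> = pairing a u + \<kappa>" if "\<mu> \<in> Poly_Mapping.keys f" for \<mu>
    proof -
      have "\<mu> \<in> E" using f(1) that unfolding supported_def by blast
      then show ?thesis by (simp add: poly_weight_eq deg that)
    qed
    show "pairing a u + \<kappa> < poly_weight w \<mu>" if \<mu>: "\<mu> \<in> Poly_Mapping.keys F" for \<mu>
    proof -
      obtain v where v: "v \<in> Poly_Mapping.keys G" "\<mu> = M v" using keysF \<mu> by blast
      then show ?thesis using M[OF v(1)] G(2)[OF v(1)] by (simp add: poly_weight_eq del: mem_Collect_eq)
    qed
  qed (fact f(2))
  ultimately show ?thesis by (metis imageI)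
qed

text \<open>
  If \<open>y\<^bsub>i0\<^esub>\<close> vanished on the limit line, every monomial of \<open>A(C)\<close> divisible by it would be an initial form
  of an element of the ideal of \<open>X(L)\<close>, by the lift above. Such a monomial exists by \<open>slack_point\<close>, and it
  is the image of a monomial of \<open>S\<close>, which contradicts the choice of \<open>w\<close>.
\<close>

lemma Y0_nonzero_if_trop:
  assumes poly: "\<And>i. i \<le> m \<Longrightarrow> \<Delta> i = {} \<or> rat_polyhedron r (\<Delta> i) \<and> tailcone r (\<Delta> i) = \<sigma>"
    and sub: "(\<Sum>i\<le>m. \<Delta> i) \<subset> \<sigma>" and trop: "w \<in> trop_X r m \<sigma> \<Delta> H L" and i0: "i0 \<le> m"
  shows "Y0 i0 \<noteq> 0"
proof
  assume zero: "Y0 i0 = 0"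
  have "\<exists>u\<in>coord_space r. \<exists>v\<in>coord_space m. (\<forall>s\<in>\<sigma>. 0 \<le> pairing s u) \<and>
    (\<forall>i\<le>m. \<forall>s\<in>\<Delta> i. (if i = i0 then 1 else 0) \<le> pairing s u + of_int (hom_exp m v i))"
    by (rule slack_point[OF poly sub i0])
  then obtain u v where uv: "u \<in> coord_space r" "v \<in> coord_space m" "\<forall>s\<in>\<sigma>. 0 \<le> pairing s u"
    and slack: "\<forall>i\<le>m. \<forall>s\<in>\<Delta> i. (if i = i0 then 1 else 0) \<le> pairing s u + of_int (hom_exp m v i)"
    by (elim bexE conjE) (rule that)
  define \<delta> where "\<delta> i = hom_exp m v i - (if i = i0 then 1 else 0)" for i
  have cone: "(u, v') \<in> D" if v': "v' \<in> coord_space m" "\<And>i. i \<le> m \<Longrightarrow> \<delta> i \<le> hom_exp m v' i" for v'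
  proof -
    have "0 \<le> pairing s u + of_int (hom_exp m v' i)" if "i \<le> m" "s \<in> \<Delta> i" for i s
    proof -
      have *: "of_int (\<delta> i) \<le> (of_int (hom_exp m v' i) :: rat)" using v'(2)[OF that(1)] by (simp only: of_int_le_iff)
      note ** = slack[rule_format, OF that]
      show ?thesis
      proof (cases "i = i0")
        case True
        have "of_int (hom_exp m v i) - 1 \<le> (of_int (hom_exp m v' i) :: rat)" using * True by (simp add: \<delta>_def)
        moreover have "1 \<le> pairing s u + of_int (hom_exp m v i)" using ** True by simp
        ultimately show ?thesis by linarith
      next
        case False
        have "of_int (hom_exp m v i) \<le> (of_int (hom_exp m v' i) :: rat)" using * False by (simp add: \<delta>_def)
        moreover have "0 \<le> pairing s u + of_int (hom_exp m v i)" using ** False by simp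
        ultimately show ?thesis by linarith
      qed
    qed
    then show ?thesis unfolding dual_pts2_iff using uv(1,3) v'(1) by blast
  qed
  have "(u, v) \<in> D" using uv(2) by (rule cone) (simp add: \<delta>_def)
  then obtain \<mu> where \<mu>: "\<mu> \<in> E" "expo_deg \<mu> = (u, v)" by (rule expo_deg_surj)
  let ?f = "Poly_Mapping.single \<mu> (1 :: 'k)"
  have comp: "component u ?f = Poly_Mapping.single v 1"
    unfolding component.total_single by (simp add: \<mu>(2))
  have "hom_monomial m \<delta> Y0 v = 0"
    unfolding hom_monomial_def using i0 zero
    by (intro prod_zero bexI[of _ i0]) (auto simp: \<delta>_def)
  then have van: "hom_eval m \<delta> Y0 (component u ?f) = 0"
    unfolding comp hom_eval.total_single by simp
  have "?f \<in> initial_form (poly_weight w) ` ideal_J r m \<sigma> \<Delta> H L"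
  proof (rule homogeneous_initial_form[OF _ _ _ _ _ cone van])
    show "?f \<in> supported E" using \<mu>(1) by (simp add: supported_def)
    show "?f \<noteq> 0" by (simp add: single_neq_0)
    show "fst (expo_deg \<mu>') = u" if "\<mu>' \<in> Poly_Mapping.keys ?f" for \<mu>' using that \<mu>(2) by simp
    show "pairing b (snd (expo_deg \<mu>')) = pairing b v" if "\<mu>' \<in> Poly_Mapping.keys ?f" for \<mu>' using that \<mu>(2) by simp
    show "expo_bound m \<delta> (component u ?f)" unfolding comp expo_bound_def using uv(2) by (simp add: \<delta>_def)
  qed
  then have "?f \<in> initial_ideal (mpoly_ring H) (poly_weight w) (ideal_J r m \<sigma> \<Delta> H L)"
    unfolding initial_ideal_def by (rule subsetD[OF genideal_superset])
  then show False using trop \<mu>(1) unfolding trop_X_def by blast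
qed

lemma component_filter:
  assumes "f \<in> supported E"
  shows "component u (filter_keys (\<lambda>\<mu>. fst (expo_deg \<mu>) = u \<and> pairing b (snd (expo_deg \<mu>)) = \<kappa>) f)
       = filter_keys (\<lambda>v. pairing b v = \<kappa>) (component u f)"
    and "component u (filter_keys (\<lambda>\<mu>. poly_weight w \<mu> = \<omega>) f)
       = filter_keys (\<lambda>v. pairing b v = \<omega> - pairing a u) (component u f)"
proof -
  have r: "filter_keys (\<lambda>v. pairing b v = x) (component u f)
    = (\<Sum>\<mu>\<in>Poly_Mapping.keys f. if fst (expo_deg \<mu>) = u \<and> pairing b (snd (expo_deg \<mu>)) = x
         then Poly_Mapping.single (snd (expo_deg \<mu>)) (Poly_Mapping.lookup f \<mu>) else 0)" for x
    unfolding component_def filter_keys.total_sum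
    by (rule sum.cong) (auto simp: filter_keys.total_single filter_keys.total_zero)
  show "component u (filter_keys (\<lambda>\<mu>. fst (expo_deg \<mu>) = u \<and> pairing b (snd (expo_deg \<mu>)) = \<kappa>) f)
       = filter_keys (\<lambda>v. pairing b v = \<kappa>) (component u f)"
    unfolding r component.total_filter_keys by (rule sum.cong) auto
  show "component u (filter_keys (\<lambda>\<mu>. poly_weight w \<mu> = \<omega>) f)
       = filter_keys (\<lambda>v. pairing b v = \<omega> - pairing a u) (component u f)"
    unfolding r component.total_filter_keys
  proof (rule sum.cong)
    fix \<mu> assume "\<mu> \<in> Poly_Mapping.keys f"
    then have "\<mu> \<in> E" using assms unfolding supported_def by blast
    from poly_weight_eq[OF this]
    show "(if poly_weight w \<mu> = \<omega> then if fst (expo_deg \<mu>) = u then Poly_Mapping.single (snd (expo_deg \<mu>)) (Poly_Mapping.lookup f \<mu>) else 0 else 0)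
      = (if fst (expo_deg \<mu>) = u \<and> pairing b (snd (expo_deg \<mu>)) = \<omega> - pairing a u
         then Poly_Mapping.single (snd (expo_deg \<mu>)) (Poly_Mapping.lookup f \<mu>) else 0)" by auto
  qed simp
qed

end

locale toric_degeneration_limit = toric_degeneration r m \<sigma> \<Delta> H b j k p q L a w + limit_line m b j k p q L
  for r m \<sigma> \<Delta> H b j k and p q :: "nat \<Rightarrow> 'k::field" and L a w
begin

lemma torus_line_L0: "torus_line m L0"
  using inf line_basis_L0 meets_L0 by unfold_locales (auto simp: is_line_def)

text \<open>
  In each degree \<open>u\<close> the terms of minimal \<open>w\<close>-weight \<open>\<omega>\<close> have \<open>b\<close>-weight \<open>\<omega> - \<langle>a, u\<rangle>\<close>, and the other terms have
  larger \<open>b\<close>-weight, so the part of this \<open>b\<close>-weight vanishes on the limit line.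
\<close>

lemma initial_form_in_J_L0:
  assumes "f \<in> ideal_J r m \<sigma> \<Delta> H L"
  shows "initial_form (poly_weight w) f \<in> ideal_J r m \<sigma> \<Delta> H L0"
proof -
  have f: "f \<in> supported E" "\<And>u. component u f \<in> line_ideal m L"
    using assms unfolding ideal_J_iff[OF torus_line_L] by blast+
  obtain \<omega> where \<omega>: "\<forall>\<mu>\<in>Poly_Mapping.keys f. \<omega> \<le> poly_weight w \<mu>"
    "initial_form (poly_weight w) f = filter_keys (\<lambda>\<mu>. poly_weight w \<mu> = \<omega>) f"
    using initial_form_min[of f "poly_weight w"] by (elim exE conjE)
  have "component u (initial_form (poly_weight w) f) \<in> line_ideal m L0" for u
    unfolding \<omega>(2) component_filter(2)[OF f(1)]
  proof (rule initial_part_line_ideal[OF f(2)])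
    fix v assume "v \<in> Poly_Mapping.keys (component u f)"
    then obtain \<mu> where \<mu>: "\<mu> \<in> Poly_Mapping.keys f" "fst (expo_deg \<mu>) = u" "snd (expo_deg \<mu>) = v"
      using keys_component[of u f] by blast
    have "\<mu> \<in> E" using f(1) \<mu>(1) unfolding supported_def by blast
    from poly_weight_eq[OF this] show "\<omega> - pairing a u \<le> pairing b v"
      using bspec[OF \<omega>(1) \<mu>(1)] \<mu>(2,3) by simp
  qed
  then show ?thesis unfolding ideal_J_iff[OF torus_line_L0] using initial_form_supported[OF f(1)] by blast
qed

text \<open>
  The bound \<open>\<delta>\<close> is attained by monomials of \<open>g\<close> in every coordinate. As the condition for \<open>(u, v) \<in> D\<close> concerns
  one exponent at a time, every \<open>v\<close> above \<open>\<delta>\<close> gives a monomial of \<open>A(C)\<close>, also when some \<open>\<Delta>\<^sub>i\<close> is empty.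
\<close>

lemma homogeneous_part_initial:
  assumes "f \<in> ideal_J r m \<sigma> \<Delta> H L0"
    and g_def: "g = filter_keys (\<lambda>\<mu>. fst (expo_deg \<mu>) = u \<and> pairing b (snd (expo_deg \<mu>)) = \<kappa>) f" and "g \<noteq> 0"
  shows "g \<in> initial_form (poly_weight w) ` ideal_J r m \<sigma> \<Delta> H L"
proof -
  have f: "f \<in> supported E" "component u f \<in> line_ideal m L0"
    using assms(1) unfolding ideal_J_iff[OF torus_line_L0] by blast+
  have keysg: "Poly_Mapping.keys g = {\<mu> \<in> Poly_Mapping.keys f. fst (expo_deg \<mu>) = u \<and> pairing b (snd (expo_deg \<mu>)) = \<kappa>}"
    unfolding g_def by (rule keys_filter_keys)
  have g: "g \<in> supported E" using f(1) unfolding supported_def mem_Collect_eq keysg by blast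
  have gE: "\<mu> \<in> E" if "\<mu> \<in> Poly_Mapping.keys g" for \<mu> using g that unfolding supported_def by blast
  have ideal: "component u g \<in> line_ideal m L0"
    unfolding g_def component_filter(1)[OF f(1)] by (rule homogeneous_part_line_ideal[OF f(2)])
  define \<delta> where "\<delta> i = Min ((\<lambda>\<mu>. hom_exp m (snd (expo_deg \<mu>)) i) ` Poly_Mapping.keys g)" for i
  have \<delta>_le: "\<delta> i \<le> hom_exp m (snd (expo_deg \<mu>)) i" if "\<mu> \<in> Poly_Mapping.keys g" for \<mu> i
    unfolding \<delta>_def using that by (intro Min_le) auto
  have \<delta>_eq: "\<exists>\<mu>\<in>Poly_Mapping.keys g. \<delta> i = hom_exp m (snd (expo_deg \<mu>)) i" for i
  proof -
    have "Poly_Mapping.keys g \<noteq> {}" using \<open>g \<noteq> 0\<close> by simp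
    then have "\<delta> i \<in> (\<lambda>\<mu>. hom_exp m (snd (expo_deg \<mu>)) i) ` Poly_Mapping.keys g"
      unfolding \<delta>_def by (intro Min_in) auto
    then show ?thesis by blast
  qed
  have bound: "expo_bound m \<delta> (component u g)"
    unfolding expo_bound_def
  proof (intro conjI subsetI ballI allI impI)
    fix v assume "v \<in> Poly_Mapping.keys (component u g)"
    then obtain \<mu> where \<mu>: "\<mu> \<in> Poly_Mapping.keys g" "v = snd (expo_deg \<mu>)"
      using keys_component[of u g] by blast
    show "v \<in> coord_space m" unfolding \<mu>(2) by (rule snd_expo_deg[OF gE[OF \<mu>(1)]])
    show "\<delta> i \<le> hom_exp m v i" for i unfolding \<mu>(2) by (rule \<delta>_le[OF \<mu>(1)])
  qed
  have cone: "(u, v) \<in> D" if v: "v \<in> coord_space m" "\<And>i. i \<le> m \<Longrightarrow> \<delta> i \<le> hom_exp m v i" for v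
  proof -
    have mem: "(u, snd (expo_deg \<mu>)) \<in> D" if "\<mu> \<in> Poly_Mapping.keys g" for \<mu>
      using expo_deg_D[OF gE[OF that]] that unfolding keysg by (cases "expo_deg \<mu>") simp
    obtain \<mu>0 where "\<mu>0 \<in> Poly_Mapping.keys g" using \<delta>_eq by blast
    from mem[OF this] have u: "u \<in> coord_space r" "\<forall>s\<in>\<sigma>. 0 \<le> pairing s u"
      unfolding dual_pts2_iff by blast+
    have "0 \<le> pairing s u + of_int (hom_exp m v i)" if "i \<le> m" "s \<in> \<Delta> i" for i s
    proof -
      obtain \<mu> where \<mu>: "\<mu> \<in> Poly_Mapping.keys g" "\<delta> i = hom_exp m (snd (expo_deg \<mu>)) i" using \<delta>_eq by blast
      have "0 \<le> pairing s u + of_int (hom_exp m (snd (expo_deg \<mu>)) i)"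
        using mem[OF \<mu>(1)] that unfolding dual_pts2_iff by blast
      moreover have "(of_int (hom_exp m (snd (expo_deg \<mu>)) i) :: rat) \<le> of_int (hom_exp m v i)"
        using v(2)[OF that(1)] \<mu>(2) by simp
      ultimately show ?thesis by linarith
    qed
    then show ?thesis unfolding dual_pts2_iff using u v(1) by blast
  qed
  show ?thesis
  proof (rule homogeneous_initial_form[OF g \<open>g \<noteq> 0\<close> _ _ bound cone])
    show "fst (expo_deg \<mu>) = u" if "\<mu> \<in> Poly_Mapping.keys g" for \<mu> using that unfolding keysg by blast
    show "pairing b (snd (expo_deg \<mu>)) = \<kappa>" if "\<mu> \<in> Poly_Mapping.keys g" for \<mu> using that unfolding keysg by blast
    show "hom_eval m \<delta> Y0 (component u g) = 0" using ideal line_ideal_L0_iff[OF bound] by blast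
  qed
qed

text \<open>
  For the inclusion from right to left, an element of \<open>J(L0)\<close> is split into its parts that are
  homogeneous for both the degree in \<open>M\<close> and the \<open>b\<close>-weight; each part is an initial form.
\<close>

theorem initial_ideal_J:
  "initial_ideal (mpoly_ring H) (poly_weight w) (ideal_J r m \<sigma> \<Delta> H L) = ideal_J r m \<sigma> \<Delta> H L0"
proof (rule subset_antisym)
  show "initial_ideal (mpoly_ring H) (poly_weight w) (ideal_J r m \<sigma> \<Delta> H L) \<subseteq> ideal_J r m \<sigma> \<Delta> H L0"
    unfolding initial_ideal_def
    by (rule genideal_least[OF ideal_ideal_J[OF torus_line_L0]]) (use initial_form_in_J_L0 in blast)
  show "ideal_J r m \<sigma> \<Delta> H L0 \<subseteq> initial_ideal (mpoly_ring H) (poly_weight w) (ideal_J r m \<sigma> \<Delta> H L)"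
  proof
    fix f assume f: "f \<in> ideal_J r m \<sigma> \<Delta> H L0"
    let ?X = "initial_form (poly_weight w) ` ideal_J r m \<sigma> \<Delta> H L"
    let ?I = "genideal (mpoly_ring H) ?X"
    have "?X \<subseteq> supported E" using initial_form_supported unfolding ideal_J_eq by blast
    then have ideal: "ideal ?I (carrier_ring (supported E))"
      unfolding mpoly_ring_supported by (rule ideal_genideal[OF submonoid_exponents])
    define ty where "ty \<mu> = (fst (expo_deg \<mu>), pairing b (snd (expo_deg \<mu>)))" for \<mu>
    have "f = (\<Sum>x\<in>ty ` Poly_Mapping.keys f. filter_keys (\<lambda>\<mu>. ty \<mu> = x) f)"
    proof (rule poly_mapping_eqI)
      fix \<mu>
      have "Poly_Mapping.lookup (\<Sum>x\<in>ty ` Poly_Mapping.keys f. filter_keys (\<lambda>\<mu>. ty \<mu> = x) f) \<mu>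
        = (\<Sum>x\<in>ty ` Poly_Mapping.keys f. if ty \<mu> = x then Poly_Mapping.lookup f \<mu> else 0)"
        by (simp add: lookup_sum lookup_filter_keys)
      also have "\<dots> = (if ty \<mu> \<in> ty ` Poly_Mapping.keys f then Poly_Mapping.lookup f \<mu> else 0)"
        by simp
      also have "\<dots> = Poly_Mapping.lookup f \<mu>"
        by (cases "\<mu> \<in> Poly_Mapping.keys f") (simp_all add: in_keys_iff)
      finally show "Poly_Mapping.lookup f \<mu> = Poly_Mapping.lookup (\<Sum>x\<in>ty ` Poly_Mapping.keys f. filter_keys (\<lambda>\<mu>. ty \<mu> = x) f) \<mu>" ..
    qed
    moreover have "filter_keys (\<lambda>\<mu>. ty \<mu> = x) f \<in> ?I" if "x \<in> ty ` Poly_Mapping.keys f" for x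
    proof -
      obtain u \<kappa> where x: "x = (u, \<kappa>)" by (cases x)
      let ?g = "filter_keys (\<lambda>\<mu>. fst (expo_deg \<mu>) = u \<and> pairing b (snd (expo_deg \<mu>)) = \<kappa>) f"
      have eq: "filter_keys (\<lambda>\<mu>. ty \<mu> = x) f = ?g" unfolding ty_def x prod.inject ..
      have "Poly_Mapping.keys (filter_keys (\<lambda>\<mu>. ty \<mu> = x) f) \<noteq> {}" using that unfolding keys_filter_keys by blast
      then have "?g \<noteq> 0" unfolding eq by simp
      then show ?thesis unfolding eq
        using homogeneous_part_initial[OF f refl] genideal_superset[of ?X "mpoly_ring H"] by blast
    qed
    ultimately show "f \<in> initial_ideal (mpoly_ring H) (poly_weight w) (ideal_J r m \<sigma> \<Delta> H L)"
      unfolding initial_ideal_def using sum_in_ideal[OF submonoid_exponents ideal] by metis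
  qed
qed

end

theorem theorem4p9:
  fixes r m :: nat
    and \<sigma> :: "(nat \<Rightarrow>\<^sub>0 rat) set"
    and \<Delta> :: "nat \<Rightarrow> (nat \<Rightarrow>\<^sub>0 rat) set"
    and H :: "expo set"
    and L :: "'k::alg_closed_field ppoint set"
  assumes "m \<ge> 1"
    and "pointed_polyhedral_cone r \<sigma>"
    and "\<And>i. i \<le> m \<Longrightarrow> \<Delta> i = {} \<or> rat_polyhedron r (\<Delta> i) \<and> tailcone r (\<Delta> i) = \<sigma>"
    and "(\<Sum>i\<le>m. \<Delta> i) \<subset> \<sigma>"
    and "finite H"
    and "{sum_list hs | hs. set hs \<subseteq> H} = dual_pts2 r m (big_cone m \<sigma> \<Delta>)"
    and "is_line m L"
    and "open_part m L \<noteq> {}"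
  shows "(\<forall>w\<in>trop_X r m \<sigma> \<Delta> H L.
            initial_ideal (mpoly_ring H) (poly_weight w) (ideal_J r m \<sigma> \<Delta> H L)
              = ideal_J r m \<sigma> \<Delta> H (initial_line r m H L w)) \<and>
         (\<forall>w\<in>trop_X r m \<sigma> \<Delta> H L.
            primeideal (initial_ideal (mpoly_ring H) (poly_weight w) (ideal_J r m \<sigma> \<Delta> H L))
              (mpoly_ring H))"
proof -
  have main: "initial_ideal (mpoly_ring H) (poly_weight w) (ideal_J r m \<sigma> \<Delta> H L)
        = ideal_J r m \<sigma> \<Delta> H (initial_line r m H L w) \<and>
      primeideal (ideal_J r m \<sigma> \<Delta> H (initial_line r m H L w)) (mpoly_ring H)"
    if w: "w \<in> trop_X r m \<sigma> \<Delta> H L" for w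
  proof -
    interpret generated_cone r m \<sigma> \<Delta> H by unfold_locales (fact assms(6))
    have image: "w \<in> weight_map H ` (coord_space r \<times> coord_space m)" by (rule trop_in_image[OF assms(5) w])
    obtain a b where ab: "inv_into (coord_space r \<times> coord_space m) (weight_map H) w = (a, b)"
      by (cases "inv_into (coord_space r \<times> coord_space m) (weight_map H) w")
    have wab: "weight_map H (a, b) = w" unfolding ab[symmetric] by (rule f_inv_into_f[OF image])
    have weight: "w h = pairing a (fst h) + pairing b (snd h)" if "h \<in> H" for h
      using that unfolding wab[symmetric] weight_map_def by (simp add: case_prod_unfold)
    obtain j k p q where adapted: "adapted_basis m b j k p q" and basis: "line_basis m L (p, q)"
      by (rule adapted_basis_exists[OF infinite_UNIV_alg_closed assms(7)])
    interpret adapted_basis m b j k p q by (fact adapted)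
    interpret toric_degeneration r m \<sigma> \<Delta> H b j k p q L a w
      by unfold_locales (fact basis assms(8) weight)+
    interpret toric_degeneration_limit r m \<sigma> \<Delta> H b j k p q L a w
      by unfold_locales (rule Y0_nonzero_if_trop[OF assms(3,4) w])
    have "initial_line r m H L w = L0"
      unfolding initial_line_def ab Let_def prod.case by (rule closure_torus_locus_initial)
    then show ?thesis using initial_ideal_J prime_ideal_J[OF torus_line_L0] by simp
  qed
  then show ?thesis by simp
qed

end
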